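(* Let $\tau:E\to M$ be a smooth vector bundle and let $[\cdot,\cdot]$ be a Loday bracket on the real vector space $\mathrm{Sec}(E)$ of smooth sections of $E$. Then $[\cdot,\cdot]$ defines a Loday algebroid structure on $E$ if and only if there are vector bundle morphisms $$\rho:E\to TM,\qquad \alpha:E\to TM\otimes_M\mathrm{End}(E),$$ covering the identity on $M$, such that, for all $X,Y\in\mathrm{Sec}(E)$ and all $f\in C^\infty(M)$, $$[X,fY]=f[X,Y]+\rho(X)(f)\,Y,\qquad [fX,Y]=f[X,Y]-\rho(Y)(f)\,X+\alpha(Y)(\mathrm{d}f\otimes X).$$ If this is the case, the maps $\rho$ and $\alpha$ are uniquely determined, and $\rho$ induces a homomorphism of the Loday bracket into the Lie bracket $[\cdot,\cdot]_{vf}$ of vector fields on $M$: $\rho([X,Y])=[\rho(X),\rho(Y)]_{vf}$ for all $X,Y\in\mathrm{Sec}(E)$.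
   Context: All manifolds, bundles, maps and sections are smooth. A Loday bracket on a real vector space $V$ is an $\mathbb{R}$-bilinear map $[\cdot,\cdot]:V\times V\to V$ (not necessarily skew-symmetric) satisfying $[x,[y,z]]=[[x,y],z]+[y,[x,z]]$ for all $x,y,z\in V$. Write $\mathcal{A}=C^\infty(M)$. For an $\mathbb{R}$-bilinear map $B:\mathrm{Sec}(E)\times\mathrm{Sec}(E)\to\mathrm{Sec}(E)$ and $f\in\mathcal{A}$ put $(\delta_1(f)B)(X,Y)=B(fX,Y)-fB(X,Y)$ and $(\delta_2(f)B)(X,Y)=B(X,fY)-fB(X,Y)$. $B$ is a bidifferential operator of total order (degree) $\le 1$ if $\delta_i(f)\delta_j(g)B=0$ for all $f,g\in\mathcal{A}$ and all $i,j\in\{1,2\}$. An $\mathbb{R}$-linear map $D:\mathrm{Sec}(E)\to\mathrm{Sec}(E)$ is a derivative endomorphism if for every $f\in\mathcal{A}$ there is $\hat f\in\mathcal{A}$ such that $D(fY)-fD(Y)=\hat f\,Y$ for all $Y\in\mathrm{Sec}(E)$. A Loday algebroid structure on $E$ is a Loday bracket on $\mathrm{Sec}(E)$ which is a bidifferential operator of total order $\le 1$ and for which every adjoint operator $\mathrm{ad}_X=[X,\cdot]$, $X\in\mathrm{Sec}(E)$, is a derivative endomorphism. $\mathrm{End}(E)$ is the endomorphism bundle of $E$; for a section $X$ of $E$, $\rho(X)=\rho\circ X$ is a vector field and $\alpha(X)$ is a section of $TM\otimes_M\mathrm{End}(E)$. Sections of $TM\otimes_M\mathrm{End}(E)$ act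 on sections of $T^*M\otimes_M E$ by $(V\otimes\Phi)(\omega\otimes X)=\langle V,\omega\rangle\,\Phi(X)$. *)

theory Defs
  imports "HOL-Analysis.Analysis" "HOL-Library.Function_Algebras"
begin

section \<open>Linear algebra on subspaces\<close>

instantiation "fun" :: (type, real_vector) real_vector
begin

definition scaleR_fun :: "real \<Rightarrow> ('a \<Rightarrow> 'b) \<Rightarrow> 'a \<Rightarrow> 'b"
  where "scaleR_fun c f = (\<lambda>x. c *\<^sub>R f x)"

instance
  by standard (simp_all add: scaleR_fun_def fun_eq_iff scaleR_add_right scaleR_add_left)

end

definition lin_on :: "'a::real_vector set \<Rightarrow> 'b::real_vector set \<Rightarrow> ('a \<Rightarrow> 'b) \<Rightarrow> bool"
  where "lin_on S T h \<longleftrightarrow>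
    (\<forall>x\<in>S. h x \<in> T) \<and>
    (\<forall>x\<in>S. \<forall>y\<in>S. h (x + y) = h x + h y) \<and>
    (\<forall>c. \<forall>x\<in>S. h (c *\<^sub>R x) = c *\<^sub>R h x)"

definition bilin_on ::
    "'a::real_vector set \<Rightarrow> 'b::real_vector set \<Rightarrow> 'c::real_vector set \<Rightarrow> ('a \<Rightarrow> 'b \<Rightarrow> 'c) \<Rightarrow> bool"
  where "bilin_on S T U b \<longleftrightarrow>
    (\<forall>x\<in>S. lin_on T U (b x)) \<and> (\<forall>y\<in>T. lin_on S U (\<lambda>x. b x y))"

text \<open>Linear maps defined on a subspace only are represented by functions vanishing outside it,
  so that equality of functions is equality of linear maps.\<close>

definition dual_space :: "'a::real_vector set \<Rightarrow> ('a \<Rightarrow> real) set"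
  where "dual_space S = {\<omega>. lin_on S UNIV \<omega> \<and> (\<forall>x. x \<notin> S \<longrightarrow> \<omega> x = 0)}"

definition endo_space :: "'a::real_vector set \<Rightarrow> ('a \<Rightarrow> 'a) set"
  where "endo_space S = {\<Phi>. lin_on S S \<Phi> \<and> (\<forall>x. x \<notin> S \<longrightarrow> \<Phi> x = 0)}"

text \<open>The tensor product of \<open>S\<close> and \<open>T\<close>, realised inside the dual of the space of bilinear forms on
  \<open>S \<times> T\<close>: a pure tensor \<open>s \<otimes> t\<close> is the functional sending a bilinear form \<open>b\<close> to \<open>b s t\<close>, and
  the tensor product is the linear span of the pure tensors.\<close>

definition pure_tensor ::
    "'a::real_vector set \<Rightarrow> 'b::real_vector set \<Rightarrow> 'a \<Rightarrow> 'b \<Rightarrow> ('a \<Rightarrow> 'b \<Rightarrow> real) \<Rightarrow> real"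
  where "pure_tensor S T s t = (\<lambda>b. if bilin_on S T UNIV b then b s t else 0)"

definition tensor_space ::
    "'a::real_vector set \<Rightarrow> 'b::real_vector set \<Rightarrow> (('a \<Rightarrow> 'b \<Rightarrow> real) \<Rightarrow> real) set"
  where "tensor_space S T = span {pure_tensor S T s t | s t. s \<in> S \<and> t \<in> T}"

text \<open>The bilinear action of \<open>S \<otimes> End W\<close> on \<open>S\<^sup>* \<otimes> W\<close> with
  \<open>(v \<otimes> \<Phi>)(\<omega> \<otimes> x) = \<omega>(v) \<Phi>(x)\<close>.\<close>

definition is_tensor_action ::
    "'a::real_vector set \<Rightarrow> 'v::real_vector set \<Rightarrow>
     ((('a \<Rightarrow> ('v \<Rightarrow> 'v) \<Rightarrow> real) \<Rightarrow> real) \<Rightarrow> ((('a \<Rightarrow> real) \<Rightarrow> 'v \<Rightarrow> real) \<Rightarrow> real) \<Rightarrow> 'v) \<Rightarrow> bool"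
  where "is_tensor_action S W L \<longleftrightarrow>
    bilin_on (tensor_space S (endo_space W)) (tensor_space (dual_space S) W) W L \<and>
    (\<forall>v\<in>S. \<forall>\<Phi>\<in>endo_space W. \<forall>\<omega>\<in>dual_space S. \<forall>x\<in>W.
      L (pure_tensor S (endo_space W) v \<Phi>) (pure_tensor (dual_space S) W \<omega> x) = \<omega> v *\<^sub>R \<Phi> x)"

definition tensor_action ::
    "'a::real_vector set \<Rightarrow> 'v::real_vector set \<Rightarrow>
     (('a \<Rightarrow> ('v \<Rightarrow> 'v) \<Rightarrow> real) \<Rightarrow> real) \<Rightarrow> ((('a \<Rightarrow> real) \<Rightarrow> 'v \<Rightarrow> real) \<Rightarrow> real) \<Rightarrow> 'v"
  where "tensor_action S W t u = (THE w. \<exists>L. is_tensor_action S W L \<and> w = L t u)"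


section \<open>Smooth manifolds\<close>

definition partial :: "nat \<Rightarrow> ((nat \<Rightarrow> real) \<Rightarrow> real) \<Rightarrow> (nat \<Rightarrow> real) \<Rightarrow> real"
  where "partial i f x = deriv (\<lambda>t. f (x(i := t))) (x i)"

primrec Ck_on :: "nat \<Rightarrow> nat \<Rightarrow> (nat \<Rightarrow> real) set \<Rightarrow> ((nat \<Rightarrow> real) \<Rightarrow> real) \<Rightarrow> bool"
  where
    "Ck_on n 0 V f \<longleftrightarrow> continuous_map (subtopology (Euclidean_space n) V) euclideanreal f"
  | "Ck_on n (Suc k) V f \<longleftrightarrow>
      continuous_map (subtopology (Euclidean_space n) V) euclideanreal f \<and>
      (\<forall>i<n. (\<forall>x\<in>V. (\<lambda>t. f (x(i := t))) differentiable (at (x i))) \<and> Ck_on n k V (partial i f))"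

text \<open>Meant for \<open>V\<close> open in \<open>Euclidean_space n\<close>.\<close>

definition Cinf_on :: "nat \<Rightarrow> (nat \<Rightarrow> real) set \<Rightarrow> ((nat \<Rightarrow> real) \<Rightarrow> real) \<Rightarrow> bool"
  where "Cinf_on n V f \<longleftrightarrow> (\<forall>k. Ck_on n k V f)"

text \<open>The underlying set of a manifold is the whole type; a chart is a pair of its domain and its
  coordinate map. Hausdorffness and second countability come from the type class constraints.\<close>

record 'm mfd =
  dim_mfd :: nat
  charts :: "('m set \<times> ('m \<Rightarrow> nat \<Rightarrow> real)) set"

definition smooth_manifold :: "'m::{t2_space,second_countable_topology} mfd \<Rightarrow> bool"
  where "smooth_manifold M \<longleftrightarrow>
    (\<Union>(U, \<phi>)\<in>charts M. U) = UNIV \<and>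
    (\<forall>(U, \<phi>)\<in>charts M.
      open U \<and> openin (Euclidean_space (dim_mfd M)) (\<phi> ` U) \<and>
      homeomorphic_map (top_of_set U) (subtopology (Euclidean_space (dim_mfd M)) (\<phi> ` U)) \<phi>) \<and>
    (\<forall>(U, \<phi>)\<in>charts M. \<forall>(V, \<psi>)\<in>charts M. \<forall>i<dim_mfd M.
      Cinf_on (dim_mfd M) (\<phi> ` (U \<inter> V)) (\<lambda>x. \<psi> (inv_into U \<phi> x) i))"

text \<open>Meant for open \<open>W\<close>.\<close>

definition smooth_fun_on :: "'m mfd \<Rightarrow> 'm set \<Rightarrow> ('m \<Rightarrow> real) \<Rightarrow> bool"
  where "smooth_fun_on M W f \<longleftrightarrow>
    (\<forall>(U, \<phi>)\<in>charts M. Cinf_on (dim_mfd M) (\<phi> ` (W \<inter> U)) (\<lambda>x. f (inv_into U \<phi> x)))"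

definition smooth_funs :: "'m mfd \<Rightarrow> ('m \<Rightarrow> real) set"
  where "smooth_funs M = {f. smooth_fun_on M UNIV f}"


section \<open>Smooth vector bundles\<close>

text \<open>A vector bundle over \<open>M\<close> is given by its fibres, subspaces of a common real vector space (the
  total space being their disjoint union), and by local trivialisations. A local trivialisation
  \<open>U \<times> \<real>\<^sup>r \<rightarrow> E\<close> over \<open>U\<close>, sending \<open>(p, c)\<close> to the sum of all \<open>c i *\<^sub>R (es ! i) p\<close>, is recorded as
  the local frame \<open>(U, es)\<close>.\<close>

record ('m, 'v) vbundle =
  fibre :: "'m \<Rightarrow> 'v set"
  frames :: "('m set \<times> ('m \<Rightarrow> 'v) list) set"

definition smooth_section_on ::
    "'m mfd \<Rightarrow> ('m, 'v::real_vector) vbundle \<Rightarrow> 'm set \<Rightarrow> ('m \<Rightarrow> 'v) \<Rightarrow> bool"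
  where "smooth_section_on M E W X \<longleftrightarrow>
    (\<forall>p\<in>W. X p \<in> fibre E p) \<and>
    (\<forall>(U, es)\<in>frames E. \<exists>c.
      (\<forall>i<length es. smooth_fun_on M (W \<inter> U) (c i)) \<and>
      (\<forall>p\<in>W \<inter> U. X p = (\<Sum>i<length es. c i p *\<^sub>R (es ! i) p)))"

definition sections :: "'m mfd \<Rightarrow> ('m, 'v::real_vector) vbundle \<Rightarrow> ('m \<Rightarrow> 'v) set"
  where "sections M E = {X. smooth_section_on M E UNIV X}"

text \<open>The last condition says that the transition matrices between frames are smooth.\<close>

definition smooth_vector_bundle ::
    "'m::topological_space mfd \<Rightarrow> nat \<Rightarrow> ('m, 'v::real_vector) vbundle \<Rightarrow> bool"
  where "smooth_vector_bundle M r E \<longleftrightarrow>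
    (\<forall>p. subspace (fibre E p)) \<and>
    (\<Union>(U, es)\<in>frames E. U) = UNIV \<and>
    (\<forall>(U, es)\<in>frames E.
      open U \<and> length es = r \<and>
      (\<forall>p\<in>U. distinct (map (\<lambda>e. e p) es) \<and> independent ((\<lambda>e. e p) ` set es) \<and>
        span ((\<lambda>e. e p) ` set es) = fibre E p) \<and>
      (\<forall>e\<in>set es. smooth_section_on M E U e))"

text \<open>Morphisms over the identity: fibrewise linear, with smooth matrix in local frames.\<close>

definition vb_morphism ::
    "'m mfd \<Rightarrow> ('m, 'v::real_vector) vbundle \<Rightarrow> ('m, 'w::real_vector) vbundle \<Rightarrow>
     ('m \<Rightarrow> 'v \<Rightarrow> 'w) \<Rightarrow> bool"
  where "vb_morphism M E F h \<longleftrightarrow>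
    (\<forall>p. lin_on (fibre E p) (fibre F p) (h p)) \<and>
    (\<forall>(U, es)\<in>frames E. \<forall>e\<in>set es. smooth_section_on M F U (\<lambda>p. h p (e p)))"

text \<open>Tangent vectors at \<open>p\<close> are the derivations at \<open>p\<close> of the algebra of smooth functions.\<close>

type_synonym 'm tvec = "('m \<Rightarrow> real) \<Rightarrow> real"

definition tangent_space :: "'m mfd \<Rightarrow> 'm \<Rightarrow> 'm tvec set"
  where "tangent_space M p = {v. v \<in> dual_space (smooth_funs M) \<and>
    (\<forall>f\<in>smooth_funs M. \<forall>g\<in>smooth_funs M. v (f * g) = f p * v g + g p * v f)}"

definition coord_vec :: "'m mfd \<Rightarrow> 'm set \<Rightarrow> ('m \<Rightarrow> nat \<Rightarrow> real) \<Rightarrow> nat \<Rightarrow> 'm \<Rightarrow> 'm tvec"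
  where "coord_vec M U \<phi> i p =
    (\<lambda>f. if f \<in> smooth_funs M then partial i (\<lambda>x. f (inv_into U \<phi> x)) (\<phi> p) else 0)"

definition tangent_bundle :: "'m mfd \<Rightarrow> ('m, 'm tvec) vbundle"
  where "tangent_bundle M = \<lparr>
    fibre = tangent_space M,
    frames = {(U, map (coord_vec M U \<phi>) [0..<dim_mfd M]) | U \<phi>. (U, \<phi>) \<in> charts M}\<rparr>"

text \<open>A local frame of \<open>E\<close> induces the frame of \<open>End(E)\<close> formed by the matrix units, where
  \<open>representation\<close> gives the coordinates of a vector in a basis and is zero outside its span.\<close>

definition endo_bundle :: "('m, 'v::real_vector) vbundle \<Rightarrow> ('m, 'v \<Rightarrow> 'v) vbundle"
  where "endo_bundle E = \<lparr>
    fibre = (\<lambda>p. endo_space (fibre E p)),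
    frames = {(U, [(\<lambda>p x. representation ((\<lambda>d. d p) ` set es) x (e' p) *\<^sub>R e p). e \<leftarrow> es, e' \<leftarrow> es])
      | U es. (U, es) \<in> frames E}\<rparr>"

definition tensor_bundle ::
    "('m, 'v::real_vector) vbundle \<Rightarrow> ('m, 'w::real_vector) vbundle \<Rightarrow>
     ('m, ('v \<Rightarrow> 'w \<Rightarrow> real) \<Rightarrow> real) vbundle"
  where "tensor_bundle E F = \<lparr>
    fibre = (\<lambda>p. tensor_space (fibre E p) (fibre F p)),
    frames = {(U \<inter> V, [(\<lambda>p. pure_tensor (fibre E p) (fibre F p) (e p) (f p)). e \<leftarrow> es, f \<leftarrow> fs])
      | U es V fs. (U, es) \<in> frames E \<and> (V, fs) \<in> frames F}\<rparr>"

definition differential :: "'m mfd \<Rightarrow> ('m \<Rightarrow> real) \<Rightarrow> 'm \<Rightarrow> 'm tvec \<Rightarrow> real"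
  where "differential M f p = (\<lambda>v. if v \<in> tangent_space M p then v f else 0)"

text \<open>For a vector field \<open>V\<close>, the function \<open>V(f)\<close> is \<open>\<lambda>p. V p f\<close>.\<close>

definition lie_bracket_vf :: "('m \<Rightarrow> 'm tvec) \<Rightarrow> ('m \<Rightarrow> 'm tvec) \<Rightarrow> 'm \<Rightarrow> 'm tvec"
  where "lie_bracket_vf V W p = (\<lambda>f. V p (\<lambda>q. W q f) - W p (\<lambda>q. V q f))"


section \<open>Loday algebroids\<close>

definition loday_bracket :: "'a::real_vector set \<Rightarrow> ('a \<Rightarrow> 'a \<Rightarrow> 'a) \<Rightarrow> bool"
  where "loday_bracket V br \<longleftrightarrow> bilin_on V V V br \<and>
    (\<forall>x\<in>V. \<forall>y\<in>V. \<forall>z\<in>V. br x (br y z) = br (br x y) z + br y (br x z))"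

definition fmult :: "('m \<Rightarrow> real) \<Rightarrow> ('m \<Rightarrow> 'v::real_vector) \<Rightarrow> 'm \<Rightarrow> 'v"  (infixr \<open>\<cdot>\<^sub>s\<close> 75)
  where "f \<cdot>\<^sub>s X = (\<lambda>p. f p *\<^sub>R X p)"

type_synonym ('m, 'v) bracket = "('m \<Rightarrow> 'v) \<Rightarrow> ('m \<Rightarrow> 'v) \<Rightarrow> 'm \<Rightarrow> 'v"

text \<open>\<open>delta False\<close> and \<open>delta True\<close> act on the first and the second argument, respectively.\<close>

definition delta :: "bool \<Rightarrow> ('m \<Rightarrow> real) \<Rightarrow> ('m, 'v::real_vector) bracket \<Rightarrow> ('m, 'v) bracket"
  where "delta i f B = (\<lambda>X Y. (if i then B X (f \<cdot>\<^sub>s Y) else B (f \<cdot>\<^sub>s X) Y) - f \<cdot>\<^sub>s B X Y)"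

definition bidiff_order_le_1 ::
    "'m mfd \<Rightarrow> ('m, 'v::real_vector) vbundle \<Rightarrow> ('m, 'v) bracket \<Rightarrow> bool"
  where "bidiff_order_le_1 M E B \<longleftrightarrow>
    (\<forall>f\<in>smooth_funs M. \<forall>g\<in>smooth_funs M. \<forall>i j. \<forall>X\<in>sections M E. \<forall>Y\<in>sections M E.
      delta i f (delta j g B) X Y = 0)"

definition derivative_endo ::
    "'m mfd \<Rightarrow> ('m, 'v::real_vector) vbundle \<Rightarrow> (('m \<Rightarrow> 'v) \<Rightarrow> 'm \<Rightarrow> 'v) \<Rightarrow> bool"
  where "derivative_endo M E D \<longleftrightarrow> lin_on (sections M E) (sections M E) D \<and>
    (\<forall>f\<in>smooth_funs M. \<exists>g\<in>smooth_funs M. \<forall>Y\<in>sections M E. D (f \<cdot>\<^sub>s Y) - f \<cdot>\<^sub>s D Y = g \<cdot>\<^sub>s Y)"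

definition loday_algebroid ::
    "'m mfd \<Rightarrow> ('m, 'v::real_vector) vbundle \<Rightarrow> ('m, 'v) bracket \<Rightarrow> bool"
  where "loday_algebroid M E br \<longleftrightarrow>
    loday_bracket (sections M E) br \<and> bidiff_order_le_1 M E br \<and>
    (\<forall>X\<in>sections M E. derivative_endo M E (br X))"

definition anchor_conditions ::
    "'m mfd \<Rightarrow> ('m, 'v::real_vector) vbundle \<Rightarrow> ('m, 'v) bracket \<Rightarrow>
     ('m \<Rightarrow> 'v \<Rightarrow> 'm tvec) \<Rightarrow> ('m \<Rightarrow> 'v \<Rightarrow> ('m tvec \<Rightarrow> ('v \<Rightarrow> 'v) \<Rightarrow> real) \<Rightarrow> real) \<Rightarrow> bool"
  where "anchor_conditions M E br \<rho> \<alpha> \<longleftrightarrow>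
    vb_morphism M E (tangent_bundle M) \<rho> \<and>
    vb_morphism M E (tensor_bundle (tangent_bundle M) (endo_bundle E)) \<alpha> \<and>
    (\<forall>X\<in>sections M E. \<forall>Y\<in>sections M E. \<forall>f\<in>smooth_funs M.
      br X (f \<cdot>\<^sub>s Y) = f \<cdot>\<^sub>s br X Y + (\<lambda>p. \<rho> p (X p) f) \<cdot>\<^sub>s Y \<and>
      br (f \<cdot>\<^sub>s X) Y = f \<cdot>\<^sub>s br X Y - (\<lambda>p. \<rho> p (Y p) f) \<cdot>\<^sub>s X +
        (\<lambda>p. tensor_action (tangent_space M p) (fibre E p) (\<alpha> p (Y p))
          (pure_tensor (dual_space (tangent_space M p)) (fibre E p) (differential M f p) (X p))))"

end

theory Submission
  imports Defs
begin

text \<open>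
  For a Loday algebroid, \<open>[X, f Y] - f [X, Y]\<close> is a multiple of \<open>Y\<close> by a function that is a
  derivation in \<open>f\<close> and, since the bracket has total order at most one, \<open>C\<^sup>\<infinity>\<close>-linear in \<open>X\<close>. Bump
  functions and local frames show that its value at \<open>p\<close> depends on \<open>X p\<close> only, and Hadamard's lemma
  that a derivation at \<open>p\<close> is a combination of coordinate vectors; together these give the anchor
  \<open>\<rho>\<close>. In the same way \<open>[f X, Y] - f [X, Y] + \<rho>(Y)(f) X\<close> is a derivation in \<open>f\<close> and
  \<open>C\<^sup>\<infinity>\<close>-bilinear in \<open>X\<close> and \<open>Y\<close>, hence given by a unique tensor \<open>\<alpha>(Y)\<close> acting on
  \<open>df \<otimes> X\<close>. Conversely, the two Leibniz rules make the iterated commutators with functions vanish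
  pointwise. Comparing the Jacobi identities for \<open>Z\<close> and \<open>f Z\<close> shows that \<open>\<rho>\<close> is a homomorphism.
\<close>

subsection \<open>Calculus on \<open>Euclidean_space n\<close>\<close>

text \<open>The obstacle is the gap between global and local data. The bracket accepts only global
  sections and a tangent vector only global functions, whereas frames and coordinates live on open
  sets. Each local object is therefore replaced near a point by a global one that agrees with it
  there, and multiplication by a bump function shows that the replacement does not matter.
  Smoothness in charts means iterated one-variable derivatives. The chain rule and differentiation
  under the integral sign are brought into that form, and Hadamard's lemma is obtained one
  coordinate at a time, where one-dimensional calculus suffices. The tensor action is a definite
  description, so its existence and uniqueness must be settled before \<alpha> can be constructed or
  compared. Both rest on expansions in finite dual bases, and the same expansions give the
  coefficients of \<alpha> and their smoothness. In rank zero the bracket carries no information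
  about a multiplier. That case is treated apart, with zero morphisms.\<close>

definition En :: "nat \<Rightarrow> (nat \<Rightarrow> real) set"
  where "En n = {x. \<forall>i\<ge>n. x i = 0}"

lemma Euclidean_space_eq_top_of_set: "Euclidean_space n = top_of_set (En n)"
  by (simp add: Euclidean_space_def En_def euclidean_product_topology)

lemma topspace_Euclidean_space_En: "topspace (Euclidean_space n) = En n"
  by (simp add: topspace_Euclidean_space En_def)

lemma openin_Euclidean_subset: "openin (Euclidean_space n) V \<Longrightarrow> V \<subseteq> En n"
  using openin_subset topspace_Euclidean_space_En by blast

lemma continuous_map_Euclidean_iff:
  assumes "V \<subseteq> En n"
  shows "continuous_map (subtopology (Euclidean_space n) V) euclideanreal f \<longleftrightarrow> continuous_on V f"
proof -
  have "subtopology (Euclidean_space n) V = top_of_set V"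
    using assms by (simp add: Euclidean_space_eq_top_of_set subtopology_subtopology Int_absorb1)
  then show ?thesis by simp
qed

text \<open>All points of \<open>En n\<close> agree in the coordinates from \<open>n\<close> on, so
  only the first \<open>n\<close> radii of a basic product neighbourhood count, and their minimum is
  positive.\<close>

lemma openin_Euclidean_box:
  assumes "openin (Euclidean_space n) V" "x \<in> V"
  obtains d where "d > 0"
    "\<And>y. y \<in> En n \<Longrightarrow> (\<And>i. i < n \<Longrightarrow> \<bar>y i - x i\<bar> < d) \<Longrightarrow> y \<in> V"
proof -
  obtain T where T: "open T" "V = En n \<inter> T"
    using assms(1) unfolding Euclidean_space_eq_top_of_set openin_open by auto
  have "openin (product_topology (\<lambda>i. euclidean) UNIV) T"
    using T(1) by (simp add: euclidean_product_topology)
  then obtain U where U: "finite {i. U i \<noteq> (UNIV::real set)}" "\<And>i. open (U i)"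
      "x \<in> Pi\<^sub>E UNIV U" "Pi\<^sub>E UNIV U \<subseteq> T"
    using assms(2) T(2) unfolding openin_product_topology_alt by auto
  have "\<exists>e>0. \<forall>y. \<bar>y - x i\<bar> < e \<longrightarrow> y \<in> U i" for i
    using U(2,3) open_dist[of "U i"] by (auto simp: dist_real_def PiE_iff)
  then obtain e where e: "\<And>i. e i > 0" "\<And>i y. \<bar>y - x i\<bar> < e i \<Longrightarrow> y \<in> U i" by metis
  \<comment> \<open>The inserted 1 keeps the minimum defined when \<open>n = 0\<close>.\<close>
  define d where "d = Min (insert 1 (e ` {..<n}))"
  have "d > 0" unfolding d_def using e(1) by auto
  moreover have "y \<in> V" if y: "y \<in> En n" "\<And>i. i < n \<Longrightarrow> \<bar>y i - x i\<bar> < d" for y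
  proof -
    have xE: "x \<in> En n" using assms T by auto
    have "y i \<in> U i" for i
    proof (cases "i < n")
      case True
      then have "d \<le> e i" unfolding d_def by (intro Min_le) auto
      then show ?thesis using y(2)[OF True] e(2) by force
    next
      case False
      then have "y i = x i" using y(1) xE by (auto simp: En_def)
      then show ?thesis using U(3) by (auto simp: PiE_iff)
    qed
    then have "y \<in> Pi\<^sub>E UNIV U" by (auto simp: PiE_iff)
    then show ?thesis using U(4) T y(1) by auto
  qed
  ultimately show ?thesis using that by blast
qed

lemma openin_Euclidean_coord_less:
  "openin (Euclidean_space n) {y \<in> En n. \<forall>i<n. \<bar>y i - x i\<bar> < d}"
proof -
  have "open {y::nat\<Rightarrow>real. \<bar>y i - x i\<bar> < d}" for i
    by (intro open_Collect_less continuous_intros continuous_on_product_coordinates)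
  then have "open (\<Inter>i\<in>{..<n}. {y::nat\<Rightarrow>real. \<bar>y i - x i\<bar> < d})"
    by (intro open_INT) auto
  moreover have "{y \<in> En n. \<forall>i<n. \<bar>y i - x i\<bar> < d} = En n \<inter> (\<Inter>i\<in>{..<n}. {y. \<bar>y i - x i\<bar> < d})"
    by auto
  ultimately show ?thesis unfolding Euclidean_space_eq_top_of_set openin_open by auto
qed

text \<open>\<open>partial\<close> looks along a whole coordinate line, which may leave
  \<open>V\<close>. Near \<open>x\<close> it does not, and this makes \<open>partial\<close> depend
  only on the values on \<open>V\<close>.\<close>

lemma eventually_fun_upd_in:
  assumes "openin (Euclidean_space n) V" "x \<in> V" "i < n"
  shows "\<forall>\<^sub>F t in nhds (x i). x(i := t) \<in> V"
proof -
  obtain d where d: "d > 0"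
    "\<And>y. y \<in> En n \<Longrightarrow> (\<And>i. i < n \<Longrightarrow> \<bar>y i - x i\<bar> < d) \<Longrightarrow> y \<in> V"
    using openin_Euclidean_box[OF assms(1,2)] by blast
  have "\<forall>\<^sub>F t in nhds (x i). dist t (x i) < d" using d(1) by (simp add: eventually_nhds_metric) blast
  then show ?thesis
  proof eventually_elim
    case (elim t)
    have "x \<in> En n" using assms openin_Euclidean_subset by blast
    then show ?case using assms(3) elim d(1)
      by (intro d(2)) (auto simp: En_def dist_real_def)
  qed
qed

lemma continuous_on_fun_upd: "continuous_on S (\<lambda>t. (x::nat\<Rightarrow>real)(i := t))"
proof (intro continuous_on_coordinatewise_then_product)
  show "continuous_on S (\<lambda>t. (x(i := t)) j)" for j
    by (cases "j = i") auto
qed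


section \<open>Functions of class C^k on open sets: locality and algebra\<close>

lemma Ck_on_imp_continuous_on:
  assumes "V \<subseteq> En n" "Ck_on n k V f" shows "continuous_on V f"
  using assms by (cases k) (auto simp: continuous_map_Euclidean_iff)

lemma Ck_on_0: "V \<subseteq> En n \<Longrightarrow> Ck_on n 0 V f \<longleftrightarrow> continuous_on V f"
  by (simp add: continuous_map_Euclidean_iff)

text \<open>With \<open>partial\<close> itself as the derivative, the usual derivative rules apply.
  From here on this form replaces the recursive equations, which leave the simpset below.\<close>

lemma Ck_on_Suc_iff:
  assumes "V \<subseteq> En n"
  shows "Ck_on n (Suc k) V f \<longleftrightarrow> continuous_on V f \<and>
    (\<forall>i<n. (\<forall>x\<in>V. ((\<lambda>t. f (x(i := t))) has_real_derivative partial i f x) (at (x i))) \<and>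
       Ck_on n k V (partial i f))"
proof -
  have "g differentiable (at a) \<longleftrightarrow> (g has_real_derivative deriv g a) (at a)" for g :: "real \<Rightarrow> real" and a
    by (meson DERIV_deriv_iff_real_differentiable)
  then show ?thesis using assms by (simp add: continuous_map_Euclidean_iff partial_def)
qed

declare Ck_on.simps [simp del]

lemma partial_eqI:
  "((\<lambda>t. f (x(i := t))) has_real_derivative D) (at (x i)) \<Longrightarrow> partial i f x = D"
  by (simp add: partial_def DERIV_imp_deriv)

lemma partial_cong:
  assumes V: "openin (Euclidean_space n) V" and "x \<in> V" "i < n" "\<And>y. y \<in> V \<Longrightarrow> f y = g y"
  shows "partial i f x = partial i g x"
  unfolding partial_def
  by (rule deriv_cong_ev) (use eventually_fun_upd_in[OF assms(1-3)] assms(4) in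
    \<open>auto elim: eventually_mono\<close>)

lemma Ck_on_cong:
  assumes V: "openin (Euclidean_space n) V" and "\<And>x. x \<in> V \<Longrightarrow> f x = g x" "Ck_on n k V f"
  shows "Ck_on n k V g"
  using assms(2,3)
proof (induction k arbitrary: f g)
  case 0
  then show ?case using openin_Euclidean_subset[OF V] continuous_on_cong[of V V f g]
    by (simp add: Ck_on_0)
next
  case (Suc k)
  note sub = openin_Euclidean_subset[OF V]
  have "((\<lambda>t. g (x(i := t))) has_real_derivative partial i g x) (at (x i))" if "x \<in> V" "i < n" for x i
  proof -
    have "((\<lambda>t. f (x(i := t))) has_real_derivative partial i f x) (at (x i))"
      using Suc.prems(2) that by (simp add: Ck_on_Suc_iff[OF sub])
    moreover have "\<forall>\<^sub>F t in nhds (x i). f (x(i := t)) = g (x(i := t))"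
      using eventually_fun_upd_in[OF V that] by eventually_elim (use Suc.prems in auto)
    ultimately show ?thesis
      using partial_cong[OF V that Suc.prems(1)]
        DERIV_cong_ev[OF refl, of "\<lambda>t. f (x(i := t))" "\<lambda>t. g (x(i := t))" "x i"] by simp
  qed
  moreover have "Ck_on n k V (partial i g)" if "i < n" for i
  proof (rule Suc.IH)
    show "partial i f x = partial i g x" if "x \<in> V" for x
      using partial_cong[OF V that \<open>i < n\<close> Suc.prems(1)] .
    show "Ck_on n k V (partial i f)" using Suc.prems(2) that by (simp add: Ck_on_Suc_iff[OF sub])
  qed
  moreover have "continuous_on V g"
    using Suc.prems continuous_on_cong[of V V f g] by (simp add: Ck_on_Suc_iff[OF sub])
  ultimately show ?case by (simp add: Ck_on_Suc_iff[OF sub])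
qed

text \<open>\<open>D\<close> may be any formula for the derivatives on \<open>V\<close>; off
  \<open>V\<close>, where \<open>partial i f\<close> can differ from it, no agreement is asked
  for.\<close>

lemma Ck_on_SucI:
  assumes V: "openin (Euclidean_space n) V" and "continuous_on V f"
    and D: "\<And>i x. i < n \<Longrightarrow> x \<in> V \<Longrightarrow> ((\<lambda>t. f (x(i := t))) has_real_derivative D i x) (at (x i))"
    and C: "\<And>i. i < n \<Longrightarrow> Ck_on n k V (D i)"
  shows "Ck_on n (Suc k) V f"
proof -
  note sub = openin_Euclidean_subset[OF V]
  have eq: "partial i f x = D i x" if "i < n" "x \<in> V" for i x
    using D[OF that] by (rule partial_eqI)
  then have "Ck_on n k V (partial i f)" if "i < n" for i
    using that by (intro Ck_on_cong[OF V _ C[OF that]]) auto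
  with eq D assms(2) show ?thesis by (simp add: Ck_on_Suc_iff[OF sub])
qed

lemma Ck_on_SucD:
  assumes "V \<subseteq> En n" "Ck_on n (Suc k) V f"
  shows "Ck_on n k V f"
  using assms(2)
  by (induction k arbitrary: f) (auto simp: Ck_on_Suc_iff[OF assms(1)] Ck_on_0[OF assms(1)])

lemma Ck_on_subset:
  assumes "V \<subseteq> En n" "V' \<subseteq> V" "Ck_on n k V f"
  shows "Ck_on n k V' f"
proof -
  have "V' \<subseteq> En n" using assms by auto
  then show ?thesis using assms(3)
    by (induction k arbitrary: f)
       (use assms in \<open>auto simp: Ck_on_Suc_iff Ck_on_0 intro: continuous_on_subset\<close>)
qed

text \<open>The derivative conditions are pointwise already. Only continuity has to be glued, which
  works because intersecting \<open>V\<close> with an open neighbourhood of \<open>x\<close> leaves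
  the filter at \<open>x\<close> within \<open>V\<close> unchanged.\<close>

lemma Ck_on_local:
  assumes V: "openin (Euclidean_space n) V"
    and L: "\<And>x. x \<in> V \<Longrightarrow> \<exists>V'. openin (Euclidean_space n) V' \<and> x \<in> V' \<and> Ck_on n k V' f"
  shows "Ck_on n k V f"
  using L
proof (induction k arbitrary: f)
  case (0 f)
  note sub = openin_Euclidean_subset
  obtain N where N: "\<And>x. x \<in> V \<Longrightarrow> openin (Euclidean_space n) (N x) \<and> x \<in> N x \<and> continuous_on (N x) f"
    using 0 sub Ck_on_0 by metis
  have VU: "V = (\<Union>x\<in>V. N x \<inter> V)" using N by auto
  have op: "openin (top_of_set V) (N x \<inter> V)" if "x \<in> V" for x
  proof -
    have "openin (top_of_set (En n)) (N x \<inter> V)"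
      using N[OF that] V unfolding Euclidean_space_eq_top_of_set by auto
    then show ?thesis using sub[OF V] openin_subset_trans by blast
  qed
  have "continuous_on (N x \<inter> V) f" if "x \<in> V" for x
    using N[OF that] continuous_on_subset by blast
  moreover have "at x within V = at x within (N x \<inter> V)" if x: "x \<in> V" for x
  proof -
    obtain T where "open T" "N x \<inter> V = V \<inter> T" using op[OF x] by (auto simp: openin_open)
    then show ?thesis using N[OF x] x by (intro at_within_nhd[of _ T]) auto
  qed
  ultimately have "continuous (at x within V) f" if "x \<in> V" for x
    using N[OF that] that unfolding continuous_on_eq_continuous_within by auto
  then have "continuous_on V f" by (simp add: continuous_on_eq_continuous_within)
  then show ?case using sub[OF V] by (simp add: Ck_on_0)
next
  case (Suc k)
  note sub = openin_Euclidean_subset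
  have nbhd: "\<exists>V'. openin (Euclidean_space n) V' \<and> x \<in> V' \<and> Ck_on n k V' f \<and>
      (\<forall>i<n. Ck_on n k V' (partial i f) \<and>
        ((\<lambda>t. f (x(i := t))) has_real_derivative partial i f x) (at (x i)))" if x: "x \<in> V" for x
  proof -
    obtain V' where V': "openin (Euclidean_space n) V'" "x \<in> V'" "Ck_on n (Suc k) V' f"
      using Suc.prems[OF x] by blast
    then show ?thesis
      using Ck_on_SucD[OF sub[OF V'(1)] V'(3)] Ck_on_Suc_iff[OF sub[OF V'(1)], of k f]
      by (intro exI[of _ V']) simp
  qed
  have c: "continuous_on V f"
  proof -
    have "Ck_on n k V f" by (rule Suc.IH) (use nbhd in blast)
    then show ?thesis by (rule Ck_on_imp_continuous_on[OF sub[OF V]])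
  qed
  have "Ck_on n k V (partial i f)" if "i < n" for i
    by (rule Suc.IH) (use nbhd that in blast)
  moreover have "((\<lambda>t. f (x(i := t))) has_real_derivative partial i f x) (at (x i))"
    if "i < n" "x \<in> V" for i x
    using nbhd that by blast
  ultimately show ?case using c by (simp add: Ck_on_Suc_iff[OF sub[OF V]])
qed

lemma Ck_on_const: "openin (Euclidean_space n) V \<Longrightarrow> Ck_on n k V (\<lambda>x. c)"
proof (induction k arbitrary: c)
  case 0
  then show ?case using openin_Euclidean_subset by (simp add: Ck_on_0)
next
  case (Suc k)
  then show ?case by (intro Ck_on_SucI[where D = "\<lambda>i x. 0"]) auto
qed

lemma Ck_on_coord:
  assumes V: "openin (Euclidean_space n) V"
  shows "Ck_on n k V (\<lambda>x. x i)"
proof -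
  have c: "continuous_on V (\<lambda>x::nat\<Rightarrow>real. x i)"
    by (rule continuous_on_subset[OF continuous_on_product_coordinates subset_UNIV])
  show ?thesis
  proof (cases k)
    case 0
    then show ?thesis using c openin_Euclidean_subset[OF V] by (simp add: Ck_on_0)
  next
    case (Suc k')
    show ?thesis unfolding Suc
    proof (rule Ck_on_SucI[OF V c, where D = "\<lambda>j x. if j = i then 1 else 0"])
      show "((\<lambda>t. (x(j := t)) i) has_real_derivative (if j = i then 1 else 0)) (at (x j))" for j x
        by (cases "j = i") auto
    qed (simp add: Ck_on_const V)
  qed
qed

lemma Ck_on_add:
  assumes V: "openin (Euclidean_space n) V" and "Ck_on n k V f" "Ck_on n k V g"
  shows "Ck_on n k V (\<lambda>x. f x + g x)"
  using assms(2,3)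
proof (induction k arbitrary: f g)
  case 0
  then show ?case using openin_Euclidean_subset[OF V]
      by (auto simp: Ck_on_0 intro!: continuous_on_add continuous_on_mult continuous_on_inverse)
next
  case (Suc k)
  note sub = openin_Euclidean_subset[OF V]
  note f = Suc.prems(1)[unfolded Ck_on_Suc_iff[OF sub]] and g = Suc.prems(2)[unfolded Ck_on_Suc_iff[OF sub]]
  show ?case
  proof (rule Ck_on_SucI[OF V, where D = "\<lambda>i x. partial i f x + partial i g x"])
    show "continuous_on V (\<lambda>x. f x + g x)" using f g by (intro continuous_on_add) auto
    show "((\<lambda>t. f (x(i := t)) + g (x(i := t))) has_real_derivative
        partial i f x + partial i g x) (at (x i))" if "i < n" "x \<in> V" for i x
      using f g that by (intro DERIV_add) auto
    show "Ck_on n k V (\<lambda>x. partial i f x + partial i g x)" if "i < n" for i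
      using f g that by (intro Suc.IH) auto
  qed
qed

lemma Ck_on_mult:
  assumes V: "openin (Euclidean_space n) V" and "Ck_on n k V f" "Ck_on n k V g"
  shows "Ck_on n k V (\<lambda>x. f x * g x)"
  using assms(2,3)
proof (induction k arbitrary: f g)
  case 0
  then show ?case using openin_Euclidean_subset[OF V]
      by (auto simp: Ck_on_0 intro!: continuous_on_add continuous_on_mult continuous_on_inverse)
next
  case (Suc k)
  note sub = openin_Euclidean_subset[OF V]
  note f = Suc.prems(1)[unfolded Ck_on_Suc_iff[OF sub]] and g = Suc.prems(2)[unfolded Ck_on_Suc_iff[OF sub]]
  show ?case
  proof (rule Ck_on_SucI[OF V, where D = "\<lambda>i x. partial i f x * g x + f x * partial i g x"])
    show "continuous_on V (\<lambda>x. f x * g x)" using f g by (intro continuous_on_mult) auto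
    show "((\<lambda>t. f (x(i := t)) * g (x(i := t))) has_real_derivative
        partial i f x * g x + f x * partial i g x) (at (x i))" if "i < n" "x \<in> V" for i x
    proof -
      have "((\<lambda>t. f (x(i := t))) has_real_derivative partial i f x) (at (x i))"
        "((\<lambda>t. g (x(i := t))) has_real_derivative partial i g x) (at (x i))" using f g that by auto
      from DERIV_mult[OF this] show ?thesis by (simp add: mult.commute add.commute)
    qed
    show "Ck_on n k V (\<lambda>x. partial i f x * g x + f x * partial i g x)" if "i < n" for i
      using f g that Suc.prems[THEN Ck_on_SucD[OF sub]] by (intro Ck_on_add[OF V] Suc.IH) auto
  qed
qed

lemma Ck_on_sum:
  assumes V: "openin (Euclidean_space n) V" and "\<And>a. a \<in> A \<Longrightarrow> Ck_on n k V (f a)"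
  shows "Ck_on n k V (\<lambda>x. \<Sum>a\<in>A. f a x)"
  using assms(2)
  by (induction A rule: infinite_finite_induct) (auto intro!: Ck_on_const Ck_on_add V)

lemma Ck_on_inverse:
  assumes V: "openin (Euclidean_space n) V" and "Ck_on n k V f" and nz: "\<And>x. x \<in> V \<Longrightarrow> f x \<noteq> 0"
  shows "Ck_on n k V (\<lambda>x. inverse (f x))"
  using assms(2)
proof (induction k)
  case 0
  then show ?case using nz openin_Euclidean_subset[OF V]
      by (auto simp: Ck_on_0 intro!: continuous_on_add continuous_on_mult continuous_on_inverse)
next
  case (Suc k)
  note sub = openin_Euclidean_subset[OF V]
  note f = Suc.prems(1)[unfolded Ck_on_Suc_iff[OF sub]]
  have IH: "Ck_on n k V (\<lambda>x. inverse (f x))" using Suc.IH Ck_on_SucD[OF sub Suc.prems] .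
  \<comment> \<open>The derivative -f'/f^2 is written with factors \<open>inverse (f x)\<close>, so
    that the induction hypothesis and the product rule cover it.\<close>
  show ?case
  proof (rule Ck_on_SucI[OF V, where D = "\<lambda>i x. (-1) * (partial i f x * (inverse (f x) * inverse (f x)))"])
    show "continuous_on V (\<lambda>x. inverse (f x))" using f nz by (intro continuous_on_inverse) auto
    show "((\<lambda>t. inverse (f (x(i := t)))) has_real_derivative
        (-1) * (partial i f x * (inverse (f x) * inverse (f x)))) (at (x i))" if "i < n" "x \<in> V" for i x
    proof -
      have "((\<lambda>t. f (x(i := t))) has_real_derivative partial i f x) (at (x i))" using f that by auto
      from DERIV_inverse'[OF this] show ?thesis using nz[OF that(2)] by (simp add: ac_simps)
    qed
    show "Ck_on n k V (\<lambda>x. (-1) * (partial i f x * (inverse (f x) * inverse (f x))))" if "i < n" for i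
      using f that IH by (intro Ck_on_mult[OF V] Ck_on_const[OF V]) auto
  qed
qed

text \<open>Telescope \<open>f (\<gamma> t) - f (\<gamma> t\<^sub>0)\<close> along the coordinates and apply the mean value theorem to each
  increment.\<close>

lemma has_real_derivative_along_curve:
  assumes V: "openin (Euclidean_space n) V" and f: "Ck_on n (Suc k) V f"
    and g0: "\<gamma> t0 \<in> V" and gE: "\<And>t. \<gamma> t \<in> En n"
    and gd: "\<And>i. i < n \<Longrightarrow> ((\<lambda>t. \<gamma> t i) has_real_derivative \<gamma>' i) (at t0)"
  shows "((\<lambda>t. f (\<gamma> t)) has_real_derivative (\<Sum>i<n. partial i f (\<gamma> t0) * \<gamma>' i)) (at t0)"
proof -
  note sub = openin_Euclidean_subset[OF V]
  note f' = f[unfolded Ck_on_Suc_iff[OF sub]]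
  \<comment> \<open>The hybrid point takes its first \<open>j\<close> coordinates from
    \<open>\<gamma> t\<close> and the others from \<open>\<gamma> t0\<close>; consecutive hybrids
    differ in coordinate \<open>j\<close> only.\<close>
  define y where "y j t = (\<lambda>i. if i < j then \<gamma> t i else \<gamma> t0 i)" for j t
  have y0: "y 0 t = \<gamma> t0" for t by (simp add: y_def)
  have yn: "y n t = \<gamma> t" for t
    using gE[of t] gE[of t0] by (auto simp: y_def En_def fun_eq_iff)
  have yS: "y (Suc j) t = (y j t)(j := \<gamma> t j)" "y j t = (y j t)(j := \<gamma> t0 j)" for j t
    by (auto simp: y_def fun_eq_iff)
  have tel: "f (\<gamma> t) = f (\<gamma> t0) + (\<Sum>j<n. f (y (Suc j) t) - f (y j t))" for t
    by (subst sum_lessThan_telescope) (simp add: y0 yn)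
  have step: "((\<lambda>t. f (y (Suc j) t) - f (y j t)) has_real_derivative partial j f (\<gamma> t0) * \<gamma>' j) (at t0)"
    if j: "j < n" for j
  proof -
    \<comment> \<open>The difference quotient in coordinate \<open>j\<close>, completed by its limit
      where the increment is 0, so that \<open>qeq\<close> holds for every \<open>t\<close> without
      a case distinction.\<close>
    define q where "q t = (if \<gamma> t j = \<gamma> t0 j then partial j f (\<gamma> t0)
      else (f (y (Suc j) t) - f (y j t)) / (\<gamma> t j - \<gamma> t0 j))" for t
    have qeq: "f (y (Suc j) t) - f (y j t) = q t * (\<gamma> t j - \<gamma> t0 j)" for t
      using yS[of j t] by (auto simp: q_def)
    have "(q \<longlongrightarrow> partial j f (\<gamma> t0)) (at t0)"
    proof (rule tendstoI)
      fix e :: real assume e: "e > 0"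
      have "continuous_on V (partial j f)" using f' j Ck_on_imp_continuous_on[OF sub] by blast
      then have "openin (top_of_set V) (V \<inter> partial j f -` ball (partial j f (\<gamma> t0)) e)"
        by (intro continuous_openin_preimage_gen) auto
      then have "openin (Euclidean_space n) (V \<inter> partial j f -` ball (partial j f (\<gamma> t0)) e)"
        using V unfolding Euclidean_space_eq_top_of_set by (rule openin_trans)
      then obtain d where d: "d > 0" "\<And>z. z \<in> En n \<Longrightarrow> (\<And>i. i < n \<Longrightarrow> \<bar>z i - \<gamma> t0 i\<bar> < d) \<Longrightarrow>
          z \<in> V \<inter> partial j f -` ball (partial j f (\<gamma> t0)) e"
        using openin_Euclidean_box[of n _ "\<gamma> t0"] g0 e by (metis IntI centre_in_ball vimageI)
      have "\<forall>\<^sub>F t in at t0. \<bar>\<gamma> t i - \<gamma> t0 i\<bar> < d" if "i < n" for i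
      proof -
        have "((\<lambda>t. \<gamma> t i) \<longlongrightarrow> \<gamma> t0 i) (at t0)"
          using DERIV_isCont[OF gd[OF that]] by (simp add: isCont_def)
        then show ?thesis using d(1) by (auto dest: tendstoD simp: dist_real_def)
      qed
      then have "\<forall>\<^sub>F t in at t0. \<forall>i\<in>{..<n}. \<bar>\<gamma> t i - \<gamma> t0 i\<bar> < d"
        by (intro eventually_ball_finite) auto
      then show "\<forall>\<^sub>F t in at t0. dist (q t) (partial j f (\<gamma> t0)) < e"
      proof eventually_elim
        case (elim t)
        define S where "S = closed_segment (\<gamma> t0 j) (\<gamma> t j)"
        have inV: "(y j t)(j := s) \<in> V \<inter> partial j f -` ball (partial j f (\<gamma> t0)) e" if "s \<in> S" for s
        proof (rule d(2))
          show "(y j t)(j := s) \<in> En n" using gE j by (auto simp: y_def En_def)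
          have "\<bar>s - \<gamma> t0 j\<bar> \<le> \<bar>\<gamma> t j - \<gamma> t0 j\<bar>"
            using that by (auto simp: S_def closed_segment_eq_real_ivl split: if_splits)
          moreover have "\<bar>\<gamma> t j - \<gamma> t0 j\<bar> < d" using elim j by simp
          ultimately have sd: "\<bar>s - \<gamma> t0 j\<bar> < d" by linarith
          fix i assume "i < n"
          then show "\<bar>((y j t)(j := s)) i - \<gamma> t0 i\<bar> < d"
            using elim d(1) sd by (auto simp: y_def)
        qed
        define F where "F s = f ((y j t)(j := s))" for s
        define F' where "F' s = partial j f ((y j t)(j := s))" for s
        have D: "(F has_real_derivative F' s) (at s)" if "s \<in> S" for s
        proof -
          have "(y j t)(j := s) \<in> V" using inV[OF that] by simp
          with f' j have "((\<lambda>u. f (((y j t)(j := s))(j := u))) has_real_derivative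
              partial j f ((y j t)(j := s))) (at (((y j t)(j := s)) j))"
            by blast
          then show ?thesis by (simp add: F_def[abs_def] F'_def)
        qed
        show ?case
        proof (cases "\<gamma> t j = \<gamma> t0 j")
          case True
          then show ?thesis using e by (simp add: q_def)
        next
          case False
          \<comment> \<open>The mean value theorem asks for ordered end points, hence the two
            cases.\<close>
          have "\<exists>z\<in>S. F (\<gamma> t j) - F (\<gamma> t0 j) = (\<gamma> t j - \<gamma> t0 j) * F' z"
          proof (cases "\<gamma> t j < \<gamma> t0 j")
            case True
            obtain z where "z > \<gamma> t j" "z < \<gamma> t0 j" "F (\<gamma> t0 j) - F (\<gamma> t j) = (\<gamma> t0 j - \<gamma> t j) * F' z"
              using MVT2[OF True, of F F'] D by (auto simp: S_def closed_segment_eq_real_ivl)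
            then show ?thesis by (intro bexI[of _ z])
                (auto simp: S_def closed_segment_eq_real_ivl algebra_simps)
          next
            case F: False
            with False have lt: "\<gamma> t0 j < \<gamma> t j" by auto
            obtain z where "z > \<gamma> t0 j" "z < \<gamma> t j" "F (\<gamma> t j) - F (\<gamma> t0 j) = (\<gamma> t j - \<gamma> t0 j) * F' z"
              using MVT2[OF lt, of F F'] D by (auto simp: S_def closed_segment_eq_real_ivl)
            then show ?thesis by (intro bexI[of _ z]) (auto simp: S_def closed_segment_eq_real_ivl)
          qed
          then obtain z where z: "z \<in> S"
              "f (y (Suc j) t) - f (y j t) = (\<gamma> t j - \<gamma> t0 j) * partial j f ((y j t)(j := z))"
            using yS[of j t] by (auto simp: F_def F'_def)
          then have "q t = partial j f ((y j t)(j := z))" using False by (simp add: q_def)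
          then show ?thesis using inV[OF z(1)] by (simp add: dist_commute)
        qed
      qed
    qed
    then have "((\<lambda>t. q t * ((\<gamma> t j - \<gamma> t0 j) / (t - t0))) \<longlongrightarrow> partial j f (\<gamma> t0) * \<gamma>' j) (at t0)"
      using gd[OF j] by (intro tendsto_mult) (auto simp: has_field_derivative_iff)
    then show ?thesis
      unfolding has_field_derivative_iff qeq by simp
  qed
  have "((\<lambda>t. f (\<gamma> t0) + (\<Sum>j<n. f (y (Suc j) t) - f (y j t))) has_real_derivative
      0 + (\<Sum>i<n. partial i f (\<gamma> t0) * \<gamma>' i)) (at t0)"
    by (intro DERIV_add DERIV_const DERIV_sum) (use step in auto)
  then show ?thesis unfolding tel[abs_def, symmetric] by simp
qed

text \<open>The chain rule turns each partial derivative into a sum of products of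
  \<open>partial i f (G x)\<close> with a derivative of \<open>G\<close>. The induction hypothesis,
  general in \<open>f\<close>, covers the first factor.\<close>

lemma Ck_on_compose:
  assumes V: "openin (Euclidean_space n) V" and V': "openin (Euclidean_space m) V'"
    and f: "Ck_on m k V' f" and G: "\<And>i. i < m \<Longrightarrow> Ck_on n k V (\<lambda>x. G x i)"
    and GV: "\<And>x. x \<in> V \<Longrightarrow> G x \<in> V'"
  shows "Ck_on n k V (\<lambda>x. f (G x))"
  using f G
proof (induction k arbitrary: f)
  case 0
  note sub = openin_Euclidean_subset[OF V] and sub' = openin_Euclidean_subset[OF V']
  have "continuous_on V (\<lambda>x. G x i)" for i
  proof (cases "i < m")
    case True
    then show ?thesis using 0 sub by (simp add: Ck_on_0)
  next
    case False
    then have "G x i = 0" if "x \<in> V" for x using GV[OF that] sub' by (auto simp: En_def)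
    then show ?thesis by (simp cong: continuous_on_cong)
  qed
  then have "continuous_on V G" by (rule continuous_on_coordinatewise_then_product)
  moreover have "continuous_on V' f" using 0 sub' by (simp add: Ck_on_0)
  ultimately have "continuous_on V (\<lambda>x. f (G x))"
    by (intro continuous_on_compose2[of V' f V G]) (use GV in auto)
  then show ?case using sub by (simp add: Ck_on_0)
next
  case (Suc k)
  note sub = openin_Euclidean_subset[OF V] and sub' = openin_Euclidean_subset[OF V']
  have IH: "Ck_on n k V (\<lambda>x. h (G x))" if "Ck_on m k V' h" for h
  proof (rule Suc.IH[OF that])
    show "Ck_on n k V (\<lambda>x. G x i)" if "i < m" for i
      by (rule Ck_on_SucD[OF sub Suc.prems(2)[OF that]])
  qed
  show ?case
  proof (rule Ck_on_SucI[OF V, where D = "\<lambda>j x. \<Sum>i<m. partial i f (G x) * partial j (\<lambda>x. G x i) x"])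
    show "continuous_on V (\<lambda>x. f (G x))"
      by (rule Ck_on_imp_continuous_on[OF sub IH[OF Ck_on_SucD[OF sub' Suc.prems(1)]]])
    show "Ck_on n k V (\<lambda>x. \<Sum>i<m. partial i f (G x) * partial j (\<lambda>x. G x i) x)" if "j < n" for j
    proof (intro Ck_on_sum[OF V] Ck_on_mult[OF V] IH)
      fix i assume "i \<in> {..<m}"
      then show "Ck_on m k V' (partial i f)" "Ck_on n k V (partial j (\<lambda>x. G x i))"
        using Suc.prems that by (auto simp: Ck_on_Suc_iff[OF sub'] Ck_on_Suc_iff[OF sub])
    qed
    fix j x assume j: "j < n" and x: "x \<in> V"
    \<comment> \<open>Truncating at \<open>m\<close> puts the curve into \<open>En m\<close> for
      every \<open>t\<close>, as the chain rule along curves requires, even where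
      \<open>x(j := t)\<close> has left \<open>V\<close>. On \<open>V\<close> the truncation changes
      nothing.\<close>
    define \<gamma> where "\<gamma> t = (\<lambda>i. if i < m then G (x(j := t)) i else 0)" for t
    have eq: "G z = (\<lambda>i. if i < m then G z i else 0)" if "z \<in> V" for z
      using GV[OF that] sub' by (auto simp: En_def fun_eq_iff)
    have \<gamma>0: "\<gamma> (x j) = G x" unfolding \<gamma>_def fun_upd_triv by (rule eq[OF x, symmetric])
    have "((\<lambda>t. f (\<gamma> t)) has_real_derivative
        (\<Sum>i<m. partial i f (\<gamma> (x j)) * partial j (\<lambda>x. G x i) x)) (at (x j))"
    proof (rule has_real_derivative_along_curve[OF V' Suc.prems(1)])
      show "\<gamma> (x j) \<in> V'" using \<gamma>0 GV x by simp
      show "\<gamma> t \<in> En m" for t by (simp add: \<gamma>_def En_def)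
      show "((\<lambda>t. \<gamma> t i) has_real_derivative partial j (\<lambda>x. G x i) x) (at (x j))" if "i < m" for i
        using Suc.prems(2)[OF that] that j x by (simp add: \<gamma>_def Ck_on_Suc_iff[OF sub])
    qed
    moreover have "\<forall>\<^sub>F t in nhds (x j). f (\<gamma> t) = f (G (x(j := t)))"
      using eventually_fun_upd_in[OF V x j]
    proof eventually_elim
      case (elim t)
      show ?case unfolding \<gamma>_def eq[OF elim, symmetric] by (rule refl)
    qed
    ultimately show "((\<lambda>t. f (G (x(j := t)))) has_real_derivative
        (\<Sum>i<m. partial i f (G x) * partial j (\<lambda>x. G x i) x)) (at (x j))"
      using \<gamma>0 DERIV_cong_ev[OF refl, of "\<lambda>t. f (\<gamma> t)" "\<lambda>t. f (G (x(j := t)))" "x j"] by simp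
  qed
qed


section \<open>Integrals with parameters and Hadamard's lemma\<close>

lemma continuous_on_Ck_integrand:
  fixes \<theta> :: "'a::topological_space \<Rightarrow> nat \<Rightarrow> real"
  assumes "V \<subseteq> En n" "Ck_on n k V h" "\<And>j. continuous_on S (\<lambda>z. \<theta> z j)" "\<And>z. z \<in> S \<Longrightarrow> \<theta> z \<in> V"
    and "continuous_on S q"
  shows "continuous_on S (\<lambda>z. q z * h (\<theta> z) :: real)"
proof -
  have "continuous_on S \<theta>" using assms(3) by (rule continuous_on_coordinatewise_then_product)
  then have "continuous_on S (\<lambda>z. h (\<theta> z))"
    by (rule continuous_on_compose2[OF Ck_on_imp_continuous_on[OF assms(1,2)]]) (use assms(4) in auto)
  with assms(5) show ?thesis by (rule continuous_on_mult)
qed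

lemma continuous_on_homothety:
  fixes x :: "'a::topological_space \<Rightarrow> nat \<Rightarrow> real"
  assumes "\<And>j. continuous_on S (\<lambda>z. x z j)" "continuous_on S t"
  shows "continuous_on S (\<lambda>z. ((x z)(i := c + t z * (x z i - c))) j)"
proof (cases "j = i")
  case True
  then show ?thesis by (auto intro!: continuous_on_add continuous_on_mult continuous_on_diff assms)
next
  case False
  then show ?thesis using assms(1) by simp
qed

lemma continuous_on_coordinate:
  assumes "continuous_on S (x :: 'a::topological_space \<Rightarrow> nat \<Rightarrow> real)"
  shows "continuous_on S (\<lambda>z. x z j)"
  using continuous_on_compose2[OF continuous_on_product_coordinates assms subset_UNIV] .

text \<open>The weight \<open>t ^ m\<close> makes the induction work: differentiating in direction \<open>i\<close> produces
  another factor \<open>t\<close>.\<close>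

lemma Ck_on_integral:
  assumes V: "openin (Euclidean_space n) V" and i: "i < n"
    and star: "\<And>x t. x \<in> V \<Longrightarrow> 0 \<le> t \<Longrightarrow> t \<le> 1 \<Longrightarrow> x(i := c + t * (x i - c)) \<in> V"
    and h: "Ck_on n k V h"
  shows "Ck_on n k V (\<lambda>x. integral {0..1} (\<lambda>t. t ^ m * h (x(i := c + t * (x i - c)))))"
  using h
proof (induction k arbitrary: h m)
  note sub = openin_Euclidean_subset[OF V]
  have cont: "continuous_on V (\<lambda>x. integral {0..1} (\<lambda>t. t ^ m * h (x(i := c + t * (x i - c)))))"
    if "Ck_on n k V h" for h k m
  proof -
    have "continuous_on (V \<times> cbox 0 1)
        (\<lambda>z. (snd z)^m * h ((fst z)(i := c + snd z * (fst z i - c))))"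
    proof (rule continuous_on_Ck_integrand[OF sub that])
      show "continuous_on (V \<times> cbox 0 1) (\<lambda>z. ((fst z)(i := c + snd z * (fst z i - c))) j)" for j
        by (intro continuous_on_homothety continuous_on_coordinate continuous_on_fst
            continuous_on_snd continuous_on_id)
    qed (auto intro!: continuous_on_snd continuous_on_id continuous_on_power star simp del: fun_upd_apply)
    then show ?thesis
      using integral_continuous_on_param[of V "0::real" 1 "\<lambda>x t. t ^ m * h (x(i := c + t * (x i - c)))"]
      by (simp add: case_prod_unfold)
  qed
  {
    case (0 h m)
    show ?case unfolding Ck_on_0[OF sub] by (rule cont[OF 0])
  next
  case (Suc k h m)
  note h' = Suc.prems[unfolded Ck_on_Suc_iff[OF sub]]
  define D where "D j x = integral {0..1}
     (\<lambda>t. t ^ (if j = i then Suc m else m) * partial j h (x(i := c + t * (x i - c))))" for j x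
  show ?case
  proof (rule Ck_on_SucI[OF V cont[OF Suc.prems], where D = D])
    show "Ck_on n k V (D j)" if "j < n" for j
      unfolding D_def using h' that by (intro Suc.IH) auto
    fix j x assume j: "j < n" and x: "x \<in> V"
    obtain d where d: "d > 0"
      "\<And>y. y \<in> En n \<Longrightarrow> (\<And>i. i < n \<Longrightarrow> \<bar>y i - x i\<bar> < d) \<Longrightarrow> y \<in> V"
      using openin_Euclidean_box[OF V x] by blast
    \<comment> \<open>A ball for the varying coordinate on which the coordinate line stays in
      \<open>V\<close>; differentiation under the integral sign takes place over this ball.\<close>
    define U where "U = ball (x j) d"
    have UV: "x(j := s) \<in> V" if "s \<in> U" for s
    proof (rule d(2))
      show "x(j := s) \<in> En n" using x sub j by (auto simp: En_def)
      show "\<bar>(x(j := s)) l - x l\<bar> < d" if "l < n" for l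
        using \<open>s \<in> U\<close> d(1) by (simp add: U_def dist_real_def abs_minus_commute)
    qed
    define F where "F s t = t ^ m * h ((x(j := s))(i := c + t * ((x(j := s)) i - c)))" for s t
    define F' where "F' s t = t ^ (if j = i then Suc m else m) *
      partial j h ((x(j := s))(i := c + t * ((x(j := s)) i - c)))" for s t
    have pt: "(x(j := s))(i := c + t * ((x(j := s)) i - c)) \<in> V" if "s \<in> U" "0 \<le> t" "t \<le> 1" for s t
      using star[OF UV[OF that(1)] that(2,3)] .
    have der: "((\<lambda>s. F s t) has_field_derivative F' s t) (at s within U)" if s: "s \<in> U" and t:
        "t \<in> cbox 0 1" for s t
    proof -
      define y where "y = (x(j := s))(i := c + t * ((x(j := s)) i - c))"
      have yV: "y \<in> V" unfolding y_def using s t by (intro pt) auto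
      have hd: "((\<lambda>u. h (y(j := u))) has_real_derivative partial j h y) (at (y j))"
        using h' j yV by blast
      have "((\<lambda>s. F s t) has_field_derivative F' s t) (at s)"
      proof (cases "j = i")
        case True
        have "((\<lambda>u. h (y(j := c + t * (u - c)))) has_real_derivative partial j h y * t) (at s)"
        proof (rule DERIV_chain2[where f = "\<lambda>u. h (y(j := u))"])
          show "((\<lambda>u. h (y(j := u))) has_real_derivative partial j h y) (at (c + t * (s - c)))"
            using hd True by (simp add: y_def)
          show "((\<lambda>u. c + t * (u - c)) has_real_derivative t) (at s)"
            by (auto intro!: derivative_eq_intros)
        qed
        then have "((\<lambda>u. t ^ m * h (y(j := c + t * (u - c)))) has_real_derivative
            t ^ m * (partial j h y * t)) (at s)"
          by (rule DERIV_cmult)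
        moreover have "(\<lambda>u. F u t) = (\<lambda>u. t ^ m * h (y(j := c + t * (u - c))))"
          using True by (simp add: F_def y_def fun_eq_iff)
        moreover have "F' s t = t ^ m * (partial j h y * t)"
          using True by (simp add: F'_def y_def)
        ultimately show ?thesis by simp
      next
        case False
        have "(\<lambda>u. F u t) = (\<lambda>u. t ^ m * h (y(j := u)))"
          using False by (auto simp: F_def y_def fun_upd_twist)
        moreover have "F' s t = t ^ m * partial j h y" using False by (simp add: F'_def y_def)
        moreover have "y j = s" using False by (simp add: y_def)
        ultimately show ?thesis using DERIV_cmult[OF hd, of "t ^ m"] by simp
      qed
      then show ?thesis by (rule has_field_derivative_at_within)
    qed
    have cU: "continuous_on (U \<times> cbox 0 1) (\<lambda>z. ((x(j := fst z))(i :=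
        c + snd z * ((x(j := fst z)) i - c))) l)" for l
      by (rule continuous_on_homothety)
         (auto intro!: continuous_on_compose2[OF continuous_on_coordinate[OF continuous_on_fun_upd[of UNIV]]]
            continuous_on_fst continuous_on_snd continuous_on_id simp del: fun_upd_apply)
    have cF': "continuous_on (U \<times> cbox 0 1) (\<lambda>z. F' (fst z) (snd z))"
      unfolding F'_def
    proof (rule continuous_on_Ck_integrand[OF sub _ cU])
      show "Ck_on n k V (partial j h)" using h' j by blast
    qed (use pt in \<open>auto intro!: continuous_on_power continuous_on_snd continuous_on_id
      simp del: fun_upd_apply power_Suc\<close>)
    have cF: "continuous_on (U \<times> cbox 0 1) (\<lambda>z. F (fst z) (snd z))"
      unfolding F_def
      by (rule continuous_on_Ck_integrand[OF sub Suc.prems cU])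
         (use pt in \<open>auto intro!: continuous_on_power continuous_on_snd continuous_on_id simp del:
             fun_upd_apply\<close>)
    have int: "F s integrable_on cbox 0 1" if "s \<in> U" for s
    proof (rule integrable_continuous)
      show "continuous_on (cbox 0 1) (F s)"
        by (rule continuous_on_compose2[OF cF, where f = "\<lambda>t. (s, t)", simplified])
           (use that in \<open>auto intro!: continuous_on_Pair continuous_on_const continuous_on_id\<close>)
    qed
    have "((\<lambda>s. integral (cbox 0 1) (F s)) has_field_derivative integral (cbox 0 1) (F' (x j)))
        (at (x j) within U)"
      by (rule leibniz_rule_field_derivative[OF der int])
         (use cF' d(1) in \<open>auto simp: U_def case_prod_unfold\<close>)
    moreover have "at (x j) within U = at (x j)" unfolding U_def using d(1) by (intro at_within_open) auto
    ultimately show "((\<lambda>s. integral {0..1} (\<lambda>t. t ^ m * h ((x(j := s))(i := c + t * ((x(j := s)) i - c)))))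
      has_real_derivative D j x) (at (x j))"
      by (simp only: F_def[abs_def] F'_def[abs_def] D_def fun_upd_triv cbox_interval)
  qed
  }
qed

text \<open>This is the fundamental theorem of calculus along the segment from
  \<open>x(i := c)\<close> to \<open>x\<close>. Since only coordinate \<open>i\<close> moves, the
  one-variable chain rule is enough.\<close>

lemma Hadamard_coordinate:
  assumes V: "openin (Euclidean_space n) V" and i: "i < n" and x: "x \<in> V"
    and star: "\<And>x t. x \<in> V \<Longrightarrow> 0 \<le> t \<Longrightarrow> t \<le> 1 \<Longrightarrow> x(i := c + t * (x i - c)) \<in> V"
    and f: "Ck_on n (Suc k) V f"
  shows "f x = f (x(i := c)) + (x i - c) * integral {0..1} (\<lambda>t. partial i f (x(i := c + t * (x i - c))))"
proof -
  note sub = openin_Euclidean_subset[OF V]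
  note f' = f[unfolded Ck_on_Suc_iff[OF sub]]
  have "((\<lambda>t. f (x(i := c + t * (x i - c)))) has_real_derivative
      partial i f (x(i := c + t * (x i - c))) * (x i - c)) (at t)" if "0 \<le> t" "t \<le> 1" for t
  proof (rule DERIV_chain2[where f = "\<lambda>s. f (x(i := s))"])
    have "x(i := c + t * (x i - c)) \<in> V" using star x that by blast
    with f' i have "((\<lambda>u. f ((x(i := c + t * (x i - c)))(i := u))) has_real_derivative
      partial i f (x(i := c + t * (x i - c)))) (at ((x(i := c + t * (x i - c))) i))" by blast
    then show "((\<lambda>u. f (x(i := u))) has_real_derivative
      partial i f (x(i := c + t * (x i - c)))) (at (c + t * (x i - c)))" by simp
  qed (auto intro!: derivative_eq_intros)
  then have "((\<lambda>t. partial i f (x(i := c + t * (x i - c))) * (x i - c)) has_integral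
      f (x(i := c + 1 * (x i - c))) - f (x(i := c + 0 * (x i - c)))) {0..1}"
    by (intro fundamental_theorem_of_calculus)
       (auto simp flip: has_real_derivative_iff_has_vector_derivative intro: has_field_derivative_at_within
         simp del: fun_upd_apply)
  then have "integral {0..1} (\<lambda>t. partial i f (x(i := c + t * (x i - c))) * (x i - c)) = f x - f (x(i := c))"
    by (intro integral_unique) simp
  then show ?thesis by (simp add: mult.commute)
qed

lemma Cinf_onD: "Cinf_on n V f \<Longrightarrow> Ck_on n k V f"
  by (simp add: Cinf_on_def)

lemma Cinf_on_partial:
  assumes "V \<subseteq> En n" "i < n" "Cinf_on n V f" shows "Cinf_on n V (partial i f)"
  using assms(2) Cinf_onD[OF assms(3)] Ck_on_Suc_iff[OF assms(1)] unfolding Cinf_on_def by blast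

text \<open>Walk from \<open>a\<close> to \<open>x\<close> changing one coordinate at a time and
  apply \<open>Hadamard_coordinate\<close> to each leg. A box is stable under moving single
  coordinates towards those of \<open>a\<close>, so the walk stays inside it.\<close>

lemma Cinf_on_Hadamard:
  assumes B: "B = {y \<in> En n. \<forall>i<n. \<bar>y i - a i\<bar> < d}" and a: "a \<in> En n" and d: "d > 0"
    and f: "Cinf_on n B f"
  obtains g where "\<And>i. i < n \<Longrightarrow> Cinf_on n B (g i)"
    "\<And>x. x \<in> B \<Longrightarrow> f x = f a + (\<Sum>i<n. (x i - a i) * g i x)"
    "\<And>i. i < n \<Longrightarrow> g i a = partial i f a"
proof -
  have Bo: "openin (Euclidean_space n) B" unfolding B by (rule openin_Euclidean_coord_less)
  note sub = openin_Euclidean_subset[OF Bo]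
  have star: "x(i := a i + t * (x i - a i)) \<in> B" if "x \<in> B" "0 \<le> t" "t \<le> 1" "i < n" for i x t
  proof -
    have "\<bar>t * (x i - a i)\<bar> \<le> 1 * \<bar>x i - a i\<bar>"
      unfolding abs_mult using that by (intro mult_right_mono) auto
    moreover have "\<bar>x i - a i\<bar> < d" using that B by auto
    ultimately have "\<bar>t * (x i - a i)\<bar> < d" by simp
    then show ?thesis using that by (auto simp: B En_def)
  qed
  \<comment> \<open>The factor \<open>t ^ 0\<close> fits the integrand to the weight in
    \<open>Ck_on_integral\<close>.\<close>
  define G where "G i x = integral {0..1} (\<lambda>t. t ^ 0 * partial i f (x(i := a i + t * (x i - a i))))" for i x
  \<comment> \<open>The stations of the walk, with \<open>P 0 x = a\<close> and
    \<open>P n x = x\<close>. The coefficient of leg \<open>i\<close> is \<open>G i\<close> at the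
    later station \<open>P (Suc i) x\<close>.\<close>
  define P where "P j x = (\<lambda>i. if i < j then x i else a i)" for j and x :: "nat \<Rightarrow> real"
  have G: "Cinf_on n B (G i)" if "i < n" for i
    unfolding Cinf_on_def G_def
    using Ck_on_integral[OF Bo that star[OF _ _ _ that]] Cinf_onD[OF Cinf_on_partial[OF sub that f]] by blast
  have PB: "P j x \<in> B" if "x \<in> B" "j \<le> n" for j x
    using that a d by (auto simp: B P_def En_def)
  have PC: "Ck_on n k B (\<lambda>x. P j x i)" for i j k
    by (cases "i < j") (simp_all add: P_def Ck_on_const[OF Bo] Ck_on_coord[OF Bo])
  show ?thesis
  proof (rule that[of "\<lambda>i x. G i (P (Suc i) x)"])
    show "Cinf_on n B (\<lambda>x. G i (P (Suc i) x))" if "i < n" for i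
      unfolding Cinf_on_def
      using Ck_on_compose[OF Bo Bo Cinf_onD[OF G[OF that]] PC] PB that by simp
    show "f x = f a + (\<Sum>i<n. (x i - a i) * G i (P (Suc i) x))" if "x \<in> B" for x
    proof -
      have "f (P (Suc j) x) - f (P j x) = (x j - a j) * G j (P (Suc j) x)" if j: "j < n" for j
      proof -
        have PS: "P (Suc j) x \<in> B" using PB \<open>x \<in> B\<close> j by simp
        have "(P (Suc j) x)(j := a j) = P j x" by (auto simp: P_def fun_eq_iff)
        moreover have "P (Suc j) x j = x j" by (simp add: P_def)
        ultimately show ?thesis
          using Hadamard_coordinate[OF Bo j PS star[OF _ _ _ j] Cinf_onD[OF f]] by (simp add: G_def)
      qed
      then have "(\<Sum>i<n. (x i - a i) * G i (P (Suc i) x)) = (\<Sum>j<n. f (P (Suc j) x) - f (P j x))" by simp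
      also have "\<dots> = f (P n x) - f (P 0 x)" by (rule sum_lessThan_telescope)
      also have "P n x = x" using that a by (auto simp: P_def B En_def fun_eq_iff)
      also have "P 0 x = a" by (simp add: P_def)
      finally show ?thesis by simp
    qed
    show "G i (P (Suc i) a) = partial i f a" if "i < n" for i
    proof -
      have "P (Suc i) a = a" by (auto simp: P_def)
      then show ?thesis by (simp add: G_def)
    qed
  qed
qed


subsection \<open>A smooth step function\<close>

text \<open>For \<open>p = 1\<close> this is the classical function exp(-1/t) that is flat at 0.
  Polynomials in 1/t are carried along because they make the family closed under
  differentiation.\<close>

definition exp_flat :: "real poly \<Rightarrow> real \<Rightarrow> real"
  where "exp_flat p t = (if t > 0 then poly p (inverse t) * exp (- inverse t) else 0)"

lemma poly_times_exp_minus_tendsto_0: "((\<lambda>s. poly p s * exp (- s)) \<longlongrightarrow> (0::real)) at_top"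
proof -
  have "((\<lambda>s. \<Sum>i\<le>degree p. coeff p i * (s ^ i / exp s)) \<longlongrightarrow> (\<Sum>i\<le>degree p. coeff p i * 0)) at_top"
    by (intro tendsto_sum tendsto_mult tendsto_const tendsto_power_div_exp_0)
  then show ?thesis
    by (simp add: poly_altdef sum_distrib_right exp_minus divide_inverse mult.assoc)
qed

text \<open>With s = 1/t one has ds/dt = -s^2, so p(s) exp(-s) has derivative s^2 (p - p')(s)
  exp(-s); \<open>[:0,0,1:]\<close> is the polynomial s^2.\<close>

lemma exp_flat_DERIV:
  "(exp_flat p has_real_derivative exp_flat ([:0,0,1:] * (p - pderiv p)) t) (at t)"
proof -
  consider "t > 0" | "t < 0" | "t = 0" by linarith
  then show ?thesis
  proof cases
    case 1
    have "((\<lambda>t. poly p (inverse t) * exp (- inverse t)) has_real_derivative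
        exp_flat ([:0,0,1:] * (p - pderiv p)) t) (at t)"
      using 1 by (auto intro!: derivative_eq_intros DERIV_chain2[OF poly_DERIV]
          simp: exp_flat_def algebra_simps power2_eq_square)
    moreover have "\<forall>\<^sub>F s in nhds t. exp_flat p s = poly p (inverse s) * exp (- inverse s)"
      using eventually_nhds_in_open[of "{0<..}" t] 1 by (auto simp: exp_flat_def elim: eventually_mono)
    ultimately show ?thesis by (simp add: DERIV_cong_ev[OF refl _ refl])
  next
    case 2
    have "\<forall>\<^sub>F s in nhds t. exp_flat p s = 0"
      using eventually_nhds_in_open[of "{..<0}" t] 2 by (auto simp: exp_flat_def elim: eventually_mono)
    moreover have "exp_flat ([:0,0,1:] * (p - pderiv p)) t = 0" using 2 by (simp add: exp_flat_def)
    ultimately show ?thesis by (simp add: DERIV_cong_ev[OF refl _ refl])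
  next
    case 3
    \<comment> \<open>Dividing by \<open>s\<close> multiplies by its inverse, so the difference
      quotient at 0 from the right again has the form polynomial times exponential.\<close>
    have "((\<lambda>s. poly ([:0,1:] * p) (inverse s) * exp (- inverse s)) \<longlongrightarrow> 0) (at_right 0)"
      by (rule filterlim_compose[OF poly_times_exp_minus_tendsto_0 filterlim_inverse_at_top_right])
    then have "((\<lambda>s. exp_flat p s / s) \<longlongrightarrow> 0) (at_right 0)"
      by (rule Lim_transform_eventually)
         (auto simp: exp_flat_def eventually_at_right_field divide_inverse intro!: exI[of _ 1])
    moreover have "((\<lambda>s. exp_flat p s / s) \<longlongrightarrow> 0) (at_left 0)"
      by (rule Lim_transform_eventually[OF tendsto_const])
         (auto simp: exp_flat_def eventually_at_left_field intro!: exI[of _ "-1"])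
    ultimately have "((\<lambda>s. exp_flat p s / s) \<longlongrightarrow> 0) (at 0)" by (simp add: filterlim_split_at)
    moreover have "exp_flat q 0 = 0" for q by (simp add: exp_flat_def)
    ultimately show ?thesis using 3 by (simp add: has_field_derivative_iff)
  qed
qed

text \<open>The classical transition function e(t) / (e(t) + e(1 - t)). Its denominator is always
  positive, because \<open>t\<close> and \<open>1 - t\<close> are never both at most 0.\<close>

definition smooth_step :: "real \<Rightarrow> real"
  where "smooth_step t = exp_flat 1 t * inverse (exp_flat 1 t + exp_flat 1 (1 - t))"

lemma smooth_step_eq_0: "t \<le> 0 \<Longrightarrow> smooth_step t = 0"
  by (simp add: smooth_step_def exp_flat_def)

lemma smooth_step_eq_1: "t \<ge> 1 \<Longrightarrow> smooth_step t = 1"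
  by (simp add: smooth_step_def exp_flat_def)

lemma openin_Euclidean_En: "openin (Euclidean_space n) (En n)"
  by (metis openin_topspace topspace_Euclidean_space_En)

text \<open>A function of one real variable is viewed on \<open>En 1\<close> through coordinate 0,
  so that it can be composed by \<open>Ck_on_compose\<close>.\<close>

lemma Ck_on_exp_flat: "Ck_on 1 k (En 1) (\<lambda>y. exp_flat p (y 0))"
proof (induction k arbitrary: p)
  have c: "continuous_on (En 1) (\<lambda>y. exp_flat p (y 0))" for p
  proof (rule continuous_on_compose2[of UNIV "exp_flat p"])
    show "continuous_on UNIV (exp_flat p)"
      using exp_flat_DERIV by (intro DERIV_continuous_on) auto
  qed (auto intro: continuous_on_coordinate[OF continuous_on_id])
  {
    case 0
    show ?case using c unfolding Ck_on_0[OF subset_refl] .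
  next
    case (Suc k)
    show ?case
    proof (rule Ck_on_SucI[OF openin_Euclidean_En c, where D =
        "\<lambda>_ y. exp_flat ([:0,0,1:] * (p - pderiv p)) (y 0)"])
      show "((\<lambda>t. exp_flat p ((x(i := t)) 0)) has_real_derivative
          exp_flat ([:0,0,1:] * (p - pderiv p)) (x 0)) (at (x i))"
        if "i < 1" for i :: nat and x using that exp_flat_DERIV[of p "x 0"] by simp
    qed (rule Suc.IH)
  }
qed

lemma Ck_on_smooth_step:
  assumes V: "openin (Euclidean_space n) V" and f: "Ck_on n k V f"
  shows "Ck_on n k V (\<lambda>x. smooth_step (f x))"
proof -
  have comp: "Ck_on n k V (\<lambda>x. exp_flat 1 (h x))" if "Ck_on n k V h" for h
    using Ck_on_compose[OF V openin_Euclidean_En Ck_on_exp_flat, of k "\<lambda>x i. if i = 0 then h x else 0" 1] that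
    by (simp add: En_def)
  have "Ck_on n k V (\<lambda>x. exp_flat 1 (1 + (-1) * f x))"
    by (intro comp Ck_on_add[OF V] Ck_on_mult[OF V] Ck_on_const[OF V] f)
  then have d: "Ck_on n k V (\<lambda>x. exp_flat 1 (f x) + exp_flat 1 (1 - f x))"
    using comp[OF f] by (intro Ck_on_add[OF V]) auto
  have "exp_flat 1 t + exp_flat 1 (1 - t) \<noteq> 0" for t
  proof -
    have "exp_flat 1 s \<ge> 0" "s > 0 \<Longrightarrow> exp_flat 1 s > 0" for s by (auto simp: exp_flat_def)
    moreover have "t > 0 \<or> 1 - t > 0" by linarith
    ultimately show ?thesis by (smt (verit))
  qed
  with d show ?thesis
    unfolding smooth_step_def by (intro Ck_on_mult[OF V] comp[OF f] Ck_on_inverse[OF V d])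
qed


subsection \<open>Smooth manifolds\<close>

lemma sum_fun_apply: "(\<Sum>a\<in>A. (f a :: 'x \<Rightarrow> 'y::comm_monoid_add)) x = (\<Sum>a\<in>A. f a x)"
  by (induction A rule: infinite_finite_induct) auto

text \<open>Tychonoff's theorem: the box is a product of compact intervals and, from
  \<open>N\<close> on, of singletons.\<close>

lemma compact_coordinate_box:
  "compact {y \<in> En N. \<forall>i<N. \<bar>y i - a i\<bar> \<le> r}"
proof -
  have eq: "{y \<in> En N. \<forall>i<N. \<bar>y i - a i\<bar> \<le> r} =
      (\<Pi>\<^sub>E i\<in>UNIV. if i < N then {a i - r..a i + r} else {0})" (is "?L = ?R")
  proof
    show "?L \<subseteq> ?R" by (auto simp: En_def PiE_iff abs_le_iff)
    show "?R \<subseteq> ?L"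
    proof
      fix y assume y: "y \<in> ?R"
      then have yi: "y i \<in> (if i < N then {a i - r..a i + r} else {0})" for i by (auto simp: PiE_iff)
      have "y i = 0" if "i \<ge> N" for i using yi[of i] that by simp
      moreover have "\<bar>y i - a i\<bar> \<le> r" if "i < N" for i using yi[of i] that by auto
      ultimately show "y \<in> ?L" by (simp add: En_def)
    qed
  qed
  have "compactin (product_topology (\<lambda>i. euclidean) UNIV) ?R"
    by (subst compactin_PiE) auto
  then show ?thesis unfolding eq by (simp add: euclidean_product_topology)
qed

locale smooth_mfd =
  fixes M :: "'m::{t2_space,second_countable_topology} mfd"
  assumes smooth_manifold: "smooth_manifold M"
begin

abbreviation "n \<equiv> dim_mfd M"

abbreviation "\<A> \<equiv> smooth_funs M"

lemma chart_exists: obtains U \<phi> where "(U, \<phi>) \<in> charts M" "p \<in> U"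
proof -
  have "(\<Union>(U, \<phi>)\<in>charts M. U) = UNIV" using smooth_manifold by (simp add: smooth_manifold_def)
  then have "p \<in> (\<Union>(U, \<phi>)\<in>charts M. U)" by simp
  then show ?thesis using that by auto
qed

lemma chart_props:
  assumes "(U, \<phi>) \<in> charts M"
  shows chart_open: "open U"
    and chart_image_openin: "openin (Euclidean_space n) (\<phi> ` U)"
    and chart_homeomorphic:
      "homeomorphic_map (top_of_set U) (subtopology (Euclidean_space n) (\<phi> ` U)) \<phi>"
proof -
  have "\<forall>(U, \<phi>)\<in>charts M. open U \<and> openin (Euclidean_space n) (\<phi> ` U) \<and>
      homeomorphic_map (top_of_set U) (subtopology (Euclidean_space n) (\<phi> ` U)) \<phi>"
    using smooth_manifold by (simp add: smooth_manifold_def)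
  then show "open U" "openin (Euclidean_space n) (\<phi> ` U)"
      "homeomorphic_map (top_of_set U) (subtopology (Euclidean_space n) (\<phi> ` U)) \<phi>"
    using assms by auto
qed

lemma chart_transition:
  assumes "(U, \<phi>) \<in> charts M" "(V, \<psi>) \<in> charts M" "i < n"
  shows "Cinf_on n (\<phi> ` (U \<inter> V)) (\<lambda>x. \<psi> (inv_into U \<phi> x) i)"
proof -
  have "\<forall>(U, \<phi>)\<in>charts M. \<forall>(V, \<psi>)\<in>charts M. \<forall>i<n.
      Cinf_on n (\<phi> ` (U \<inter> V)) (\<lambda>x. \<psi> (inv_into U \<phi> x) i)"
    using smooth_manifold by (simp add: smooth_manifold_def)
  then show ?thesis using assms by fast
qed

lemma chart_inj: "(U, \<phi>) \<in> charts M \<Longrightarrow> inj_on \<phi> U"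
  using homeomorphic_imp_injective_map[OF chart_homeomorphic] by fastforce

lemma chart_inv: "(U, \<phi>) \<in> charts M \<Longrightarrow> q \<in> U \<Longrightarrow> inv_into U \<phi> (\<phi> q) = q"
  using chart_inj by (simp add: inv_into_f_f)

lemma chart_in_En: "(U, \<phi>) \<in> charts M \<Longrightarrow> q \<in> U \<Longrightarrow> \<phi> q \<in> En n"
  using openin_Euclidean_subset[OF chart_image_openin] by blast

lemma chart_image_open:
  assumes c: "(U, \<phi>) \<in> charts M" and W: "open W"
  shows "openin (Euclidean_space n) (\<phi> ` (W \<inter> U))"
proof -
  have "openin (top_of_set U) (W \<inter> U)" using W by (auto simp: openin_open)
  then have "openin (subtopology (Euclidean_space n) (\<phi> ` U)) (\<phi> ` (W \<inter> U))"
    using homeomorphic_imp_open_map[OF chart_homeomorphic[OF c]] unfolding open_map_def by blast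
  then show ?thesis using chart_image_openin[OF c] openin_open_subtopology by blast
qed

lemma chart_preimage_open:
  assumes c: "(U, \<phi>) \<in> charts M" and V: "openin (Euclidean_space n) V"
  shows "open {q \<in> U. \<phi> q \<in> V}"
proof -
  have "openin (subtopology (Euclidean_space n) (\<phi> ` U)) (V \<inter> \<phi> ` U)"
    using V by (auto simp: openin_subtopology)
  then have "openin (top_of_set U) {q \<in> topspace (top_of_set U). \<phi> q \<in> V \<inter> \<phi> ` U}"
    by (rule openin_continuous_map_preimage[OF homeomorphic_imp_continuous_map[OF chart_homeomorphic[OF c]]])
  moreover have "{q \<in> topspace (top_of_set U). \<phi> q \<in> V \<inter> \<phi> ` U} = {q \<in> U. \<phi> q \<in> V}" by auto
  ultimately show ?thesis using chart_open[OF c] by (simp add: openin_open_eq)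
qed


section \<open>Smooth functions on open sets, bump functions and global extensions\<close>

lemma smooth_fun_onD:
  "smooth_fun_on M W f \<Longrightarrow> (U, \<phi>) \<in> charts M \<Longrightarrow> Ck_on n k (\<phi> ` (W \<inter> U)) (\<lambda>x. f (inv_into U \<phi> x))"
  unfolding smooth_fun_on_def Cinf_on_def by blast

lemma smooth_fun_onI:
  "(\<And>U \<phi> k. (U, \<phi>) \<in> charts M \<Longrightarrow> Ck_on n k (\<phi> ` (W \<inter> U)) (\<lambda>x. f (inv_into U \<phi> x))) \<Longrightarrow> smooth_fun_on M W f"
  unfolding smooth_fun_on_def Cinf_on_def by blast

lemma smooth_fun_on_cong:
  assumes "open W" "\<And>q. q \<in> W \<Longrightarrow> f q = g q" "smooth_fun_on M W f"
  shows "smooth_fun_on M W g"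
proof (rule smooth_fun_onI)
  fix U \<phi> k assume c: "(U, \<phi>) \<in> charts M"
  show "Ck_on n k (\<phi> ` (W \<inter> U)) (\<lambda>x. g (inv_into U \<phi> x))"
    by (rule Ck_on_cong[OF chart_image_open[OF c assms(1)] _ smooth_fun_onD[OF assms(3) c]])
       (auto simp: chart_inv[OF c] assms(2))
qed

lemma smooth_fun_on_subset:
  assumes "W' \<subseteq> W" "smooth_fun_on M W f"
  shows "smooth_fun_on M W' f"
proof (rule smooth_fun_onI)
  fix U \<phi> k assume c: "(U, \<phi>) \<in> charts M"
  show "Ck_on n k (\<phi> ` (W' \<inter> U)) (\<lambda>x. f (inv_into U \<phi> x))"
    by (rule Ck_on_subset[OF _ _ smooth_fun_onD[OF assms(2) c]])
       (use assms(1) chart_in_En[OF c] in auto)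
qed

lemma smooth_fun_on_local:
  assumes W: "open W" and L: "\<And>p. p \<in> W \<Longrightarrow> \<exists>W'. open W' \<and> p \<in> W' \<and> smooth_fun_on M W' f"
  shows "smooth_fun_on M W f"
proof (rule smooth_fun_onI)
  fix U \<phi> k assume c: "(U, \<phi>) \<in> charts M"
  show "Ck_on n k (\<phi> ` (W \<inter> U)) (\<lambda>x. f (inv_into U \<phi> x))"
  proof (rule Ck_on_local[OF chart_image_open[OF c W]])
    fix x assume "x \<in> \<phi> ` (W \<inter> U)"
    then obtain p where p: "p \<in> W" "p \<in> U" "x = \<phi> p" by auto
    obtain W' where "open W'" "p \<in> W'" "smooth_fun_on M W' f" using L[OF p(1)] by blast
    then show "\<exists>V'. openin (Euclidean_space n) V' \<and> x \<in> V' \<and> Ck_on n k V' (\<lambda>x. f (inv_into U \<phi> x))"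
      using p smooth_fun_onD[OF _ c] by (intro exI[of _ "\<phi> ` (W' \<inter> U)"] conjI chart_image_open[OF c]) auto
  qed
qed

lemma smooth_fun_on_const: "open W \<Longrightarrow> smooth_fun_on M W (\<lambda>q. a)"
  by (rule smooth_fun_onI, rule Ck_on_const[OF chart_image_open])

lemma smooth_fun_on_add:
  "open W \<Longrightarrow> smooth_fun_on M W f \<Longrightarrow> smooth_fun_on M W g \<Longrightarrow> smooth_fun_on M W (\<lambda>q. f q + g q)"
  by (rule smooth_fun_onI, rule Ck_on_add[OF chart_image_open])
    (auto intro: smooth_fun_onD)

lemma smooth_fun_on_mult:
  "open W \<Longrightarrow> smooth_fun_on M W f \<Longrightarrow> smooth_fun_on M W g \<Longrightarrow> smooth_fun_on M W (\<lambda>q. f q * g q)"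
  by (rule smooth_fun_onI, rule Ck_on_mult[OF chart_image_open])
    (auto intro: smooth_fun_onD)

lemma smooth_fun_on_sum:
  "open W \<Longrightarrow> (\<And>a. a \<in> A \<Longrightarrow> smooth_fun_on M W (f a)) \<Longrightarrow> smooth_fun_on M W (\<lambda>q. \<Sum>a\<in>A. f a q)"
  by (rule smooth_fun_onI, rule Ck_on_sum[OF chart_image_open])
    (auto intro: smooth_fun_onD)

lemma smooth_fun_on_smooth_step:
  "open W \<Longrightarrow> smooth_fun_on M W f \<Longrightarrow> smooth_fun_on M W (\<lambda>q. smooth_step (f q))"
  by (rule smooth_fun_onI, rule Ck_on_smooth_step[OF chart_image_open])
    (auto intro: smooth_fun_onD)

text \<open>Read in a second chart, a coordinate function is a component of a transition
  map.\<close>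

lemma smooth_fun_on_coord:
  assumes c: "(U, \<phi>) \<in> charts M" and i: "i < n"
  shows "smooth_fun_on M U (\<lambda>q. \<phi> q i)"
proof (rule smooth_fun_onI)
  fix V \<psi> k assume "(V, \<psi>) \<in> charts M"
  then show "Ck_on n k (\<psi> ` (U \<inter> V)) (\<lambda>x. \<phi> (inv_into V \<psi> x) i)"
    using chart_transition[OF _ c i, of V \<psi>] by (simp add: Cinf_on_def Int_commute)
qed

text \<open>This brings the coefficients of Hadamard's lemma, which are functions on a chart image,
  back to the manifold.\<close>

lemma smooth_fun_on_chart_compose:
  assumes c: "(U, \<phi>) \<in> charts M" and W: "open W" "W \<subseteq> U"
    and V: "openin (Euclidean_space n) V" "\<phi> ` W \<subseteq> V" and h: "Cinf_on n V h"
  shows "smooth_fun_on M W (\<lambda>q. h (\<phi> q))"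
proof (rule smooth_fun_onI)
  fix V' \<psi> k assume c': "(V', \<psi>) \<in> charts M"
  show "Ck_on n k (\<psi> ` (W \<inter> V')) (\<lambda>x. h (\<phi> (inv_into V' \<psi> x)))"
  proof (rule Ck_on_compose[OF chart_image_open[OF c' W(1)] V(1) Cinf_onD[OF h]])
    show "Ck_on n k (\<psi> ` (W \<inter> V')) (\<lambda>x. \<phi> (inv_into V' \<psi> x) i)" if "i < n" for i
      using smooth_fun_onD[OF smooth_fun_on_subset[OF W(2) smooth_fun_on_coord[OF c that]] c'] .
    show "\<phi> (inv_into V' \<psi> x) \<in> V" if "x \<in> \<psi> ` (W \<inter> V')" for x
      using that V(2) by (auto simp: chart_inv[OF c'])
  qed
qed

lemma smooth_funs_onD: "f \<in> \<A> \<Longrightarrow> smooth_fun_on M W f"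
  using smooth_fun_on_subset[of W UNIV f] by (simp add: smooth_funs_def)

lemma smooth_funs_const [simp]: "(\<lambda>q. a) \<in> \<A>"
  by (simp add: smooth_funs_def smooth_fun_on_const)

lemma smooth_funs_zero [simp]: "0 \<in> \<A>"
  by (simp add: zero_fun_def)

lemma smooth_funs_add: "f \<in> \<A> \<Longrightarrow> g \<in> \<A> \<Longrightarrow> f + g \<in> \<A>"
  by (simp add: smooth_funs_def smooth_fun_on_add plus_fun_def)

lemma smooth_funs_mult: "f \<in> \<A> \<Longrightarrow> g \<in> \<A> \<Longrightarrow> f * g \<in> \<A>"
  by (simp add: smooth_funs_def smooth_fun_on_mult times_fun_def)

lemma smooth_funs_scaleR: "f \<in> \<A> \<Longrightarrow> a *\<^sub>R f \<in> \<A>"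
  using smooth_funs_mult[OF smooth_funs_const[of a]] by (simp add: scaleR_fun_def times_fun_def)

lemma smooth_funs_diff: "f \<in> \<A> \<Longrightarrow> g \<in> \<A> \<Longrightarrow> f - g \<in> \<A>"
  using smooth_funs_add[OF _ smooth_funs_scaleR[of g "-1"], of f] by simp

lemma smooth_funs_sum: "(\<And>a. a \<in> A \<Longrightarrow> f a \<in> \<A>) \<Longrightarrow> (\<Sum>a\<in>A. f a) \<in> \<A>"
  by (induction A rule: infinite_finite_induct) (auto intro: smooth_funs_add)

text \<open>The open sets \<open>W\<close> and \<open>- K\<close> cover the manifold; the extension
  equals \<open>f\<close> on the first and 0 on the second.\<close>

lemma smooth_funs_extend_by_zero:
  assumes "open W" "closed K" "K \<subseteq> W" "smooth_fun_on M W f" "\<And>q. q \<in> W \<Longrightarrow> q \<notin> K \<Longrightarrow> f q = 0"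
  shows "(\<lambda>q. if q \<in> W then f q else 0) \<in> \<A>"
proof -
  have "\<exists>W'. open W' \<and> p \<in> W' \<and> smooth_fun_on M W' (\<lambda>q. if q \<in> W then f q else 0)" for p
  proof (cases "p \<in> W")
    case True
    have "smooth_fun_on M W (\<lambda>q. if q \<in> W then f q else 0)"
      by (rule smooth_fun_on_cong[OF assms(1) _ assms(4)]) simp
    then show ?thesis using True assms(1) by blast
  next
    case False
    have "smooth_fun_on M (- K) (\<lambda>q. if q \<in> W then f q else 0)"
      by (rule smooth_fun_on_cong[OF _ _ smooth_fun_on_const[of _ 0]]) (use assms in auto)
    then show ?thesis using False assms(2,3) by (intro exI[of _ "- K"]) auto
  qed
  then show ?thesis unfolding smooth_funs_def using smooth_fun_on_local[OF open_UNIV] by blast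
qed

text \<open>A step function of the squared distance in a chart. Both a plateau \<open>W'\<close> and
  a closed set \<open>K\<close> carrying the bump are delivered: the plateau preserves germs at
  \<open>p\<close>, and \<open>K\<close> permits extension by zero.\<close>

lemma smooth_bump:
  assumes W: "open W" "p \<in> W"
  obtains \<beta> K W' where "\<beta> \<in> \<A>" "closed K" "K \<subseteq> W" "open W'" "p \<in> W'" "W' \<subseteq> W"
    "\<And>q. q \<in> W' \<Longrightarrow> \<beta> q = 1" "\<And>q. q \<notin> K \<Longrightarrow> \<beta> q = 0"
proof -
  obtain U \<phi> where c: "(U, \<phi>) \<in> charts M" "p \<in> U" by (rule chart_exists)
  have "openin (Euclidean_space n) (\<phi> ` (W \<inter> U))" by (rule chart_image_open[OF c(1) W(1)])
  then obtain d where d: "d > 0" "\<And>y. y \<in> En n \<Longrightarrow> (\<And>i. i < n \<Longrightarrow> \<bar>y i - \<phi> p i\<bar> < d) \<Longrightarrow> y \<in> \<phi> ` (W \<inter> U)"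
    using openin_Euclidean_box[of n "\<phi> ` (W \<inter> U)" "\<phi> p"] c W by blast
  define N where "N y = (\<Sum>i<n. (y i - \<phi> p i)\<^sup>2)" for y
  \<comment> \<open>The bump will vanish beyond the Euclidean radius sqrt 2 * d / 2. This is below 3
    * d / 4, since 1/2 < 9/16, so the bump is carried by this compact box, and 3 * d / 4 < d keeps
    the box in the chart image of \<open>W\<close>.\<close>
  define C where "C = {y \<in> En n. \<forall>i<n. \<bar>y i - \<phi> p i\<bar> \<le> 3 * d / 4}"
  define K where "K = {q \<in> U. \<phi> q \<in> C}"
  define W' where "W' = {q \<in> U. \<phi> q \<in> {y \<in> En n. N y < (d/2)\<^sup>2}}"
  \<comment> \<open>The argument of the step is at least 1 while \<open>N\<close> is at most
    (d/2)^2, and at most 0 once \<open>N\<close> reaches twice that value.\<close>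
  define \<beta> where "\<beta> q = (if q \<in> U then smooth_step (2 + (-1 / (d/2)\<^sup>2) * N (\<phi> q)) else 0)" for q
  have C: "C \<subseteq> \<phi> ` (W \<inter> U)"
  proof
    fix y assume y: "y \<in> C"
    have "\<bar>y i - \<phi> p i\<bar> < d" if "i < n" for i
    proof -
      have "\<bar>y i - \<phi> p i\<bar> \<le> 3 * d / 4" using y that by (simp add: C_def)
      also have "\<dots> < d" using d(1) by simp
      finally show ?thesis .
    qed
    then show "y \<in> \<phi> ` (W \<inter> U)" using y by (intro d(2)) (auto simp: C_def)
  qed
  have KC: "\<phi> ` K = C" using C by (auto simp: K_def)
  have KW: "K \<subseteq> W"
  proof
    fix q assume q: "q \<in> K"
    then have "\<phi> q \<in> \<phi> ` (W \<inter> U)" using KC C by blast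
    then show "q \<in> W" using q chart_inj[OF c(1)] by (auto simp: K_def inj_on_def)
  qed
  \<comment> \<open>That \<open>K\<close> is closed in the whole manifold, and not merely in
    \<open>U\<close>, comes from compactness and the Hausdorff property.\<close>
  have "compactin (subtopology (Euclidean_space n) (\<phi> ` U)) C"
    using compact_coordinate_box[of n "\<phi> p" "3 * d / 4"] C
    by (auto simp: compactin_subtopology Euclidean_space_eq_top_of_set C_def)
  then have "compactin (top_of_set U) K"
    using homeomorphic_map_compactness[OF chart_homeomorphic[OF c(1)], of K] KC by (auto simp: K_def)
  then have "compact K" by (simp add: compactin_subtopology)
  then have clK: "closed K" by (rule compact_imp_closed)
  have supp: "q \<in> K" if "q \<in> U" "N (\<phi> q) < 2 * (d/2)\<^sup>2" for q
  proof -
    have "\<bar>\<phi> q i - \<phi> p i\<bar> \<le> 3 * d / 4" if i: "i < n" for i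
    proof -
      have "(\<phi> q i - \<phi> p i)\<^sup>2 \<le> N (\<phi> q)"
        unfolding N_def using i by (intro member_le_sum) auto
      also have "\<dots> \<le> (3 * d / 4)\<^sup>2"
      proof -
        have "2 * N (\<phi> q) < d\<^sup>2" using \<open>N (\<phi> q) < _\<close> by (simp add: power_divide)
        moreover have "0 \<le> d\<^sup>2" by simp
        ultimately have "N (\<phi> q) * 16 \<le> 9 * d\<^sup>2" by linarith
        then show ?thesis by (simp add: power_divide power_mult_distrib)
      qed
      finally show ?thesis using d(1) by (simp add: abs_le_square_iff[symmetric])
    qed
    then show ?thesis using that(1) chart_in_En[OF c(1)] by (simp add: K_def C_def)
  qed
  have sq: "(d/2)\<^sup>2 > 0" using d(1) by simp
  have smooth: "smooth_fun_on M U (\<lambda>q. smooth_step (2 + (-1 / (d/2)\<^sup>2) * N (\<phi> q)))"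
  proof -
    have "smooth_fun_on M U (\<lambda>q. (\<phi> q i + (- \<phi> p i)) * (\<phi> q i + (- \<phi> p i)))" if "i < n" for i
      by (intro smooth_fun_on_mult smooth_fun_on_add smooth_fun_on_const smooth_fun_on_coord
          chart_open[OF c(1)] c that)
    then have "smooth_fun_on M U (\<lambda>q. N (\<phi> q))"
      unfolding N_def by (intro smooth_fun_on_sum chart_open[OF c(1)]) (auto simp: power2_eq_square)
    then show ?thesis
      by (intro smooth_fun_on_smooth_step smooth_fun_on_add smooth_fun_on_mult smooth_fun_on_const
          chart_open[OF c(1)])
  qed
  have step0: "smooth_step (2 + (-1 / (d/2)\<^sup>2) * N (\<phi> q)) = 0" if "q \<in> U" "q \<notin> K" for q
  proof (rule smooth_step_eq_0)
    have "N (\<phi> q) \<ge> 2 * (d/2)\<^sup>2" using supp that by (meson not_le)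
    then show "2 + (-1 / (d/2)\<^sup>2) * N (\<phi> q) \<le> 0" using sq by (simp add: field_simps)
  qed
  have Wo: "open W'" unfolding W'_def
  proof (rule chart_preimage_open[OF c(1)])
    have "open {y::nat\<Rightarrow>real. N y < (d/2)\<^sup>2}" unfolding N_def
      by (intro open_Collect_less continuous_on_sum continuous_on_power continuous_on_diff
          continuous_on_product_coordinates continuous_on_const)
    moreover have "{y \<in> En n. N y < (d/2)\<^sup>2} = En n \<inter> {y. N y < (d/2)\<^sup>2}" by auto
    ultimately show "openin (Euclidean_space n) {y \<in> En n. N y < (d/2)\<^sup>2}"
      unfolding Euclidean_space_eq_top_of_set openin_open by blast
  qed
  show ?thesis
  proof (rule that[of \<beta> K W'])
    show "\<beta> \<in> \<A>"
      unfolding \<beta>_def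
      by (rule smooth_funs_extend_by_zero[OF chart_open[OF c(1)] clK _ smooth step0]) (auto simp: K_def)
    show "p \<in> W'" using c chart_in_En d(1) by (simp add: W'_def N_def)
    show "W' \<subseteq> W"
    proof
      fix q assume "q \<in> W'"
      then have "q \<in> U" "N (\<phi> q) < (d/2)\<^sup>2" by (auto simp: W'_def)
      then have "q \<in> K" using sq by (intro supp) linarith+
      then show "q \<in> W" using KW by blast
    qed
    show "\<beta> q = 1" if "q \<in> W'" for q
    proof -
      have "smooth_step (2 + (-1 / (d/2)\<^sup>2) * N (\<phi> q)) = 1"
        using that sq by (intro smooth_step_eq_1) (simp add: W'_def field_simps)
      then show ?thesis using that by (simp add: \<beta>_def W'_def)
    qed
    show "\<beta> q = 0" if "q \<notin> K" for q using step0 that by (simp add: \<beta>_def)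
  qed (use clK KW Wo in auto)
qed

text \<open>Multiply by a bump function and extend by zero; agreement with \<open>f\<close> is
  retained on the plateau only.\<close>

lemma smooth_fun_local_extension:
  assumes W: "open W" "p \<in> W" and f: "smooth_fun_on M W f"
  obtains g W' where "g \<in> \<A>" "open W'" "p \<in> W'" "W' \<subseteq> W" "\<And>q. q \<in> W' \<Longrightarrow> g q = f q"
proof -
  obtain \<beta> K W' where b: "\<beta> \<in> \<A>" "closed K" "K \<subseteq> W" "open W'" "p \<in> W'" "W' \<subseteq> W"
    "\<And>q. q \<in> W' \<Longrightarrow> \<beta> q = 1" "\<And>q. q \<notin> K \<Longrightarrow> \<beta> q = 0"
    using smooth_bump[OF W] by metis
  have "(\<lambda>q. if q \<in> W then \<beta> q * f q else 0) \<in> \<A>"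
    using b by (intro smooth_funs_extend_by_zero[OF W(1) b(2,3)] smooth_fun_on_mult W f smooth_funs_onD) auto
  then show ?thesis using b by (intro that[of "\<lambda>q. if q \<in> W then \<beta> q * f q else 0" W']) auto
qed

lemma smooth_funs_localI:
  assumes "\<And>p. \<exists>W. open W \<and> p \<in> W \<and> (\<exists>g. smooth_fun_on M W g \<and> (\<forall>q\<in>W. g q = f q))"
  shows "f \<in> \<A>"
  unfolding smooth_funs_def mem_Collect_eq
proof (rule smooth_fun_on_local[OF open_UNIV])
  fix p
  obtain W g where "open W" "p \<in> W" "smooth_fun_on M W g" "\<forall>q\<in>W. g q = f q" using assms by blast
  then show "\<exists>W'. open W' \<and> p \<in> W' \<and> smooth_fun_on M W' f"
    using smooth_fun_on_cong[of W g f] by blast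
qed

text \<open>Tangent vectors act on global functions, so coordinates must be represented by global
  functions before a tangent vector can be evaluated on them.\<close>

lemma global_coordinates:
  assumes c: "(U, \<phi>) \<in> charts M" and p: "p \<in> U"
  obtains \<zeta> W where "\<And>i. i < n \<Longrightarrow> \<zeta> i \<in> \<A>" "open W" "p \<in> W" "W \<subseteq> U"
    "\<And>i q. i < n \<Longrightarrow> q \<in> W \<Longrightarrow> \<zeta> i q = \<phi> q i"
proof -
  obtain \<beta> K W where b: "\<beta> \<in> \<A>" "closed K" "K \<subseteq> U" "open W" "p \<in> W" "W \<subseteq> U"
    "\<And>q. q \<in> W \<Longrightarrow> \<beta> q = 1" "\<And>q. q \<notin> K \<Longrightarrow> \<beta> q = 0"
    using smooth_bump[OF chart_open[OF c] p] by metis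
  define \<zeta> where "\<zeta> i q = (if q \<in> U then \<beta> q * \<phi> q i else 0)" for i q
  show ?thesis
  proof (rule that[of \<zeta> W])
    show "\<zeta> i \<in> \<A>" if "i < n" for i
      unfolding \<zeta>_def using b
      by (intro smooth_funs_extend_by_zero[OF chart_open[OF c] b(2,3)] smooth_fun_on_mult
          chart_open[OF c] smooth_fun_on_coord[OF c that] smooth_funs_onD) auto
  qed (use b in \<open>auto simp: \<zeta>_def\<close>)
qed


subsection \<open>Tangent vectors\<close>

lemma tangent_spaceD:
  assumes "v \<in> tangent_space M p"
  shows tangent_add: "f \<in> \<A> \<Longrightarrow> g \<in> \<A> \<Longrightarrow> v (f + g) = v f + v g"
    and tangent_scaleR: "f \<in> \<A> \<Longrightarrow> v (a *\<^sub>R f) = a * v f"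
    and tangent_mult: "f \<in> \<A> \<Longrightarrow> g \<in> \<A> \<Longrightarrow> v (f * g) = f p * v g + g p * v f"
    and tangent_outside: "f \<notin> \<A> \<Longrightarrow> v f = 0"
  using assms by (auto simp: tangent_space_def dual_space_def lin_on_def)

lemma tangent_zero: "v \<in> tangent_space M p \<Longrightarrow> v 0 = 0"
  using tangent_scaleR[of v p 0 0] by simp

lemma tangent_diff:
  "v \<in> tangent_space M p \<Longrightarrow> f \<in> \<A> \<Longrightarrow> g \<in> \<A> \<Longrightarrow> v (f - g) = v f - v g"
  using tangent_add[of v p f "(-1) *\<^sub>R g"] tangent_scaleR[of v p g "-1"]
    smooth_funs_scaleR[of g "-1"] by simp

lemma tangent_sum:
  "v \<in> tangent_space M p \<Longrightarrow> (\<And>a. a \<in> A \<Longrightarrow> f a \<in> \<A>) \<Longrightarrow> v (\<Sum>a\<in>A. f a) = (\<Sum>a\<in>A. v (f a))"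
  by (induction A rule: infinite_finite_induct) (auto simp: tangent_zero tangent_add smooth_funs_sum)

text \<open>Apply the product rule to 1 * 1 = 1.\<close>

lemma tangent_const:
  assumes v: "v \<in> tangent_space M p" shows "v (\<lambda>q. a) = 0"
proof -
  have "v ((\<lambda>q. 1) * (\<lambda>q. 1)) = v (\<lambda>q. 1) + v (\<lambda>q. 1)"
    using tangent_mult[OF v, of "\<lambda>q. 1" "\<lambda>q. 1"] by simp
  then have "v (\<lambda>q. 1) = 0" by (simp add: times_fun_def)
  then show ?thesis using tangent_scaleR[OF v, of "\<lambda>q. 1" a] by (simp add: scaleR_fun_def)
qed

text \<open>For a bump \<beta> with \<beta>(p) = 1 carried by \<open>W\<close>, the product \<beta>
  (f - g) is zero, and the product rule at \<open>p\<close> reduces its derivative to that of f -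
  g.\<close>

lemma tangent_local:
  assumes v: "v \<in> tangent_space M p" and fg: "f \<in> \<A>" "g \<in> \<A>"
    and W: "open W" "p \<in> W" "\<And>q. q \<in> W \<Longrightarrow> f q = g q"
  shows "v f = v g"
proof -
  obtain \<beta> K W' where b: "\<beta> \<in> \<A>" "closed K" "K \<subseteq> W" "open W'" "p \<in> W'" "W' \<subseteq> W"
    "\<And>q. q \<in> W' \<Longrightarrow> \<beta> q = 1" "\<And>q. q \<notin> K \<Longrightarrow> \<beta> q = 0"
    using smooth_bump[OF W(1,2)] by metis
  have "(\<beta> * (f - g)) q = 0" for q
    using b(3,8) W(3) by (cases "q \<in> K") auto
  then have "\<beta> * (f - g) = 0" by (simp add: fun_eq_iff)
  then have "0 = v (\<beta> * (f - g))" using tangent_zero[OF v] by simp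
  also have "\<dots> = v (f - g)"
    using tangent_mult[OF v b(1) smooth_funs_diff[OF fg]] b(5,7) W by simp
  finally show ?thesis using tangent_diff[OF v fg] by simp
qed

lemma has_real_derivative_chart:
  assumes c: "(U, \<phi>) \<in> charts M" and p: "p \<in> U" and i: "i < n" and f: "f \<in> \<A>"
  shows "((\<lambda>t. f (inv_into U \<phi> ((\<phi> p)(i := t)))) has_real_derivative coord_vec M U \<phi> i p f) (at (\<phi> p i))"
proof -
  have "Ck_on n (Suc 0) (\<phi> ` (UNIV \<inter> U)) (\<lambda>x. f (inv_into U \<phi> x))"
    using smooth_fun_onD[OF smooth_funs_onD[OF f] c] .
  moreover have "\<phi> ` U \<subseteq> En n" using chart_in_En[OF c] by blast
  ultimately show ?thesis using p i f by (simp add: Ck_on_Suc_iff coord_vec_def)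
qed

lemma coord_vec_eqI:
  assumes c: "(U, \<phi>) \<in> charts M" and p: "p \<in> U" and i: "i < n" and f: "f \<in> \<A>"
    and "((\<lambda>t. f (inv_into U \<phi> ((\<phi> p)(i := t)))) has_real_derivative D) (at (\<phi> p i))"
  shows "coord_vec M U \<phi> i p f = D"
  using DERIV_unique[OF has_real_derivative_chart[OF c p i f] assms(5)] .

lemma coord_vec_in_tangent_space:
  assumes c: "(U, \<phi>) \<in> charts M" and p: "p \<in> U" and i: "i < n"
  shows "coord_vec M U \<phi> i p \<in> tangent_space M p"
proof -
  note d = has_real_derivative_chart[OF c p i] and eqI = coord_vec_eqI[OF c p i]
  have "coord_vec M U \<phi> i p (f + g) = coord_vec M U \<phi> i p f + coord_vec M U \<phi> i p g"
    if "f \<in> \<A>" "g \<in> \<A>" for f g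
    using DERIV_add[OF d[OF that(1)] d[OF that(2)]] by (intro eqI smooth_funs_add that) simp
  moreover have "coord_vec M U \<phi> i p (a *\<^sub>R f) = a *\<^sub>R coord_vec M U \<phi> i p f"
    if "f \<in> \<A>" for f a
    using DERIV_cmult[OF d[OF that], of a] by (intro eqI smooth_funs_scaleR that) (simp add: scaleR_fun_def)
  moreover have "coord_vec M U \<phi> i p (f * g) = f p * coord_vec M U \<phi> i p g + g p * coord_vec M U \<phi> i p f"
    if "f \<in> \<A>" "g \<in> \<A>" for f g
    using DERIV_mult[OF d[OF that(1)] d[OF that(2)]] chart_inv[OF c p]
    by (intro eqI smooth_funs_mult that) (simp add: algebra_simps)
  moreover have "coord_vec M U \<phi> i p f = 0" if "f \<notin> \<A>" for f
    using that by (simp add: coord_vec_def)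
  ultimately show ?thesis by (simp add: tangent_space_def dual_space_def lin_on_def)
qed

text \<open>Hadamard's lemma writes \<open>f\<close> near \<open>p\<close> as f(p) + sum of \<xi>_i
  G_i, where \<xi>_i vanishes at \<open>p\<close> and G_i(p) is the partial derivative. The product
  rule then leaves only the terms G_i(p) v(\<xi>_i).\<close>

lemma tangent_expansion_fun:
  assumes c: "(U, \<phi>) \<in> charts M" and W: "open W" "p \<in> W" "W \<subseteq> U"
    and \<zeta>: "\<And>i. i < n \<Longrightarrow> \<zeta> i \<in> \<A>" "\<And>i q. i < n \<Longrightarrow> q \<in> W \<Longrightarrow> \<zeta> i q = \<phi> q i"
    and v: "v \<in> tangent_space M p" and f: "f \<in> \<A>"
  shows "v f = (\<Sum>i<n. v (\<zeta> i) * coord_vec M U \<phi> i p f)"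
proof -
  have p: "p \<in> U" using W by blast
  define F where "F = (\<lambda>x. f (inv_into U \<phi> x))"
  have "openin (Euclidean_space n) (\<phi> ` (W \<inter> U))" by (rule chart_image_open[OF c W(1)])
  then obtain d where d: "d > 0" "\<And>y. y \<in> En n \<Longrightarrow> (\<And>i. i < n \<Longrightarrow> \<bar>y i - \<phi> p i\<bar> < d) \<Longrightarrow> y \<in> \<phi> ` (W \<inter> U)"
    using openin_Euclidean_box[of n "\<phi> ` (W \<inter> U)" "\<phi> p"] p W by blast
  \<comment> \<open>A coordinate box inside the chart image of \<open>W\<close>, the shape of domain
    on which Hadamard's lemma is available.\<close>
  define B where "B = {y \<in> En n. \<forall>i<n. \<bar>y i - \<phi> p i\<bar> < d}"
  have Bo: "openin (Euclidean_space n) B" unfolding B_def by (rule openin_Euclidean_coord_less)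
  have BW: "B \<subseteq> \<phi> ` (W \<inter> U)" using d by (auto simp: B_def)
  have "Cinf_on n (\<phi> ` (UNIV \<inter> U)) F"
    using smooth_fun_onD[OF smooth_funs_onD[OF f] c] unfolding Cinf_on_def F_def by blast
  then have "Cinf_on n B F"
    using Ck_on_subset[of "\<phi> ` (UNIV \<inter> U)" n B _ F] BW chart_in_En[OF c] unfolding Cinf_on_def by blast
  then obtain g where g: "\<And>i. i < n \<Longrightarrow> Cinf_on n B (g i)"
    "\<And>x. x \<in> B \<Longrightarrow> F x = F (\<phi> p) + (\<Sum>i<n. (x i - \<phi> p i) * g i x)"
    "\<And>i. i < n \<Longrightarrow> g i (\<phi> p) = partial i F (\<phi> p)"
    using Cinf_on_Hadamard[OF B_def chart_in_En[OF c p] d(1)] by metis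
  define W1 where "W1 = {q \<in> U. \<phi> q \<in> B}"
  have W1: "open W1" "p \<in> W1" "W1 \<subseteq> U" "W1 \<subseteq> W"
  proof -
    show "open W1" unfolding W1_def by (rule chart_preimage_open[OF c Bo])
    show "p \<in> W1" using p chart_in_En[OF c p] d(1) by (simp add: W1_def B_def)
    show "W1 \<subseteq> U" by (auto simp: W1_def)
    show "W1 \<subseteq> W"
    proof
      fix q assume q: "q \<in> W1"
      then have "\<phi> q \<in> \<phi> ` (W \<inter> U)" using BW by (auto simp: W1_def)
      then show "q \<in> W" using q chart_inj[OF c] by (auto simp: W1_def inj_on_def)
    qed
  qed
  have gW1: "smooth_fun_on M W1 (\<lambda>q. g i (\<phi> q))" if "i < n" for i
    by (rule smooth_fun_on_chart_compose[OF c W1(1,3) Bo _ g(1)[OF that]]) (auto simp: W1_def)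
  then have "\<exists>G W'. G \<in> \<A> \<and> open W' \<and> p \<in> W' \<and> W' \<subseteq> W1 \<and> (\<forall>q\<in>W'. G q = g i (\<phi> q))" if i: "i < n" for i
  proof -
    obtain G W' where "G \<in> \<A>" "open W'" "p \<in> W'" "W' \<subseteq> W1" "\<And>q. q \<in> W' \<Longrightarrow> G q = g i (\<phi> q)"
      using smooth_fun_local_extension[OF W1(1,2) gW1[OF i]] by blast
    then show ?thesis by blast
  qed
  then obtain G W' where G: "\<And>i. i < n \<Longrightarrow> G i \<in> \<A>" "\<And>i. i < n \<Longrightarrow> open (W' i)"
    "\<And>i. i < n \<Longrightarrow> p \<in> W' i" "\<And>i q. i < n \<Longrightarrow> q \<in> W' i \<Longrightarrow> G i q = g i (\<phi> q)"
    by metis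
  define W2 where "W2 = W1 \<inter> (\<Inter>i\<in>{..<n}. W' i)"
  have W2: "open W2" "p \<in> W2" using W1 G(2,3) by (auto simp: W2_def intro!: open_Int open_INT)
  \<comment> \<open>Shifted to vanish at \<open>p\<close>; the value under \<open>v\<close> is
    unchanged because constants are killed.\<close>
  define \<xi> where "\<xi> i = \<zeta> i - (\<lambda>q. \<phi> p i)" for i
  have \<xi>: "\<xi> i \<in> \<A>" "v (\<xi> i) = v (\<zeta> i)" "\<xi> i p = 0" if "i < n" for i
    using that \<zeta> W v by (auto simp: \<xi>_def smooth_funs_diff tangent_diff tangent_const)
  define h where "h = (\<lambda>q. f p) + (\<Sum>i<n. \<xi> i * G i)"
  have hs: "(\<Sum>i<n. \<xi> i * G i) \<in> \<A>" using \<xi>(1) G(1) by (intro smooth_funs_sum smooth_funs_mult) auto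
  have Fq: "F (\<phi> q) = f q" if "q \<in> U" for q using chart_inv[OF c that] by (simp add: F_def)
  have "f q = h q" if q: "q \<in> W2" for q
  proof -
    have qW: "q \<in> W" "q \<in> U" "\<phi> q \<in> B" using q W1 by (auto simp: W2_def W1_def)
    have "(\<Sum>i<n. \<xi> i * G i) q = (\<Sum>i<n. \<xi> i q * G i q)"
      by (simp add: sum_fun_apply)
    also have "\<dots> = (\<Sum>i<n. (\<phi> q i - \<phi> p i) * g i (\<phi> q))"
      using qW q \<zeta>(2) G(4) by (intro sum.cong) (auto simp: \<xi>_def W2_def)
    finally show ?thesis using g(2)[OF qW(3)] Fq[OF qW(2)] Fq[OF p] by (simp add: h_def)
  qed
  then have "v f = v h"
    using tangent_local[OF v f _ W2] smooth_funs_add[OF smooth_funs_const hs] unfolding h_def by blast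
  also have "\<dots> = (\<Sum>i<n. v (\<xi> i * G i))"
    unfolding h_def using tangent_add[OF v smooth_funs_const hs] tangent_const[OF v]
      tangent_sum[OF v, of "{..<n}" "\<lambda>i. \<xi> i * G i"] smooth_funs_mult \<xi>(1) G(1) by simp
  also have "\<dots> = (\<Sum>i<n. v (\<zeta> i) * coord_vec M U \<phi> i p f)"
  proof (rule sum.cong)
    fix i assume "i \<in> {..<n}"
    then have i: "i < n" by simp
    have "G i p = coord_vec M U \<phi> i p f"
      using G(3,4)[OF i] g(3)[OF i] f by (simp add: coord_vec_def F_def)
    then show "v (\<xi> i * G i) = v (\<zeta> i) * coord_vec M U \<phi> i p f"
      using tangent_mult[OF v \<xi>(1)[OF i] G(1)[OF i]] \<xi>(2,3)[OF i] by simp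
  qed simp
  finally show ?thesis .
qed

lemma tangent_expansion:
  assumes c: "(U, \<phi>) \<in> charts M" and W: "open W" "p \<in> W" "W \<subseteq> U"
    and \<zeta>: "\<And>i. i < n \<Longrightarrow> \<zeta> i \<in> \<A>" "\<And>i q. i < n \<Longrightarrow> q \<in> W \<Longrightarrow> \<zeta> i q = \<phi> q i"
    and v: "v \<in> tangent_space M p"
  shows "v = (\<Sum>i<n. v (\<zeta> i) *\<^sub>R coord_vec M U \<phi> i p)"
proof
  fix f
  show "v f = (\<Sum>i<n. v (\<zeta> i) *\<^sub>R coord_vec M U \<phi> i p) f"
  proof (cases "f \<in> \<A>")
    case True
    then show ?thesis
      using tangent_expansion_fun[OF c W \<zeta> v True] by (simp add: sum_fun_apply scaleR_fun_def)
  next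
    case False
    then show ?thesis
      using tangent_outside[OF v False] by (simp add: sum_fun_apply scaleR_fun_def coord_vec_def)
  qed
qed

end


subsection \<open>Tensor products of finite-dimensional spaces\<close>

lemma lin_onD:
  assumes "lin_on S T h"
  shows lin_on_mem: "x \<in> S \<Longrightarrow> h x \<in> T"
    and lin_on_add: "x \<in> S \<Longrightarrow> y \<in> S \<Longrightarrow> h (x + y) = h x + h y"
    and lin_on_scaleR: "x \<in> S \<Longrightarrow> h (c *\<^sub>R x) = c *\<^sub>R h x"
  using assms by (auto simp: lin_on_def)

lemma lin_on_zero: "lin_on S T h \<Longrightarrow> subspace S \<Longrightarrow> h 0 = 0"
  using lin_on_scaleR[of S T h 0 0] subspace_0 by force

lemma lin_on_sum:
  assumes h: "lin_on S T h" and S: "subspace S" and x: "\<And>a. a \<in> A \<Longrightarrow> x a \<in> S"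
  shows "h (\<Sum>a\<in>A. c a *\<^sub>R x a) = (\<Sum>a\<in>A. c a *\<^sub>R h (x a))"
  using x
proof (induction A rule: infinite_finite_induct)
  case (insert a A)
  have "(\<Sum>a\<in>A. c a *\<^sub>R x a) \<in> S" using insert.prems by (intro subspace_sum[OF S] subspace_mul[OF S]) auto
  then show ?case using insert subspace_mul[OF S]
    by (simp add: lin_on_add[OF h] lin_on_scaleR[OF h])
qed (simp_all add: lin_on_zero[OF h S])

lemma lin_on_eq_on_span:
  assumes "lin_on (span B) T h" "lin_on (span B) T' h'" "\<And>x. x \<in> B \<Longrightarrow> h x = h' x" "t \<in> span B"
  shows "h t = h' t"
proof -
  have "t \<in> span B \<and> h t = h' t" using assms(4)
  proof (induction rule: span_induct_alt)
    case base
    show ?case using assms(1,2) lin_on_zero subspace_span span_zero by metis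
  next
    case (step c x y)
    then have "x \<in> span B" "c *\<^sub>R x \<in> span B" "y \<in> span B" by (auto intro: span_base span_scale)
    then show ?case using step assms(3)
      by (simp add: lin_on_add[OF assms(1)] lin_on_add[OF assms(2)] lin_on_scaleR[OF assms(1)]
          lin_on_scaleR[OF assms(2)] span_add)
  qed
  then show ?thesis by blast
qed

lemma bilin_onD:
  assumes "bilin_on S T U b"
  shows bilin_on_left: "t \<in> T \<Longrightarrow> lin_on S U (\<lambda>s. b s t)"
    and bilin_on_right: "s \<in> S \<Longrightarrow> lin_on T U (b s)"
  using assms by (auto simp: bilin_on_def)

lemma bilin_onI:
  assumes "\<And>s t. s \<in> S \<Longrightarrow> t \<in> T \<Longrightarrow> b s t \<in> U"
    and "\<And>s s' t. s \<in> S \<Longrightarrow> s' \<in> S \<Longrightarrow> t \<in> T \<Longrightarrow> b (s + s') t = b s t + b s' t"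
    and "\<And>c s t. s \<in> S \<Longrightarrow> t \<in> T \<Longrightarrow> b (c *\<^sub>R s) t = c *\<^sub>R b s t"
    and "\<And>s t t'. s \<in> S \<Longrightarrow> t \<in> T \<Longrightarrow> t' \<in> T \<Longrightarrow> b s (t + t') = b s t + b s t'"
    and "\<And>c s t. s \<in> S \<Longrightarrow> t \<in> T \<Longrightarrow> b s (c *\<^sub>R t) = c *\<^sub>R b s t"
  shows "bilin_on S T U b"
  using assms by (auto simp: bilin_on_def lin_on_def)

lemma dual_spaceD:
  assumes "\<omega> \<in> dual_space S"
  shows dual_space_add: "x \<in> S \<Longrightarrow> y \<in> S \<Longrightarrow> \<omega> (x + y) = \<omega> x + \<omega> y"
    and dual_space_scaleR: "x \<in> S \<Longrightarrow> \<omega> (c *\<^sub>R x) = c * \<omega> x"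
    and dual_space_outside: "x \<notin> S \<Longrightarrow> \<omega> x = 0"
  using assms by (auto simp: dual_space_def lin_on_def)

lemma endo_spaceD:
  assumes "\<Phi> \<in> endo_space W"
  shows endo_space_mem: "x \<in> W \<Longrightarrow> \<Phi> x \<in> W"
    and endo_space_add: "x \<in> W \<Longrightarrow> y \<in> W \<Longrightarrow> \<Phi> (x + y) = \<Phi> x + \<Phi> y"
    and endo_space_scaleR: "x \<in> W \<Longrightarrow> \<Phi> (c *\<^sub>R x) = c *\<^sub>R \<Phi> x"
    and endo_space_outside: "x \<notin> W \<Longrightarrow> \<Phi> x = 0"
  using assms by (auto simp: endo_space_def lin_on_def)

lemma subspace_endo_space: "subspace W \<Longrightarrow> subspace (endo_space W)"
  unfolding subspace_def endo_space_def lin_on_def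
  by (auto simp: scaleR_fun_def scaleR_add_right scaleR_left_commute add.assoc add.left_commute)

lemma subspace_dual_space: "subspace (dual_space S)"
  unfolding subspace_def dual_space_def lin_on_def
  by (auto simp: scaleR_fun_def algebra_simps)

lemma subspace_tensor_space: "subspace (tensor_space S T)"
  by (simp add: tensor_space_def)

lemma pure_tensor_mem: "s \<in> S \<Longrightarrow> t \<in> T \<Longrightarrow> pure_tensor S T s t \<in> tensor_space S T"
  unfolding tensor_space_def by (rule span_base) blast

lemma pure_tensor_bilin: "bilin_on S T (tensor_space S T) (pure_tensor S T)"
proof (rule bilin_onI)
  show "pure_tensor S T s t \<in> tensor_space S T" if "s \<in> S" "t \<in> T" for s t
    using pure_tensor_mem that .
qed (auto simp: pure_tensor_def fun_eq_iff scaleR_fun_def lin_on_add[OF bilin_on_left]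
   lin_on_scaleR[OF bilin_on_left] lin_on_add[OF bilin_on_right] lin_on_scaleR[OF bilin_on_right])

text \<open>A tensor is a bare function of forms. Its linearity holds for pure tensors by evaluation
  and passes to their span. The forms need to be related on \<open>S\<close> and \<open>T\<close>
  only, since pure tensors evaluate them nowhere else.\<close>

lemma tensor_eval_linear:
  assumes "t \<in> tensor_space S T" "bilin_on S T UNIV b" "bilin_on S T UNIV b1" "bilin_on S T UNIV b2"
    and "\<And>x y. x \<in> S \<Longrightarrow> y \<in> T \<Longrightarrow> b x y = a1 * b1 x y + a2 * b2 x y"
  shows "t b = a1 * t b1 + a2 * t b2"
  using assms(1) unfolding tensor_space_def
proof (induction rule: span_induct_alt)
  case (step c x y)
  then show ?case using assms(2-5) by (auto simp: pure_tensor_def scaleR_fun_def algebra_simps)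
qed simp

text \<open>Only the expansion of vectors is demanded, not the pairing of the \<open>\<xi> i\<close>
  with the \<open>s j\<close>. This is exactly what the expansion of tangent vectors in coordinate
  vectors supplies.\<close>

definition dual_basis :: "'a::real_vector set \<Rightarrow> nat \<Rightarrow> (nat \<Rightarrow> 'a) \<Rightarrow> (nat \<Rightarrow> 'a \<Rightarrow> real) \<Rightarrow> bool"
  where "dual_basis S m s \<xi> \<longleftrightarrow> subspace S \<and> (\<forall>i<m. s i \<in> S \<and> \<xi> i \<in> dual_space S) \<and>
    (\<forall>v\<in>S. v = (\<Sum>i<m. \<xi> i v *\<^sub>R s i))"

lemma dual_basisD:
  assumes "dual_basis S m s \<xi>"
  shows dual_basis_subspace: "subspace S"
    and dual_basis_mem: "i < m \<Longrightarrow> s i \<in> S"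
    and dual_basis_dual: "i < m \<Longrightarrow> \<xi> i \<in> dual_space S"
    and dual_basis_expand: "v \<in> S \<Longrightarrow> (\<Sum>i<m. \<xi> i v *\<^sub>R s i) = v"
  using assms by (simp_all add: dual_basis_def)

text \<open>Bilinearity and the prescribed values on pure tensors determine the action: extend first
  in the right argument with a pure left one, then in the left argument.\<close>

lemma is_tensor_action_unique:
  assumes L: "is_tensor_action S W L" and L': "is_tensor_action S W L'"
    and t: "t \<in> tensor_space S (endo_space W)" and u: "u \<in> tensor_space (dual_space S) W"
  shows "L t u = L' t u"
proof -
  have b: "bilin_on (tensor_space S (endo_space W)) (tensor_space (dual_space S) W) W L"
    and b': "bilin_on (tensor_space S (endo_space W)) (tensor_space (dual_space S) W) W L'"
    using L L' by (auto simp: is_tensor_action_def)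
  have pure: "L (pure_tensor S (endo_space W) v \<Phi>) u = L' (pure_tensor S (endo_space W) v \<Phi>) u"
    if v: "v \<in> S" "\<Phi> \<in> endo_space W" and u: "u \<in> tensor_space (dual_space S) W" for v \<Phi> u
  proof (rule lin_on_eq_on_span[OF bilin_on_right[OF b, unfolded tensor_space_def[of "dual_space S"]]
        bilin_on_right[OF b', unfolded tensor_space_def[of "dual_space S"]]])
    show "u \<in> span {pure_tensor (dual_space S) W s t | s t. s \<in> dual_space S \<and> t \<in> W}"
      using u by (simp add: tensor_space_def)
  qed (use v pure_tensor_mem L L' in \<open>auto simp: is_tensor_action_def\<close>)
  show ?thesis
  proof (rule lin_on_eq_on_span[OF bilin_on_left[OF b u, unfolded tensor_space_def[of S]]
        bilin_on_left[OF b' u, unfolded tensor_space_def[of S]]])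
    show "t \<in> span {pure_tensor S (endo_space W) s t | s t. s \<in> S \<and> t \<in> endo_space W}"
      using t by (simp add: tensor_space_def)
  qed (use pure u in auto)
qed

lemma tensor_action_eq:
  assumes "is_tensor_action S W L" "t \<in> tensor_space S (endo_space W)" "u \<in> tensor_space (dual_space S) W"
  shows "tensor_action S W t u = L t u"
  unfolding tensor_action_def using assms is_tensor_action_unique[OF _ assms(1-3)]
      by (intro the_equality) blast+

text \<open>\<open>tensor_action\<close> is described value by value. It agrees with any given
  action on the two tensor products and so inherits bilinearity from it.\<close>

lemma is_tensor_action_tensor_action:
  assumes L: "is_tensor_action S W L"
  shows "is_tensor_action S W (tensor_action S W)"
proof -
  note b = L[unfolded is_tensor_action_def, THEN conjunct1]
  have "bilin_on (tensor_space S (endo_space W)) (tensor_space (dual_space S) W) W (tensor_action S W)"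
    by (rule bilin_onI)
       (auto simp: tensor_action_eq[OF L] lin_on_mem[OF bilin_on_right[OF b]]
         subspace_add[OF subspace_tensor_space] subspace_mul[OF subspace_tensor_space]
         lin_on_add[OF bilin_on_left[OF b]] lin_on_add[OF bilin_on_right[OF b]]
         lin_on_scaleR[OF bilin_on_left[OF b]] lin_on_scaleR[OF bilin_on_right[OF b]])
  moreover have "tensor_action S W (pure_tensor S (endo_space W) v \<Phi>) (pure_tensor (dual_space S) W \<omega> x)
      = \<omega> v *\<^sub>R \<Phi> x"
    if *: "v \<in> S" "\<Phi> \<in> endo_space W" "\<omega> \<in> dual_space S" "x \<in> W" for v \<Phi> \<omega> x
    using tensor_action_eq[OF L pure_tensor_mem[OF *(1,2)] pure_tensor_mem[OF *(3,4)]] * L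
    by (simp add: is_tensor_action_def)
  ultimately show ?thesis by (simp add: is_tensor_action_def)
qed

text \<open>As tensors are functionals on bilinear forms, the action can be defined by evaluation,
  without choosing representatives. The dual basis of \<open>W\<close> serves to assemble the vector
  value from its coordinates.\<close>

lemma is_tensor_action_exists:
  fixes S :: "'a::real_vector set" and W :: "'b::real_vector set"
  assumes W: "dual_basis W r e \<eta>"
  shows "is_tensor_action S W (tensor_action S W)"
proof -
  let ?T = "tensor_space S (endo_space W)" and ?U = "tensor_space (dual_space S) W"
  \<comment> \<open>For fixed \<open>\<omega>\<close> and \<open>x\<close>, the form
    \<open>b j \<omega> x\<close> sends a pair to coordinate \<open>j\<close> of the desired value.
    Evaluating \<open>t\<close> on it leaves a form \<open>B j t\<close> in \<open>\<omega>\<close>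
    and \<open>x\<close>, and evaluating \<open>u\<close> on that one gives coordinate
    \<open>j\<close> of the action.\<close>
  define b where "b j \<omega> x = (\<lambda>v \<Phi>. \<omega> v * \<eta> j (\<Phi> x))" for j and \<omega> :: "'a \<Rightarrow> real" and x :: 'b
  define B where "B j t = (\<lambda>\<omega> x. t (b j \<omega> x))" for j and t :: "('a \<Rightarrow> ('b \<Rightarrow> 'b) \<Rightarrow> real) \<Rightarrow> real"
  define L where "L t u = (\<Sum>j<r. u (B j t) *\<^sub>R e j)" for t u
  have \<eta>: "\<eta> j (x + y) = \<eta> j x + \<eta> j y" "\<eta> j (c *\<^sub>R x) = c * \<eta> j x"
    if "j < r" "x \<in> W" "y \<in> W" for j x y c
    using dual_space_add[OF dual_basis_dual[OF W that(1)]] dual_space_scaleR[OF dual_basis_dual[OF W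
        that(1)]] that
    by auto
  have b: "bilin_on S (endo_space W) UNIV (b j \<omega> x)" if "j < r" "\<omega> \<in> dual_space S" "x \<in> W" for j \<omega> x
    using that unfolding b_def
    by (intro bilin_onI)
       (auto simp: dual_space_add dual_space_scaleR endo_space_mem \<eta> scaleR_fun_def algebra_simps)
  have B: "bilin_on (dual_space S) W UNIV (B j t)" if j: "j < r" and t: "t \<in> ?T" for j t
  proof (rule bilin_onI)
    fix \<omega> \<omega>' x y c assume *: "\<omega> \<in> dual_space S" "x \<in> W"
    note sub = subspace_dual_space[of S] dual_basis_subspace[OF W]
    have "(\<lambda>v. c * \<omega> v) \<in> dual_space S"
      using subspace_mul[OF sub(1) *(1), of c] by (simp add: scaleR_fun_def)
    then show "B j t (c *\<^sub>R \<omega>) x = c *\<^sub>R B j t \<omega> x"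
      using tensor_eval_linear[OF t b[OF j] b[OF j] b[OF j], of "c *\<^sub>R \<omega>" x \<omega> x \<omega> x c 0] * sub
      by (simp add: B_def b_def scaleR_fun_def[of c \<omega>])
    show "B j t \<omega> (c *\<^sub>R x) = c *\<^sub>R B j t \<omega> x"
      using tensor_eval_linear[OF t b[OF j] b[OF j] b[OF j], of \<omega> "c *\<^sub>R x" \<omega> x \<omega> x c 0] * sub
      by (simp add: B_def b_def endo_space_scaleR endo_space_mem \<eta>[OF j] subspace_mul)
    show "B j t (\<omega> + \<omega>') x = B j t \<omega> x + B j t \<omega>' x" if "\<omega>' \<in> dual_space S"
      using tensor_eval_linear[OF t b[OF j] b[OF j] b[OF j], of "\<omega> + \<omega>'" x \<omega> x \<omega>' x 1 1] * sub that
      by (simp add: B_def b_def subspace_add algebra_simps)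
    show "B j t \<omega> (x + y) = B j t \<omega> x + B j t \<omega> y" if "y \<in> W"
      using tensor_eval_linear[OF t b[OF j] b[OF j] b[OF j], of \<omega> "x + y" \<omega> x \<omega> y 1 1] * sub that
      by (simp add: B_def b_def endo_space_add endo_space_mem \<eta>[OF j] subspace_add algebra_simps)
  qed simp
  have "bilin_on ?T ?U W L"
  proof (rule bilin_onI)
    fix t t' u u' c assume *: "t \<in> ?T" "u \<in> ?U"
    note sub = subspace_tensor_space[of S "endo_space W"]
    show "L t u \<in> W"
      unfolding L_def using dual_basis_mem[OF W] dual_basis_subspace[OF W]
      by (intro subspace_sum subspace_mul) auto
    have ct: "(\<lambda>b. c * t b) \<in> ?T"
      using subspace_mul[OF sub *(1), of c] by (simp add: scaleR_fun_def)
    have "u (B j (c *\<^sub>R t)) = c * u (B j t)" if "j < r" for j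
      using tensor_eval_linear[OF *(2) B[OF that] B[OF that] B[OF that], of "c *\<^sub>R t" t t c 0] * ct
      by (simp add: B_def scaleR_fun_def[of c t])
    then show "L (c *\<^sub>R t) u = c *\<^sub>R L t u" by (simp add: L_def scaleR_sum_right)
    show "L t (c *\<^sub>R u) = c *\<^sub>R L t u" by (simp add: L_def scaleR_sum_right scaleR_fun_def)
    show "L t (u + u') = L t u + L t u'" by (simp add: L_def sum.distrib scaleR_add_left)
    assume t': "t' \<in> ?T"
    have "u (B j (t + t')) = u (B j t) + u (B j t')" if "j < r" for j
      using tensor_eval_linear[OF *(2) B[OF that] B[OF that] B[OF that], of "t + t'" t t' 1 1] * sub t'
      by (simp add: B_def subspace_add)
    then show "L (t + t') u = L t u + L t' u" by (simp add: L_def sum.distrib scaleR_add_left)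
  qed
  moreover have "L (pure_tensor S (endo_space W) v \<Phi>) (pure_tensor (dual_space S) W \<omega> x) = \<omega> v *\<^sub>R \<Phi> x"
    if *: "v \<in> S" "\<Phi> \<in> endo_space W" "\<omega> \<in> dual_space S" "x \<in> W" for v \<Phi> \<omega> x
  proof -
    have "L (pure_tensor S (endo_space W) v \<Phi>) (pure_tensor (dual_space S) W \<omega> x) =
        (\<Sum>j<r. (\<omega> v * \<eta> j (\<Phi> x)) *\<^sub>R e j)"
      unfolding L_def
    proof (rule sum.cong)
      fix j assume "j \<in> {..<r}"
      then have j: "j < r" by simp
      show "pure_tensor (dual_space S) W \<omega> x (B j (pure_tensor S (endo_space W) v \<Phi>)) *\<^sub>R e j =
          (\<omega> v * \<eta> j (\<Phi> x)) *\<^sub>R e j"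
        using B[OF j pure_tensor_mem[OF *(1,2)]] b[OF j *(3,4)]
        by (simp add: pure_tensor_def B_def b_def)
    qed simp
    also have "\<dots> = \<omega> v *\<^sub>R \<Phi> x"
      by (subst dual_basis_expand[OF W endo_space_mem[OF *(2,4)], symmetric]) (simp add: scaleR_sum_right)
    finally show ?thesis .
  qed
  ultimately have "is_tensor_action S W L" by (simp add: is_tensor_action_def)
  then show ?thesis by (rule is_tensor_action_tensor_action)
qed

definition matrix_unit :: "(nat \<Rightarrow> 'b::real_vector) \<Rightarrow> (nat \<Rightarrow> 'b \<Rightarrow> real) \<Rightarrow> nat \<Rightarrow> nat \<Rightarrow> 'b \<Rightarrow> 'b"
  where "matrix_unit e \<eta> j k = (\<lambda>x. \<eta> k x *\<^sub>R e j)"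

lemma matrix_unit_mem:
  assumes W: "dual_basis W r e \<eta>" and "j < r" "k < r"
  shows "matrix_unit e \<eta> j k \<in> endo_space W"
  unfolding endo_space_def lin_on_def matrix_unit_def
  using dual_basis_mem[OF W assms(2)] dual_basis_subspace[OF W] dual_basis_dual[OF W assms(3)]
  by (auto simp: subspace_mul dual_space_add dual_space_scaleR dual_space_outside scaleR_add_left)

lemma endo_expand:
  assumes W: "dual_basis W r e \<eta>" and \<Phi>: "\<Phi> \<in> endo_space W"
  shows "\<Phi> = (\<Sum>j<r. \<Sum>k<r. \<eta> j (\<Phi> (e k)) *\<^sub>R matrix_unit e \<eta> j k)"
proof
  fix x
  have "(\<Sum>j<r. \<Sum>k<r. \<eta> j (\<Phi> (e k)) *\<^sub>R matrix_unit e \<eta> j k) x =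
      (\<Sum>j<r. \<Sum>k<r. (\<eta> j (\<Phi> (e k)) * \<eta> k x) *\<^sub>R e j)"
    by (simp add: sum_fun_apply scaleR_fun_def matrix_unit_def)
  also have "\<dots> = \<Phi> x"
  proof (cases "x \<in> W")
    case True
    have l: "lin_on W W \<Phi>" using \<Phi> by (simp add: endo_space_def)
    have "(\<Sum>j<r. \<Sum>k<r. (\<eta> j (\<Phi> (e k)) * \<eta> k x) *\<^sub>R e j) =
        (\<Sum>k<r. \<eta> k x *\<^sub>R (\<Sum>j<r. \<eta> j (\<Phi> (e k)) *\<^sub>R e j))"
      by (subst sum.swap) (simp add: scaleR_sum_right mult.commute)
    also have "\<dots> = (\<Sum>k<r. \<eta> k x *\<^sub>R \<Phi> (e k))"
      using dual_basis_mem[OF W] endo_space_mem[OF \<Phi>]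
      by (intro sum.cong) (auto simp: dual_basis_expand[OF W])
    also have "\<dots> = \<Phi> (\<Sum>k<r. \<eta> k x *\<^sub>R e k)"
      using dual_basis_mem[OF W] by (intro lin_on_sum[OF l dual_basis_subspace[OF W], symmetric]) auto
    also have "\<dots> = \<Phi> x" using dual_basis_expand[OF W True] by simp
    finally show ?thesis .
  next
    case False
    then have "\<eta> k x = 0" if "k < r" for k using dual_space_outside[OF dual_basis_dual[OF W that]] by blast
    then show ?thesis using endo_space_outside[OF \<Phi> False] by simp
  qed
  finally show "\<Phi> x = (\<Sum>j<r. \<Sum>k<r. \<eta> j (\<Phi> (e k)) *\<^sub>R matrix_unit e \<eta> j k) x" by simp
qed

context
  fixes S :: "'a::real_vector set" and m s \<xi> and W :: "'b::real_vector set" and r e \<eta>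
  assumes S: "dual_basis S m s \<xi>" and W: "dual_basis W r e \<eta>"
begin

lemma tensor_action_bilin:
  "bilin_on (tensor_space S (endo_space W)) (tensor_space (dual_space S) W) W (tensor_action S W)"
  using is_tensor_action_exists[OF W, of S] by (simp add: is_tensor_action_def)

lemma tensor_action_pure:
  "v \<in> S \<Longrightarrow> \<Phi> \<in> endo_space W \<Longrightarrow> \<omega> \<in> dual_space S \<Longrightarrow> x \<in> W \<Longrightarrow>
    tensor_action S W (pure_tensor S (endo_space W) v \<Phi>) (pure_tensor (dual_space S) W \<omega> x) = \<omega> v *\<^sub>R \<Phi> x"
  using is_tensor_action_exists[OF W, of S] by (simp add: is_tensor_action_def)

lemma pure_tensor_expand:
  assumes v: "v \<in> S" and \<Phi>: "\<Phi> \<in> endo_space W"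
  shows "pure_tensor S (endo_space W) v \<Phi> = (\<Sum>i<m. \<Sum>j<r. \<Sum>k<r.
    (\<xi> i v * \<eta> j (\<Phi> (e k))) *\<^sub>R pure_tensor S (endo_space W) (s i) (matrix_unit e \<eta> j k))"
proof -
  let ?P = "pure_tensor S (endo_space W)"
  note sS = dual_basis_subspace[OF S] and sE = subspace_endo_space[OF dual_basis_subspace[OF W]]
  note bl = bilin_on_left[OF pure_tensor_bilin[of S "endo_space W"]]
    and br = bilin_on_right[OF pure_tensor_bilin[of S "endo_space W"]]
  have mu: "(\<Sum>k<r. \<eta> j (\<Phi> (e k)) *\<^sub>R matrix_unit e \<eta> j k) \<in> endo_space W" if "j < r" for j
    using that matrix_unit_mem[OF W] by (intro subspace_sum[OF sE] subspace_mul[OF sE]) auto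
  have Pi: "?P (s i) \<Phi> = (\<Sum>j<r. \<Sum>k<r. \<eta> j (\<Phi> (e k)) *\<^sub>R ?P (s i) (matrix_unit e \<eta> j k))" if i: "i < m" for i
  proof -
    note l = br[OF dual_basis_mem[OF S i]]
    \<comment> \<open>The trivial scalars 1 bring the outer sum into the form that
      \<open>lin_on_sum\<close> handles.\<close>
    have "?P (s i) \<Phi> = ?P (s i) (\<Sum>j<r. 1 *\<^sub>R (\<Sum>k<r. \<eta> j (\<Phi> (e k)) *\<^sub>R matrix_unit e \<eta> j k))"
      using endo_expand[OF W \<Phi>] by simp
    also have "\<dots> = (\<Sum>j<r. 1 *\<^sub>R ?P (s i) (\<Sum>k<r. \<eta> j (\<Phi> (e k)) *\<^sub>R matrix_unit e \<eta> j k))"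
      using mu by (intro lin_on_sum[OF l sE]) auto
    also have "\<dots> = (\<Sum>j<r. \<Sum>k<r. \<eta> j (\<Phi> (e k)) *\<^sub>R ?P (s i) (matrix_unit e \<eta> j k))"
      using matrix_unit_mem[OF W] by (intro sum.cong) (auto intro!: lin_on_sum[OF l sE])
    finally show ?thesis .
  qed
  have "?P v \<Phi> = ?P (\<Sum>i<m. \<xi> i v *\<^sub>R s i) \<Phi>" using dual_basis_expand[OF S v] by simp
  also have "\<dots> = (\<Sum>i<m. \<xi> i v *\<^sub>R ?P (s i) \<Phi>)"
    using dual_basis_mem[OF S] by (intro lin_on_sum[OF bl[OF \<Phi>] sS]) auto
  finally show ?thesis by (simp add: Pi scaleR_sum_right)
qed

text \<open>The coefficients of a tensor can be read off from its action on the pure tensors of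
  \<open>\<xi> i\<close> and \<open>e k\<close>. Both sides are linear in \<open>t\<close>, so pure
  tensors suffice for the check.\<close>

lemma tensor_expand:
  assumes t: "t \<in> tensor_space S (endo_space W)"
  shows "t = (\<Sum>i<m. \<Sum>j<r. \<Sum>k<r.
    \<eta> j (tensor_action S W t (pure_tensor (dual_space S) W (\<xi> i) (e k))) *\<^sub>R
      pure_tensor S (endo_space W) (s i) (matrix_unit e \<eta> j k))"
proof -
  let ?T = "tensor_space S (endo_space W)"
  let ?h = "\<lambda>t. (\<Sum>i<m. \<Sum>j<r. \<Sum>k<r.
    \<eta> j (tensor_action S W t (pure_tensor (dual_space S) W (\<xi> i) (e k))) *\<^sub>R
      pure_tensor S (endo_space W) (s i) (matrix_unit e \<eta> j k))"
  have u: "pure_tensor (dual_space S) W (\<xi> i) (e k) \<in> tensor_space (dual_space S) W" if "i < m" "k < r" for i k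
    using that dual_basis_dual[OF S] dual_basis_mem[OF W] by (intro pure_tensor_mem)
  have coef: "lin_on ?T UNIV (\<lambda>t. \<eta> j (tensor_action S W t (pure_tensor (dual_space S) W (\<xi> i) (e k))))"
    if "i < m" "j < r" "k < r" for i j k
    using bilin_on_left[OF tensor_action_bilin u[OF that(1,3)]] dual_basis_dual[OF W that(2)]
    unfolding lin_on_def dual_space_def by simp
  have "lin_on ?T UNIV ?h"
    unfolding lin_on_def
    by (intro conjI ballI allI)
       (auto simp: sum.distrib[symmetric] scaleR_sum_right scaleR_add_left[symmetric]
          lin_on_add[OF coef] lin_on_scaleR[OF coef] intro!: sum.cong)
  moreover have "lin_on ?T UNIV (\<lambda>t. t)" by (simp add: lin_on_def)
  moreover have "p = ?h p" if p0: "p \<in> {pure_tensor S (endo_space W) s t |s t. s \<in> S \<and> t \<in> endo_space W}" for p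
  proof -
    obtain v \<Phi> where p: "p = pure_tensor S (endo_space W) v \<Phi>" "v \<in> S" "\<Phi> \<in> endo_space W" using p0 by blast
    have "\<eta> j (tensor_action S W p (pure_tensor (dual_space S) W (\<xi> i) (e k))) = \<xi> i v * \<eta> j (\<Phi> (e k))"
      if "i < m" "j < r" "k < r" for i j k
      using p that tensor_action_pure[OF p(2,3) dual_basis_dual[OF S that(1)] dual_basis_mem[OF W that(3)]]
        dual_space_scaleR[OF dual_basis_dual[OF W that(2)] endo_space_mem[OF p(3) dual_basis_mem[OF W that(3)]]]
      by simp
    then show ?thesis unfolding p(1) by (subst pure_tensor_expand[OF p(2,3)]) (auto intro!: sum.cong simp: p(1))
  qed
  ultimately show ?thesis
    using lin_on_eq_on_span[of _ UNIV "\<lambda>t. t" UNIV ?h t] t unfolding tensor_space_def by blast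
qed

text \<open>Converse to \<open>tensor_expand\<close>: a tensor is built from given coefficients and
  its action computed. The value of \<alpha> at a point arises in this way.\<close>

lemma tensor_action_sum:
  fixes c :: "nat \<Rightarrow> nat \<Rightarrow> nat \<Rightarrow> real"
  assumes \<omega>: "\<omega> \<in> dual_space S" and x: "x \<in> W"
    and t_def: "t = (\<Sum>i<m. \<Sum>j<r. \<Sum>k<r. c i j k *\<^sub>R pure_tensor S (endo_space W) (s i) (matrix_unit e \<eta> j k))"
  shows "t \<in> tensor_space S (endo_space W)"
    and "tensor_action S W t (pure_tensor (dual_space S) W \<omega> x) =
      (\<Sum>i<m. \<Sum>k<r. (\<omega> (s i) * \<eta> k x) *\<^sub>R (\<Sum>j<r. c i j k *\<^sub>R e j))"
proof -
  let ?T = "tensor_space S (endo_space W)" and ?P =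
      "\<lambda>i j k. pure_tensor S (endo_space W) (s i) (matrix_unit e \<eta> j k)"
  note sT = subspace_tensor_space[of S "endo_space W"]
  let ?u = "pure_tensor (dual_space S) W \<omega> x"
  have l: "lin_on ?T W (\<lambda>t. tensor_action S W t ?u)"
    using bilin_on_left[OF tensor_action_bilin pure_tensor_mem[OF \<omega> x]] .
  have P: "?P i j k \<in> ?T" if "i < m" "j < r" "k < r" for i j k
    using that dual_basis_mem[OF S] matrix_unit_mem[OF W] by (intro pure_tensor_mem)
  then have P1: "(\<Sum>k<r. c i j k *\<^sub>R ?P i j k) \<in> ?T" if "i < m" "j < r" for i j
    using that by (intro subspace_sum[OF sT] subspace_mul[OF sT]) auto
  then have P2: "(\<Sum>j<r. \<Sum>k<r. c i j k *\<^sub>R ?P i j k) \<in> ?T" if "i < m" for i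
    using that by (auto intro!: subspace_sum[OF sT, of "{..<r}" "\<lambda>j. \<Sum>k<r. c i j k *\<^sub>R ?P i j k"])
  then show "t \<in> ?T" unfolding t_def
    by (auto intro!: subspace_sum[OF sT, of "{..<m}" "\<lambda>i. \<Sum>j<r. \<Sum>k<r. c i j k *\<^sub>R ?P i j k"])
  have add: "tensor_action S W (\<Sum>a\<in>A. f a) ?u = (\<Sum>a\<in>A. tensor_action S W (f a) ?u)"
    if "\<And>a. a \<in> A \<Longrightarrow> f a \<in> ?T" for A :: "nat set" and f
    using lin_on_sum[OF l sT, of A f "\<lambda>_. 1"] that by simp
  have "tensor_action S W t ?u = (\<Sum>i<m. \<Sum>j<r. \<Sum>k<r. c i j k *\<^sub>R tensor_action S W (?P i j k) ?u)"
  proof -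
    have 1: "tensor_action S W (\<Sum>k<r. c i j k *\<^sub>R ?P i j k) ?u =
        (\<Sum>k<r. c i j k *\<^sub>R tensor_action S W (?P i j k) ?u)"
      if "i < m" "j < r" for i j using P that by (intro lin_on_sum[OF l sT]) auto
    have 2: "tensor_action S W (\<Sum>j<r. \<Sum>k<r. c i j k *\<^sub>R ?P i j k) ?u =
        (\<Sum>j<r. \<Sum>k<r. c i j k *\<^sub>R tensor_action S W (?P i j k) ?u)"
      if "i < m" for i using P1 that by (subst add) (auto simp: 1)
    show ?thesis unfolding t_def using P2 by (subst add) (auto simp: 2)
  qed
  also have "\<dots> = (\<Sum>i<m. \<Sum>j<r. \<Sum>k<r. c i j k *\<^sub>R (\<omega> (s i) *\<^sub>R (\<eta> k x *\<^sub>R e j)))"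
    using \<omega> x dual_basis_mem[OF S] matrix_unit_mem[OF W]
    by (intro sum.cong) (auto simp: tensor_action_pure matrix_unit_def)
  also have "\<dots> = (\<Sum>i<m. \<Sum>k<r. \<Sum>j<r. c i j k *\<^sub>R (\<omega> (s i) *\<^sub>R (\<eta> k x *\<^sub>R e j)))"
    by (subst sum.swap) simp
  finally show "tensor_action S W t ?u = (\<Sum>i<m. \<Sum>k<r. (\<omega> (s i) * \<eta> k x) *\<^sub>R (\<Sum>j<r. c i j k *\<^sub>R e j))"
    by (simp add: scaleR_sum_right mult_ac)
qed

lemma tensor_eqI:
  assumes t: "t \<in> tensor_space S (endo_space W)" and t': "t' \<in> tensor_space S (endo_space W)"
    and "\<And>i k. i < m \<Longrightarrow> k < r \<Longrightarrow> tensor_action S W t (pure_tensor (dual_space S) W (\<xi> i) (e k)) =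
      tensor_action S W t' (pure_tensor (dual_space S) W (\<xi> i) (e k))"
  shows "t = t'"
  by (subst tensor_expand[OF t], subst tensor_expand[OF t']) (simp add: assms(3))

end


text \<open>The frames of the endomorphism and tensor bundles are list comprehensions over pairs, so
  position \<open>x\<close> in such a list stands for the pair of quotient and remainder.\<close>

lemma sum_div_mod:
  fixes g :: "nat \<Rightarrow> nat \<Rightarrow> 'a::comm_monoid_add"
  shows "(\<Sum>x<a * b. g (x div b) (x mod b)) = (\<Sum>i<a. \<Sum>j<b. g i j)"
proof -
  have "(\<Sum>x<a * b. g (x div b) (x mod b)) = (\<Sum>i<a. \<Sum>x = i * b..<i * b + b. g (x div b) (x mod b))"
    by (rule sum.nat_group[symmetric])
  also have "\<dots> = (\<Sum>i<a. \<Sum>j<b. g i j)"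
  proof (rule sum.cong[OF refl])
    fix i
    have "(\<Sum>x = i * b..<i * b + b. g (x div b) (x mod b)) =
        (\<Sum>j = 0..<b. g ((j + i * b) div b) ((j + i * b) mod b))"
      using sum.shift_bounds_nat_ivl[of "\<lambda>x. g (x div b) (x mod b)" 0 "i * b" b] by (simp add: add.commute)
    also have "\<dots> = (\<Sum>j<b. g i j)"
      by (intro sum.cong) auto
    finally show "(\<Sum>x = i * b..<i * b + b. g (x div b) (x mod b)) = (\<Sum>j<b. g i j)" .
  qed
  finally show ?thesis .
qed

lemma nth_concat_map_map:
  assumes "x < length xs * length ys"
  shows "[h a b. a \<leftarrow> xs, b \<leftarrow> ys] ! x = h (xs ! (x div length ys)) (ys ! (x mod length ys))"
proof -
  have "[h a b. a \<leftarrow> xs, b \<leftarrow> ys] = map (\<lambda>(a, b). h a b) (List.product xs ys)"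
    by (induction xs) auto
  then show ?thesis using assms by (simp add: product_nth)
qed

lemma length_concat_map_map: "length [h a b. a \<leftarrow> xs, b \<leftarrow> ys] = length xs * length ys"
  by (induction xs) auto

section \<open>Coordinate covectors and smooth vector fields\<close>

context smooth_mfd
begin

text \<open>The covector dx_i at \<open>p\<close>. Since \<open>differential\<close> evaluates
  tangent vectors on global functions, some global function with the germ of the coordinate at
  \<open>p\<close> is chosen; by locality of tangent vectors the choice does not matter.\<close>

definition coord_covec :: "'m set \<Rightarrow> ('m \<Rightarrow> nat \<Rightarrow> real) \<Rightarrow> nat \<Rightarrow> 'm \<Rightarrow> 'm tvec \<Rightarrow> real"
  where "coord_covec U \<phi> i p = differential M (SOME \<zeta>. \<zeta> \<in> \<A> \<and>
    (\<exists>W. open W \<and> p \<in> W \<and> W \<subseteq> U \<and> (\<forall>q\<in>W. \<zeta> q = \<phi> q i))) p"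

lemma coord_covec_eq:
  assumes W: "open W" "p \<in> W" "W \<subseteq> U" and \<zeta>: "\<zeta> \<in> \<A>" "\<And>q. q \<in> W \<Longrightarrow> \<zeta> q = \<phi> q i"
  shows "coord_covec U \<phi> i p = differential M \<zeta> p"
proof -
  define \<zeta>' where "\<zeta>' = (SOME \<zeta>. \<zeta> \<in> \<A> \<and>
    (\<exists>W. open W \<and> p \<in> W \<and> W \<subseteq> U \<and> (\<forall>q\<in>W. \<zeta> q = \<phi> q i)))"
  have "\<exists>\<zeta>. \<zeta> \<in> \<A> \<and> (\<exists>W. open W \<and> p \<in> W \<and> W \<subseteq> U \<and> (\<forall>q\<in>W. \<zeta> q = \<phi> q i))"
    using assms by (intro exI[of _ \<zeta>] conjI exI[of _ W]) auto
  from someI_ex[OF this, folded \<zeta>'_def] obtain W' where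
    W': "\<zeta>' \<in> \<A>" "open W'" "p \<in> W'" "\<forall>q\<in>W'. \<zeta>' q = \<phi> q i" by blast
  have "v \<zeta>' = v \<zeta>" if "v \<in> tangent_space M p" for v
    using tangent_local[OF that W'(1) \<zeta>(1), of "W \<inter> W'"] W W' \<zeta>(2) by auto
  then show ?thesis by (auto simp: coord_covec_def \<zeta>'_def[symmetric] differential_def)
qed

lemma subspace_tangent_space: "subspace (tangent_space M p)"
  unfolding subspace_def tangent_space_def dual_space_def lin_on_def
  by (auto simp: scaleR_fun_def algebra_simps)

lemma differential_in_dual_space: "differential M f p \<in> dual_space (tangent_space M p)"
  using subspace_add[OF subspace_tangent_space[of p]] subspace_mul[OF subspace_tangent_space[of p]]
  by (simp add: dual_space_def lin_on_def differential_def scaleR_fun_def)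

lemma tangent_dual_basis:
  assumes c: "(U, \<phi>) \<in> charts M" and p: "p \<in> U"
  shows "dual_basis (tangent_space M p) n (\<lambda>i. coord_vec M U \<phi> i p) (\<lambda>i. coord_covec U \<phi> i p)"
proof -
  obtain \<zeta> W where \<zeta>: "\<And>i. i < n \<Longrightarrow> \<zeta> i \<in> \<A>" "open W" "p \<in> W" "W \<subseteq> U"
    "\<And>i q. i < n \<Longrightarrow> q \<in> W \<Longrightarrow> \<zeta> i q = \<phi> q i"
    using global_coordinates[OF c p] by blast
  have eq: "coord_covec U \<phi> i p = differential M (\<zeta> i) p" if "i < n" for i
    by (rule coord_covec_eq[of W]) (use \<zeta> that in auto)
  have "v = (\<Sum>i<n. coord_covec U \<phi> i p v *\<^sub>R coord_vec M U \<phi> i p)" if v: "v \<in> tangent_space M p" for v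
  proof -
    have "v = (\<Sum>i<n. v (\<zeta> i) *\<^sub>R coord_vec M U \<phi> i p)"
      by (rule tangent_expansion[OF c \<zeta>(2-4) \<zeta>(1,5) v])
    also have "\<dots> = (\<Sum>i<n. coord_covec U \<phi> i p v *\<^sub>R coord_vec M U \<phi> i p)"
      by (intro sum.cong) (auto simp: eq differential_def v)
    finally show ?thesis .
  qed
  moreover have "coord_covec U \<phi> i p \<in> dual_space (tangent_space M p)" if "i < n" for i
    using eq[OF that] differential_in_dual_space by simp
  ultimately show ?thesis
    using subspace_tangent_space coord_vec_in_tangent_space[OF c p] by (simp add: dual_basis_def)
qed

text \<open>Near each point the coefficients in a coordinate frame are the derivatives of global
  representatives of the coordinates, and those are smooth by assumption.\<close>

lemma smooth_vector_fieldI: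
  assumes W: "open W" and v: "\<And>q. q \<in> W \<Longrightarrow> v q \<in> tangent_space M q"
    and s: "\<And>f. f \<in> \<A> \<Longrightarrow> smooth_fun_on M W (\<lambda>q. v q f)"
  shows "smooth_section_on M (tangent_bundle M) W v"
proof -
  have "\<exists>c. (\<forall>i<length es. smooth_fun_on M (W \<inter> U) (c i)) \<and>
      (\<forall>p\<in>W \<inter> U. v p = (\<Sum>i<length es. c i p *\<^sub>R (es ! i) p))"
    if "(U, es) \<in> frames (tangent_bundle M)" for U es
  proof -
    obtain \<phi> where c: "(U, \<phi>) \<in> charts M" and es: "es = map (coord_vec M U \<phi>) [0..<n]"
      using \<open>(U, es) \<in> _\<close> by (auto simp: tangent_bundle_def)
    have "smooth_fun_on M (W \<inter> U) (\<lambda>q. coord_covec U \<phi> i q (v q))" if i: "i < n" for i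
    proof (rule smooth_fun_on_local)
      show "open (W \<inter> U)" using W chart_open[OF c] by auto
      fix p assume p: "p \<in> W \<inter> U"
      obtain \<zeta> W' where \<zeta>: "\<And>i. i < n \<Longrightarrow> \<zeta> i \<in> \<A>" "open W'" "p \<in> W'" "W' \<subseteq> U"
        "\<And>i q. i < n \<Longrightarrow> q \<in> W' \<Longrightarrow> \<zeta> i q = \<phi> q i"
        using global_coordinates[OF c, of p] p by blast
      have vs: "smooth_fun_on M (W \<inter> W') (\<lambda>q. v q (\<zeta> i))"
        by (rule smooth_fun_on_subset[OF _ s[OF \<zeta>(1)[OF i]]]) blast
      have veq: "v q (\<zeta> i) = coord_covec U \<phi> i q (v q)" if "q \<in> W \<inter> W'" for q
      proof -
        have "coord_covec U \<phi> i q = differential M (\<zeta> i) q"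
          by (rule coord_covec_eq[of W']) (use \<zeta> i that in auto)
        then show ?thesis using v that by (simp add: differential_def)
      qed
      have "smooth_fun_on M (W \<inter> W') (\<lambda>q. coord_covec U \<phi> i q (v q))"
        by (rule smooth_fun_on_cong[OF open_Int[OF W \<zeta>(2)] veq vs])
      then show "\<exists>W'. open W' \<and> p \<in> W' \<and> smooth_fun_on M W' (\<lambda>q. coord_covec U \<phi> i q (v q))"
        using W \<zeta>(2,3) p by (intro exI[of _ "W \<inter> W'"]) auto
    qed
    moreover have "v q = (\<Sum>i<n. coord_covec U \<phi> i q (v q) *\<^sub>R coord_vec M U \<phi> i q)" if "q \<in> W \<inter> U" for q
      using dual_basis_expand[OF tangent_dual_basis[OF c] v] that by simp
    ultimately show ?thesis
      unfolding es by (intro exI[of _ "\<lambda>i q. coord_covec U \<phi> i q (v q)"]) simp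
  qed
  then show ?thesis using v unfolding smooth_section_on_def by (auto simp: tangent_bundle_def)
qed

end

subsection \<open>Vector bundles\<close>

definition frame_coef :: "('m \<Rightarrow> 'v::real_vector) list \<Rightarrow> nat \<Rightarrow> 'm \<Rightarrow> 'v \<Rightarrow> real"
  where "frame_coef es j p x = representation ((\<lambda>d. d p) ` set es) x ((es ! j) p)"

locale smooth_vb = smooth_mfd M for M :: "'m::{t2_space,second_countable_topology} mfd" +
  fixes E :: "('m, 'v::real_vector) vbundle" and r :: nat
  assumes smooth_vector_bundle: "smooth_vector_bundle M r E"
begin

abbreviation "Sec \<equiv> sections M E"

lemma subspace_fibre: "subspace (fibre E p)"
  using smooth_vector_bundle by (simp add: smooth_vector_bundle_def)

lemma frame_exists: obtains U es where "(U, es) \<in> frames E" "p \<in> U"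
proof -
  have "(\<Union>(U, es)\<in>frames E. U) = UNIV" using smooth_vector_bundle by (simp add: smooth_vector_bundle_def)
  then have "p \<in> (\<Union>(U, es)\<in>frames E. U)" by simp
  then show ?thesis using that by auto
qed

lemma frame_props:
  assumes "(U, es) \<in> frames E"
  shows frame_open: "open U" and frame_length: "length es = r"
    and frame_distinct: "p \<in> U \<Longrightarrow> distinct (map (\<lambda>e. e p) es)"
    and frame_independent: "p \<in> U \<Longrightarrow> independent ((\<lambda>e. e p) ` set es)"
    and frame_span: "p \<in> U \<Longrightarrow> span ((\<lambda>e. e p) ` set es) = fibre E p"
    and frame_smooth: "e \<in> set es \<Longrightarrow> smooth_section_on M E U e"
proof -
  have *: "\<forall>(U, es)\<in>frames E. open U \<and> length es = r \<and>
      (\<forall>p\<in>U. distinct (map (\<lambda>e. e p) es) \<and> independent ((\<lambda>e. e p) ` set es) \<and>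
        span ((\<lambda>e. e p) ` set es) = fibre E p) \<and>
      (\<forall>e\<in>set es. smooth_section_on M E U e)"
    using smooth_vector_bundle by (simp add: smooth_vector_bundle_def)
  then show "open U" "length es = r" "p \<in> U \<Longrightarrow> distinct (map (\<lambda>e. e p) es)"
    "p \<in> U \<Longrightarrow> independent ((\<lambda>e. e p) ` set es)"
    "p \<in> U \<Longrightarrow> span ((\<lambda>e. e p) ` set es) = fibre E p"
    "e \<in> set es \<Longrightarrow> smooth_section_on M E U e"
    using assms by auto
qed

text \<open>Frames are lists, while \<open>representation\<close> works with sets of vectors.
  Distinctness at \<open>p\<close> makes the two kinds of sums interchangeable.\<close>

lemma frame_bij:
  assumes "(U, es) \<in> frames E" "p \<in> U"
  shows "bij_betw (\<lambda>j. (es ! j) p) {..<r} ((\<lambda>e. e p) ` set es)"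
proof -
  have "bij_betw (\<lambda>j. map (\<lambda>e. e p) es ! j) {..<length (map (\<lambda>e. e p) es)} (set (map (\<lambda>e. e p) es))"
    by (rule bij_betw_nth[OF frame_distinct[OF assms] refl refl])
  then show ?thesis
    using frame_length[OF assms(1)] bij_betw_cong[of "{..<r}" "\<lambda>j. map (\<lambda>e. e p) es ! j" "\<lambda>j. (es ! j) p"]
    by simp
qed

lemma frame_dual_basis:
  assumes f: "(U, es) \<in> frames E" and p: "p \<in> U"
  shows "dual_basis (fibre E p) r (\<lambda>j. (es ! j) p) (\<lambda>j. frame_coef es j p)"
  unfolding dual_basis_def
proof (intro conjI allI impI ballI)
  let ?B = "(\<lambda>d. d p) ` set es"
  note ind = frame_independent[OF f p] and sp = frame_span[OF f p]
  show "subspace (fibre E p)" by (rule subspace_fibre)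
  fix j assume j: "j < r"
  then have "es ! j \<in> set es" using frame_length[OF f] by simp
  then show "(es ! j) p \<in> fibre E p" using sp span_superset[of ?B] by blast
  have "representation ?B x = (\<lambda>b. 0)" if "x \<notin> span ?B" for x
    using that by (simp add: representation_def)
  then show "frame_coef es j p \<in> dual_space (fibre E p)"
    unfolding dual_space_def lin_on_def frame_coef_def sp[symmetric]
    using ind by (auto simp: representation_add representation_scale)
next
  fix v assume v: "v \<in> fibre E p"
  let ?B = "(\<lambda>d. d p) ` set es"
  have "v = (\<Sum>b\<in>?B. representation ?B v b *\<^sub>R b)"
    using sum_representation_eq[OF frame_independent[OF f p], of v ?B] v frame_span[OF f p] by simp
  also have "\<dots> = (\<Sum>j<r. frame_coef es j p v *\<^sub>R (es ! j) p)"
    unfolding frame_coef_def by (rule sum.reindex_bij_betw[OF frame_bij[OF f p], symmetric])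
  finally show "v = (\<Sum>j<r. frame_coef es j p v *\<^sub>R (es ! j) p)" .
qed

lemma frame_coef_add:
  "(U, es) \<in> frames E \<Longrightarrow> p \<in> U \<Longrightarrow> j < r \<Longrightarrow> x \<in> fibre E p \<Longrightarrow> y \<in> fibre E p \<Longrightarrow>
    frame_coef es j p (x + y) = frame_coef es j p x + frame_coef es j p y"
  using dual_space_add[OF dual_basis_dual[OF frame_dual_basis]] by blast

lemma frame_coef_scaleR:
  "(U, es) \<in> frames E \<Longrightarrow> p \<in> U \<Longrightarrow> j < r \<Longrightarrow> x \<in> fibre E p \<Longrightarrow>
    frame_coef es j p (a *\<^sub>R x) = a * frame_coef es j p x"
  using dual_space_scaleR[OF dual_basis_dual[OF frame_dual_basis]] by blast

lemma frame_coef_frame: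
  assumes f: "(U, es) \<in> frames E" and p: "p \<in> U" and "j < r" "k < r"
  shows "frame_coef es j p ((es ! k) p) = (if j = k then 1 else 0)"
proof -
  have "(es ! k) p \<in> (\<lambda>e. e p) ` set es" using assms frame_length[OF f] by simp
  moreover have "(es ! k) p = (es ! j) p \<longleftrightarrow> j = k"
    using frame_bij[OF f p] assms(3,4) by (auto simp: bij_betw_def inj_on_def)
  ultimately show ?thesis
    unfolding frame_coef_def by (auto simp: representation_basis[OF frame_independent[OF f p]])
qed

lemma frame_coef_sum:
  assumes f: "(U, es) \<in> frames E" and p: "p \<in> U" and "j < r"
  shows "frame_coef es j p (\<Sum>k<r. c k *\<^sub>R (es ! k) p) = c j"
proof -
  have l: "lin_on (fibre E p) UNIV (frame_coef es j p)"
    using dual_basis_dual[OF frame_dual_basis[OF f p] assms(3)] by (simp add: dual_space_def)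
  have "frame_coef es j p (\<Sum>k<r. c k *\<^sub>R (es ! k) p) = (\<Sum>k<r. c k *\<^sub>R frame_coef es j p ((es ! k) p))"
    using dual_basis_mem[OF frame_dual_basis[OF f p]] by (intro lin_on_sum[OF l subspace_fibre]) auto
  also have "\<dots> = (\<Sum>k<r. if j = k then c k else 0)"
    by (intro sum.cong) (auto simp: frame_coef_frame[OF f p assms(3)])
  finally show ?thesis using assms(3) by simp
qed

text \<open>Coefficients in a frame are unique, so the existential quantifier over coefficient
  functions can be replaced by \<open>frame_coef\<close>.\<close>

lemma smooth_section_on_iff:
  assumes W: "open W"
  shows "smooth_section_on M E W X \<longleftrightarrow> (\<forall>p\<in>W. X p \<in> fibre E p) \<and>
    (\<forall>(U, es)\<in>frames E. \<forall>j<r. smooth_fun_on M (W \<inter> U) (\<lambda>p. frame_coef es j p (X p)))"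
    (is "_ \<longleftrightarrow> ?R")
proof
  assume L: "smooth_section_on M E W X"
  have "smooth_fun_on M (W \<inter> U) (\<lambda>p. frame_coef es j p (X p))" if f: "(U, es) \<in> frames E" and j: "j < r"
      for U es j
  proof -
    obtain c where c: "\<forall>i<r. smooth_fun_on M (W \<inter> U) (c i)" "\<forall>p\<in>W \<inter> U. X p = (\<Sum>i<r. c i p *\<^sub>R (es ! i) p)"
      using L f frame_length[OF f] unfolding smooth_section_on_def by fastforce
    have "smooth_fun_on M (W \<inter> U) (c j)" using c j by blast
    then show ?thesis
    proof (rule smooth_fun_on_cong[rotated 2])
      show "open (W \<inter> U)" using W frame_open[OF f] by blast
      show "c j p = frame_coef es j p (X p)" if "p \<in> W \<inter> U" for p
        using c(2) that frame_coef_sum[OF f _ j] by simp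
    qed
  qed
  then show ?R using L unfolding smooth_section_on_def by auto
next
  assume R: ?R
  have "\<exists>c. (\<forall>i<length es. smooth_fun_on M (W \<inter> U) (c i)) \<and>
      (\<forall>p\<in>W \<inter> U. X p = (\<Sum>i<length es. c i p *\<^sub>R (es ! i) p))" if f: "(U, es) \<in> frames E" for U es
  proof (intro exI[of _ "\<lambda>j p. frame_coef es j p (X p)"] conjI allI impI ballI)
    show "smooth_fun_on M (W \<inter> U) (\<lambda>p. frame_coef es i p (X p))" if "i < length es" for i
      using R f that frame_length[OF f] by auto
    show "X p = (\<Sum>i<length es. frame_coef es i p (X p) *\<^sub>R (es ! i) p)" if "p \<in> W \<inter> U" for p
      using dual_basis_expand[OF frame_dual_basis[OF f], of p "X p"] that R frame_length[OF f] by simp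
  qed
  then show "smooth_section_on M E W X" using R unfolding smooth_section_on_def by auto
qed

lemma sections_iff:
  "X \<in> Sec \<longleftrightarrow> (\<forall>p. X p \<in> fibre E p) \<and>
    (\<forall>(U, es)\<in>frames E. \<forall>j<r. smooth_fun_on M U (\<lambda>p. frame_coef es j p (X p)))"
  using smooth_section_on_iff[OF open_UNIV, of X] by (simp add: sections_def)

lemma section_in_fibre: "X \<in> Sec \<Longrightarrow> X p \<in> fibre E p"
  by (simp add: sections_iff)

lemma section_coef_smooth:
  "X \<in> Sec \<Longrightarrow> (U, es) \<in> frames E \<Longrightarrow> j < r \<Longrightarrow> smooth_fun_on M U (\<lambda>p. frame_coef es j p (X p))"
  by (auto simp: sections_iff)

lemma sectionsI:
  assumes "\<And>p. X p \<in> fibre E p"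
    and "\<And>U es j. (U, es) \<in> frames E \<Longrightarrow> j < r \<Longrightarrow> smooth_fun_on M U (\<lambda>p. frame_coef es j p (X p))"
  shows "X \<in> Sec"
  using assms by (auto simp: sections_iff)

lemma sections_fmult:
  assumes "f \<in> \<A>" "X \<in> Sec" shows "f \<cdot>\<^sub>s X \<in> Sec"
proof (rule sectionsI)
  show "(f \<cdot>\<^sub>s X) p \<in> fibre E p" for p
    using assms section_in_fibre subspace_mul[OF subspace_fibre] by (simp add: fmult_def)
  show "smooth_fun_on M U (\<lambda>p. frame_coef es j p ((f \<cdot>\<^sub>s X) p))" if "(U, es) \<in> frames E" "j < r" for U es j
    by (rule smooth_fun_on_cong[OF frame_open[OF that(1)] _
          smooth_fun_on_mult[OF frame_open[OF that(1)] smooth_funs_onD[OF assms(1)]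
              section_coef_smooth[OF assms(2) that]]])
       (use that assms section_in_fibre in \<open>auto simp: fmult_def frame_coef_scaleR[OF that(1)]\<close>)
qed

lemma sections_add:
  assumes "X \<in> Sec" "Y \<in> Sec" shows "X + Y \<in> Sec"
proof (rule sectionsI)
  show "(X + Y) p \<in> fibre E p" for p
    using assms section_in_fibre subspace_add[OF subspace_fibre] by simp
  show "smooth_fun_on M U (\<lambda>p. frame_coef es j p ((X + Y) p))" if "(U, es) \<in> frames E" "j < r" for U es j
    by (rule smooth_fun_on_cong[OF frame_open[OF that(1)] _
          smooth_fun_on_add[OF frame_open[OF that(1)] section_coef_smooth[OF assms(1) that]
              section_coef_smooth[OF assms(2) that]]])
       (use that assms section_in_fibre in \<open>auto simp: frame_coef_add[OF that(1)]\<close>)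
qed

lemma sections_scaleR: "X \<in> Sec \<Longrightarrow> c *\<^sub>R X \<in> Sec"
  using sections_fmult[OF smooth_funs_const[of c]] by (simp add: fmult_def scaleR_fun_def)

lemma sections_zero: "0 \<in> Sec"
proof (rule sectionsI)
  show "smooth_fun_on M U (\<lambda>p. frame_coef es j p (0 p))" if "(U, es) \<in> frames E" "j < r" for U es j
    by (rule smooth_fun_on_cong[OF frame_open[OF that(1)] _ smooth_fun_on_const[OF frame_open[OF
        that(1)], of 0]])
       (use frame_coef_scaleR[OF that(1) _ that(2), of _ 0 0] subspace_0[OF subspace_fibre] in auto)
qed (simp add: subspace_0[OF subspace_fibre])

lemma subspace_sections: "subspace Sec"
  by (simp add: subspace_def sections_zero sections_add sections_scaleR)

text \<open>As for functions: multiply by a bump function and check smoothness separately on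
  \<open>W\<close> and on the complement of \<open>K\<close>.\<close>

lemma local_section_extension:
  assumes W: "open W" "p \<in> W" and s: "smooth_section_on M E W s"
  obtains X W' where "X \<in> Sec" "open W'" "p \<in> W'" "W' \<subseteq> W" "\<And>q. q \<in> W' \<Longrightarrow> X q = s q"
proof -
  obtain \<beta> K W' where b: "\<beta> \<in> \<A>" "closed K" "K \<subseteq> W" "open W'" "p \<in> W'" "W' \<subseteq> W"
    "\<And>q. q \<in> W' \<Longrightarrow> \<beta> q = 1" "\<And>q. q \<notin> K \<Longrightarrow> \<beta> q = 0"
    using smooth_bump[OF W] by metis
  define X where "X q = (if q \<in> W then \<beta> q *\<^sub>R s q else 0)" for q
  note s' = s[unfolded smooth_section_on_iff[OF W(1)]]
  have "X \<in> Sec"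
  proof (rule sectionsI)
    show "X q \<in> fibre E q" for q
      using s' subspace_mul[OF subspace_fibre] subspace_0[OF subspace_fibre] by (simp add: X_def)
    fix U es j assume f: "(U, es) \<in> frames E" and j: "j < r"
    have coef0: "frame_coef es j q 0 = 0" if "q \<in> U" for q
      using frame_coef_scaleR[OF f that j, of 0 0] subspace_0[OF subspace_fibre] by simp
    show "smooth_fun_on M U (\<lambda>q. frame_coef es j q (X q))"
    proof (rule smooth_fun_on_local[OF frame_open[OF f]])
      fix q assume q: "q \<in> U"
      show "\<exists>W'. open W' \<and> q \<in> W' \<and> smooth_fun_on M W' (\<lambda>q. frame_coef es j q (X q))"
      proof (cases "q \<in> W")
        case True
        have o: "open (W \<inter> U)" using W frame_open[OF f] by blast
        have "smooth_fun_on M (W \<inter> U) (\<lambda>q. \<beta> q * frame_coef es j q (s q))"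
          using s' f j by (intro smooth_fun_on_mult[OF o] smooth_funs_onD[OF b(1)]) auto
        then have "smooth_fun_on M (W \<inter> U) (\<lambda>q. frame_coef es j q (X q))"
        proof (rule smooth_fun_on_cong[OF o, rotated])
          show "\<beta> q * frame_coef es j q (s q) = frame_coef es j q (X q)" if "q \<in> W \<inter> U" for q
            using that s' frame_coef_scaleR[OF f _ j, of q "s q"] by (simp add: X_def)
        qed
        then show ?thesis using o q True by blast
      next
        case False
        have o: "open (- K \<inter> U)" using b(2) frame_open[OF f] by blast
        have "smooth_fun_on M (- K \<inter> U) (\<lambda>q. frame_coef es j q (X q))"
          by (rule smooth_fun_on_cong[OF o _ smooth_fun_on_const[OF o, of 0]]) (auto simp: X_def b(8) coef0)
        then show ?thesis using o q False b(3) by blast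
      qed
    qed
  qed
  then show ?thesis using b by (intro that[of X W']) (auto simp: X_def)
qed

text \<open>The bracket takes global sections only, so a frame must be continued to global sections,
  at the price of shrinking the neighbourhood.\<close>

lemma global_frame:
  assumes f: "(U, es) \<in> frames E" and p: "p \<in> U"
  obtains e W where "\<And>j. j < r \<Longrightarrow> e j \<in> Sec" "open W" "p \<in> W" "W \<subseteq> U"
    "\<And>j q. j < r \<Longrightarrow> q \<in> W \<Longrightarrow> e j q = (es ! j) q"
proof -
  have "\<exists>X W'. X \<in> Sec \<and> open W' \<and> p \<in> W' \<and> W' \<subseteq> U \<and> (\<forall>q\<in>W'. X q = (es ! j) q)" if j: "j < r" for j
  proof -
    have "smooth_section_on M E U (es ! j)" using frame_smooth[OF f] frame_length[OF f] j by simp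
    then obtain X W' where "X \<in> Sec" "open W'" "p \<in> W'" "W' \<subseteq> U" "\<And>q. q \<in> W' \<Longrightarrow> X q = (es ! j) q"
      using local_section_extension[OF frame_open[OF f] p] by blast
    then show ?thesis by blast
  qed
  then obtain e W' where e: "\<And>j. j < r \<Longrightarrow> e j \<in> Sec \<and> open (W' j) \<and> p \<in> W' j \<and> W' j \<subseteq> U \<and>
      (\<forall>q\<in>W' j. e j q = (es ! j) q)"
    by metis
  show ?thesis
  proof (rule that[of e "U \<inter> (\<Inter>j\<in>{..<r}. W' j)"])
    show "open (U \<inter> (\<Inter>j\<in>{..<r}. W' j))" using e frame_open[OF f] by (intro open_Int open_INT) auto
  qed (use e p in auto)
qed

lemma section_through:
  assumes "x \<in> fibre E p" obtains X where "X \<in> Sec" "X p = x"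
proof -
  obtain U es where f: "(U, es) \<in> frames E" "p \<in> U" by (rule frame_exists)
  obtain e W where e: "\<And>j. j < r \<Longrightarrow> e j \<in> Sec" "p \<in> W" "\<And>j q. j < r \<Longrightarrow> q \<in> W \<Longrightarrow> e j q = (es ! j) q"
    using global_frame[OF f] by metis
  have "(\<Sum>j<r. frame_coef es j p x *\<^sub>R e j) \<in> Sec"
    using e(1) by (intro subspace_sum[OF subspace_sections] sections_scaleR) auto
  moreover have "(\<Sum>j<r. frame_coef es j p x *\<^sub>R e j) p = x"
    using dual_basis_expand[OF frame_dual_basis[OF f] assms] e(2,3) by (simp add: sum_fun_apply scaleR_fun_def)
  ultimately show ?thesis by (rule that)
qed

text \<open>Near \<open>p\<close> write X as a combination of a frame with coefficients vanishing at
  \<open>p\<close>, all made global, and pull the coefficients out of \<open>T\<close>. The target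
  type stays general because \<open>T\<close> is applied both with function values
  (\<open>hat\<close>) and with section values (\<open>symbol\<close>).\<close>

lemma tensorial_zero:
  fixes T :: "('m \<Rightarrow> 'v) \<Rightarrow> 'm \<Rightarrow> 'c::real_vector"
  assumes add: "\<And>X Y. X \<in> Sec \<Longrightarrow> Y \<in> Sec \<Longrightarrow> T (X + Y) = T X + T Y"
    and mult: "\<And>f X. f \<in> \<A> \<Longrightarrow> X \<in> Sec \<Longrightarrow> T (f \<cdot>\<^sub>s X) = f \<cdot>\<^sub>s T X"
    and X: "X \<in> Sec" and X0: "X p = 0"
  shows "T X p = 0"
proof -
  obtain U es where f: "(U, es) \<in> frames E" "p \<in> U" by (rule frame_exists)
  obtain e W where e: "\<And>j. j < r \<Longrightarrow> e j \<in> Sec" "open W" "p \<in> W" "W \<subseteq> U"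
    "\<And>j q. j < r \<Longrightarrow> q \<in> W \<Longrightarrow> e j q = (es ! j) q"
    using global_frame[OF f] by metis
  have "\<exists>g W'. g \<in> \<A> \<and> open W' \<and> p \<in> W' \<and> W' \<subseteq> U \<and> (\<forall>q\<in>W'. g q = frame_coef es j q (X q))"
    if j: "j < r" for j
  proof -
    obtain g W' where "g \<in> \<A>" "open W'" "p \<in> W'" "W' \<subseteq> U" "\<And>q. q \<in> W' \<Longrightarrow> g q = frame_coef es j q (X q)"
      using smooth_fun_local_extension[OF frame_open[OF f(1)] f(2) section_coef_smooth[OF X f(1) j]] by blast
    then show ?thesis by blast
  qed
  then obtain c W' where c: "\<And>j. j < r \<Longrightarrow> c j \<in> \<A> \<and> open (W' j) \<and> p \<in> W' j \<and> W' j \<subseteq> U \<and>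
      (\<forall>q\<in>W' j. c j q = frame_coef es j q (X q))" by metis
  define W2 where "W2 = W \<inter> (\<Inter>j\<in>{..<r}. W' j)"
  have W2: "open W2" "p \<in> W2" unfolding W2_def using c e(2,3) by (auto intro!: open_Int open_INT)
  obtain \<beta> K V where b: "\<beta> \<in> \<A>" "closed K" "K \<subseteq> W2" "open V" "p \<in> V" "V \<subseteq> W2"
    "\<And>q. q \<in> V \<Longrightarrow> \<beta> q = 1" "\<And>q. q \<notin> K \<Longrightarrow> \<beta> q = 0"
    using smooth_bump[OF W2] by metis
  define Z where "Z = (\<Sum>j<r. c j \<cdot>\<^sub>s e j)"
  have ce: "c j \<cdot>\<^sub>s e j \<in> Sec" if "j < r" for j using c e(1) that sections_fmult by blast
  then have Z: "Z \<in> Sec" unfolding Z_def by (intro subspace_sum[OF subspace_sections]) auto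
  have Tzero: "T 0 = 0"
    using mult[OF smooth_funs_const[of 0] sections_zero] by (simp add: fmult_def zero_fun_def)
  have Tsum: "T (\<Sum>j<k. c j \<cdot>\<^sub>s e j) = (\<Sum>j<k. c j \<cdot>\<^sub>s T (e j))" if "k \<le> r" for k
    using that
  proof (induction k)
    case (Suc k)
    have "(\<Sum>j<k. c j \<cdot>\<^sub>s e j) \<in> Sec" using ce Suc.prems by (intro subspace_sum[OF subspace_sections]) auto
    then have "T ((\<Sum>j<k. c j \<cdot>\<^sub>s e j) + c k \<cdot>\<^sub>s e k) = T (\<Sum>j<k. c j \<cdot>\<^sub>s e j) + T (c k \<cdot>\<^sub>s e k)"
      using ce Suc.prems by (intro add) auto
    also have "T (c k \<cdot>\<^sub>s e k) = c k \<cdot>\<^sub>s T (e k)" using c[of k] e(1) Suc.prems by (intro mult) auto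
    also have "T (\<Sum>j<k. c j \<cdot>\<^sub>s e j) = (\<Sum>j<k. c j \<cdot>\<^sub>s T (e j))" using Suc by simp
    finally show ?case by (simp only: sum.lessThan_Suc)
  qed (simp add: Tzero)
  \<comment> \<open>\<open>X\<close> and its combination \<open>Z\<close> agree only near
    \<open>p\<close>. Multiplication by \<beta> turns this into an equality of global sections, to
    which \<open>T\<close> can be applied.\<close>
  have "(\<beta> \<cdot>\<^sub>s X) q = (\<beta> \<cdot>\<^sub>s Z) q" for q
  proof (cases "q \<in> K")
    case True
    then have q: "q \<in> W2" "q \<in> U" using b(3) e(4) by (auto simp: W2_def)
    have "Z q = (\<Sum>j<r. frame_coef es j q (X q) *\<^sub>R (es ! j) q)"
      unfolding Z_def sum_fun_apply using q(1) c e(5) by (intro sum.cong) (auto simp: fmult_def W2_def)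
    also have "\<dots> = X q" by (rule dual_basis_expand[OF frame_dual_basis[OF f(1) q(2)] section_in_fibre[OF X]])
    finally show ?thesis by (simp add: fmult_def)
  next
    case False
    then show ?thesis by (simp add: fmult_def b(8))
  qed
  then have "\<beta> \<cdot>\<^sub>s X = \<beta> \<cdot>\<^sub>s Z" by blast
  then have "\<beta> \<cdot>\<^sub>s T X = \<beta> \<cdot>\<^sub>s T Z" using mult[OF b(1) X] mult[OF b(1) Z] by simp
  then have "T X p = T Z p" using b(5,7) by (auto simp: fmult_def dest: fun_cong[of _ _ p])
  also have "\<dots> = (\<Sum>j<r. c j p *\<^sub>R T (e j) p)"
    unfolding Z_def Tsum[OF order_refl] by (simp add: sum_fun_apply fmult_def)
  also have "\<dots> = 0"
  proof (rule sum.neutral, rule ballI)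
    fix j assume "j \<in> {..<r}"
    then have "c j p = frame_coef es j p (X p)" using c by blast
    also have "\<dots> = 0" using frame_coef_scaleR[OF f, of j 0 0] \<open>j \<in> _\<close> subspace_0[OF subspace_fibre] X0 by simp
    finally show "c j p *\<^sub>R T (e j) p = 0" by simp
  qed
  finally show ?thesis .
qed

lemma tensorial:
  fixes T :: "('m \<Rightarrow> 'v) \<Rightarrow> 'm \<Rightarrow> 'c::real_vector"
  assumes add: "\<And>X Y. X \<in> Sec \<Longrightarrow> Y \<in> Sec \<Longrightarrow> T (X + Y) = T X + T Y"
    and mult: "\<And>f X. f \<in> \<A> \<Longrightarrow> X \<in> Sec \<Longrightarrow> T (f \<cdot>\<^sub>s X) = f \<cdot>\<^sub>s T X"
    and X: "X \<in> Sec" and Y: "Y \<in> Sec" and "X p = Y p"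
  shows "T X p = T Y p"
proof -
  have m: "(-1) *\<^sub>R Y = (\<lambda>_. -1) \<cdot>\<^sub>s Y" by (simp add: fmult_def scaleR_fun_def)
  have "T (X + (-1) *\<^sub>R Y) p = 0"
  proof (rule tensorial_zero[OF add mult])
    show "X + (-1) *\<^sub>R Y \<in> Sec" by (rule sections_add[OF X sections_scaleR[OF Y]])
    show "(X + (-1) *\<^sub>R Y) p = 0" using assms(5) by (simp add: scaleR_fun_def)
  qed
  moreover have "T (X + (-1) *\<^sub>R Y) = T X + (\<lambda>_. -1) \<cdot>\<^sub>s T Y"
    using add[OF X sections_scaleR[OF Y, of "-1"]] mult[OF smooth_funs_const[of "-1"] Y] unfolding m by simp
  ultimately show ?thesis by (simp add: fmult_def)
qed

lemma nonvanishing_section: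
  assumes "r > 0" obtains Y where "Y \<in> Sec" "Y p \<noteq> 0"
proof -
  obtain U es where f: "(U, es) \<in> frames E" "p \<in> U" by (rule frame_exists)
  have "frame_coef es 0 p ((es ! 0) p) = 1" using frame_coef_frame[OF f assms assms] by simp
  moreover have "frame_coef es 0 p 0 = 0"
    using frame_coef_scaleR[OF f assms, of 0 0] subspace_0[OF subspace_fibre] by simp
  ultimately have "(es ! 0) p \<noteq> 0" by auto
  then show ?thesis using section_through[OF dual_basis_mem[OF frame_dual_basis[OF f] assms]] that by metis
qed

text \<open>Near a point, \<open>g\<close> is the first frame coefficient of \<open>g\<close> times
  the first frame section.\<close>

lemma smooth_multiplier:
  assumes r: "r > 0" and g: "\<And>Y. Y \<in> Sec \<Longrightarrow> g \<cdot>\<^sub>s Y \<in> Sec"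
  shows "g \<in> \<A>"
proof (rule smooth_funs_localI)
  fix p
  obtain U es where f: "(U, es) \<in> frames E" "p \<in> U" by (rule frame_exists)
  obtain e W where e: "\<And>j. j < r \<Longrightarrow> e j \<in> Sec" "open W" "p \<in> W" "W \<subseteq> U"
    "\<And>j q. j < r \<Longrightarrow> q \<in> W \<Longrightarrow> e j q = (es ! j) q"
    using global_frame[OF f] by metis
  have s: "smooth_fun_on M W (\<lambda>q. frame_coef es 0 q ((g \<cdot>\<^sub>s e 0) q))"
    using section_coef_smooth[OF g[OF e(1)[OF r]] f(1) r] smooth_fun_on_subset[OF e(4)] by blast
  have "frame_coef es 0 q ((g \<cdot>\<^sub>s e 0) q) = g q" if "q \<in> W" for q
  proof -
    have q: "q \<in> U" using that e(4) by blast
    show ?thesis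
      using e(5)[OF r that] frame_coef_scaleR[OF f(1) q r dual_basis_mem[OF frame_dual_basis[OF f(1) q]
          r], of "g q"]
        frame_coef_frame[OF f(1) q r r] by (simp add: fmult_def)
  qed
  then show "\<exists>W. open W \<and> p \<in> W \<and> (\<exists>h. smooth_fun_on M W h \<and> (\<forall>q\<in>W. h q = g q))"
    using s e(2,3) by blast
qed

lemma multiplier_unique:
  assumes "r > 0" "\<And>Y. Y \<in> Sec \<Longrightarrow> g \<cdot>\<^sub>s Y = h \<cdot>\<^sub>s Y"
  shows "g = h"
proof
  fix p
  obtain Y where Y: "Y \<in> Sec" "Y p \<noteq> 0" using nonvanishing_section[OF assms(1)] by blast
  have "(g \<cdot>\<^sub>s Y) p = (h \<cdot>\<^sub>s Y) p" using assms(2)[OF Y(1)] by simp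
  then show "g p = h p" using Y(2) by (simp add: fmult_def)
qed

lemma rank_zero_section: "r = 0 \<Longrightarrow> X \<in> Sec \<Longrightarrow> X = 0"
proof
  fix p assume r: "r = 0" and X: "X \<in> Sec"
  obtain U es where f: "(U, es) \<in> frames E" "p \<in> U" by (rule frame_exists)
  show "X p = 0 p" using dual_basis_expand[OF frame_dual_basis[OF f] section_in_fibre[OF X]] r by simp
qed

lemma rank_zero_fibre:
  assumes "r = 0" "x \<in> fibre E p" shows "x = 0"
proof -
  obtain X where "X \<in> Sec" "X p = x" using section_through[OF assms(2)] .
  moreover from this have "X = 0" using rank_zero_section[OF assms(1)] by blast
  ultimately show ?thesis by simp
qed

end


section \<open>The fibrewise action of tensors and smooth tensor sections\<close>

context smooth_vb
begin

abbreviation act :: "'m \<Rightarrow> (('m tvec \<Rightarrow> ('v \<Rightarrow> 'v) \<Rightarrow> real) \<Rightarrow> real) \<Rightarrow> ('m tvec \<Rightarrow> real) \<Rightarrow> 'v \<Rightarrow> 'v"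
  where "act p t \<omega> x \<equiv> tensor_action (tangent_space M p) (fibre E p) t
    (pure_tensor (dual_space (tangent_space M p)) (fibre E p) \<omega> x)"

abbreviation TE :: "'m \<Rightarrow> (('m tvec \<Rightarrow> ('v \<Rightarrow> 'v) \<Rightarrow> real) \<Rightarrow> real) set"
  where "TE p \<equiv> tensor_space (tangent_space M p) (endo_space (fibre E p))"

lemma act_bilin:
  "bilin_on (TE p) (tensor_space (dual_space (tangent_space M p)) (fibre E p)) (fibre E p)
    (tensor_action (tangent_space M p) (fibre E p))"
proof -
  obtain U es where f: "(U, es) \<in> frames E" "p \<in> U" by (rule frame_exists)
  show ?thesis
    using is_tensor_action_exists[OF frame_dual_basis[OF f], of "tangent_space M p"]
    by (simp add: is_tensor_action_def)
qed

lemma act_lin_left: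
  assumes "\<omega> \<in> dual_space (tangent_space M p)" "x \<in> fibre E p"
  shows "lin_on (TE p) (fibre E p) (\<lambda>t. act p t \<omega> x)"
  by (rule bilin_on_left[OF act_bilin pure_tensor_mem[OF assms]])

lemma act_lin_right:
  assumes "\<omega> \<in> dual_space (tangent_space M p)" "t \<in> TE p"
  shows "lin_on (fibre E p) (fibre E p) (\<lambda>x. act p t \<omega> x)"
proof -
  note l = bilin_on_right[OF act_bilin assms(2)]
    and l' = bilin_on_right[OF pure_tensor_bilin[of _ "fibre E p"] assms(1)]
  show ?thesis
    unfolding lin_on_def
    using lin_on_mem[OF l'] by (simp add: lin_on_add[OF l'] lin_on_scaleR[OF l'] lin_on_mem[OF l]
        lin_on_add[OF l] lin_on_scaleR[OF l])
qed

text \<open>The test arguments of \<open>tensor_eqI\<close> are of this form: coordinate covectors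
  are differentials of global functions, and every fibre vector is the value of a global section.
  Uniqueness and linearity of \<alpha> are both derived from this.\<close>

lemma TE_eqI:
  assumes t: "t \<in> TE p" "t' \<in> TE p"
    and eq: "\<And>f X. f \<in> \<A> \<Longrightarrow> X \<in> Sec \<Longrightarrow> act p t (differential M f p) (X p) = act p t' (differential M f p) (X p)"
  shows "t = t'"
proof -
  obtain U es where f: "(U, es) \<in> frames E" "p \<in> U" by (rule frame_exists)
  obtain V \<phi> where c: "(V, \<phi>) \<in> charts M" "p \<in> V" by (rule chart_exists)
  obtain \<zeta> W where \<zeta>: "\<And>i. i < n \<Longrightarrow> \<zeta> i \<in> \<A>" "open W" "p \<in> W" "W \<subseteq> V"
    "\<And>i q. i < n \<Longrightarrow> q \<in> W \<Longrightarrow> \<zeta> i q = \<phi> q i"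
    using global_coordinates[OF c] by blast
  show ?thesis
  proof (rule tensor_eqI[OF tangent_dual_basis[OF c] frame_dual_basis[OF f] t])
    fix i k assume ik: "i < n" "k < r"
    have "coord_covec V \<phi> i p = differential M (\<zeta> i) p"
      by (rule coord_covec_eq[of W]) (use \<zeta> ik in auto)
    moreover obtain X where "X \<in> Sec" "X p = (es ! k) p"
      using section_through[OF dual_basis_mem[OF frame_dual_basis[OF f] ik(2)]] .
    ultimately show "act p t (coord_covec V \<phi> i p) ((es ! k) p) = act p t' (coord_covec V \<phi> i p) ((es ! k) p)"
      using eq[OF \<zeta>(1)[OF ik(1)], of X] by simp
  qed
qed

text \<open>By \<open>tensor_expand\<close>, the coefficients in the induced frame are frame
  coefficients of the action on dx_i and e_k. Locally these come from a global function and a global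
  section, where the assumption applies.\<close>

lemma smooth_tensor_sectionI:
  assumes W: "open W" and t: "\<And>q. q \<in> W \<Longrightarrow> t q \<in> TE q"
    and s: "\<And>f Z U es j. f \<in> \<A> \<Longrightarrow> Z \<in> Sec \<Longrightarrow> (U, es) \<in> frames E \<Longrightarrow> j < r \<Longrightarrow>
      smooth_fun_on M (W \<inter> U) (\<lambda>q. frame_coef es j q (act q (t q) (differential M f q) (Z q)))"
  shows "smooth_section_on M (tensor_bundle (tangent_bundle M) (endo_bundle E)) W t"
proof -
  have coef: "smooth_fun_on M (W \<inter> (V \<inter> U)) (\<lambda>q. frame_coef es j q
      (act q (t q) (coord_covec V \<phi> i q) ((es ! k) q)))"
    if c: "(V, \<phi>) \<in> charts M" and f: "(U, es) \<in> frames E" and ijk: "i < n" "j < r" "k < r" for V \<phi> U es i j k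
  proof (rule smooth_fun_on_local)
    show "open (W \<inter> (V \<inter> U))" using W chart_open[OF c] frame_open[OF f] by blast
    fix p assume p: "p \<in> W \<inter> (V \<inter> U)"
    obtain \<zeta> W1 where \<zeta>: "\<And>i. i < n \<Longrightarrow> \<zeta> i \<in> \<A>" "open W1" "p \<in> W1" "W1 \<subseteq> V"
      "\<And>i q. i < n \<Longrightarrow> q \<in> W1 \<Longrightarrow> \<zeta> i q = \<phi> q i"
      using global_coordinates[OF c, of p] p by blast
    obtain e W2 where e: "\<And>j. j < r \<Longrightarrow> e j \<in> Sec" "open W2" "p \<in> W2" "W2 \<subseteq> U"
      "\<And>j q. j < r \<Longrightarrow> q \<in> W2 \<Longrightarrow> e j q = (es ! j) q"
      using global_frame[OF f, of p] p by blast
    let ?W = "W \<inter> W1 \<inter> W2"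
    have o: "open ?W" using W \<zeta>(2) e(2) by blast
    have "smooth_fun_on M ?W (\<lambda>q. frame_coef es j q (act q (t q) (differential M (\<zeta> i) q) (e k q)))"
      by (rule smooth_fun_on_subset[OF _ s[OF \<zeta>(1)[OF ijk(1)] e(1)[OF ijk(3)] f ijk(2)]]) (use e(4) in blast)
    then have "smooth_fun_on M ?W (\<lambda>q. frame_coef es j q (act q (t q) (coord_covec V \<phi> i q) ((es ! k) q)))"
    proof (rule smooth_fun_on_cong[OF o, rotated])
      fix q assume q: "q \<in> ?W"
      have "coord_covec V \<phi> i q = differential M (\<zeta> i) q"
        by (rule coord_covec_eq[of W1]) (use \<zeta> ijk q in auto)
      then show "frame_coef es j q (act q (t q) (differential M (\<zeta> i) q) (e k q)) =
          frame_coef es j q (act q (t q) (coord_covec V \<phi> i q) ((es ! k) q))"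
        using e(5)[OF ijk(3)] q by simp
    qed
    then show "\<exists>W'. open W' \<and> p \<in> W' \<and>
        smooth_fun_on M W' (\<lambda>q. frame_coef es j q (act q (t q) (coord_covec V \<phi> i q) ((es ! k) q)))"
      using o p \<zeta>(3) e(3) by (intro exI[of _ ?W]) auto
  qed
  have "\<exists>c. (\<forall>i<length L. smooth_fun_on M (W \<inter> D) (c i)) \<and> (\<forall>p\<in>W \<inter> D. t p = (\<Sum>i<length L. c i p *\<^sub>R (L ! i) p))"
    if DL: "(D, L) \<in> frames (tensor_bundle (tangent_bundle M) (endo_bundle E))" for D L
  proof -
    from DL obtain V \<phi> U es where c: "(V, \<phi>) \<in> charts M" and f: "(U, es) \<in> frames E" and D: "D = V \<inter> U"
      and L: "L = [(\<lambda>p. pure_tensor (tangent_space M p) (endo_space (fibre E p)) (a p) (b p)).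
          a \<leftarrow> map (coord_vec M V \<phi>) [0..<n],
          b \<leftarrow> [(\<lambda>p x. representation ((\<lambda>d. d p) ` set es) x (e' p) *\<^sub>R e p). e \<leftarrow> es, e' \<leftarrow> es]]"
      unfolding tensor_bundle_def tangent_bundle_def endo_bundle_def by auto
    let ?bs = "[(\<lambda>p x. representation ((\<lambda>d. d p) ` set es) x (e' p) *\<^sub>R e p). e \<leftarrow> es, e' \<leftarrow> es]"
    have lb: "length ?bs = r * r" using length_concat_map_map[of _ es es] frame_length[OF f] by simp
    have lL: "length L = n * (r * r)" unfolding L length_concat_map_map by (simp add: frame_length[OF f])
    have bs: "(?bs ! l) p = matrix_unit (\<lambda>j. (es ! j) p) (\<lambda>j. frame_coef es j p) (l div r) (l mod r)"
      if "l < r * r" for l p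
      using that frame_length[OF f] by (subst nth_concat_map_map) (auto simp: matrix_unit_def frame_coef_def)
    define P where "P p i l = pure_tensor (tangent_space M p) (endo_space (fibre E p)) (coord_vec M V \<phi> i p)
        (matrix_unit (\<lambda>j. (es ! j) p) (\<lambda>j. frame_coef es j p) (l div r) (l mod r))" for p i l
    have Lx: "(L ! x) p = P p (x div (r * r)) (x mod (r * r))" if x: "x < n * (r * r)" for x p
    proof -
      \<comment> \<open>If \<open>r\<close> were 0 there would be no index \<open>x\<close>;
        positivity is what bounds the remainder.\<close>
      have "0 < r * r" using x by (cases "r * r = 0") auto
      then have "x mod (r * r) < r * r" "x div (r * r) < n" using x by (auto simp: less_mult_imp_div_less)
      then show ?thesis unfolding L P_def bs[OF \<open>x mod (r * r) < r * r\<close>, symmetric]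
        by (subst nth_concat_map_map) (simp_all add: lb x)
    qed
    define C where "C i l q = frame_coef es (l div r) q
        (act q (t q) (coord_covec V \<phi> i q) ((es ! (l mod r)) q))" for i l q
    show ?thesis
    proof (intro exI[of _ "\<lambda>x q. C (x div (r * r)) (x mod (r * r)) q"] conjI allI impI ballI)
      fix x assume x: "x < length L"
      then have "0 < r * r" using lL by (cases "r * r = 0") auto
      then have "x mod (r * r) < r * r" "x div (r * r) < n" "r > 0" using x lL
          by (auto simp: less_mult_imp_div_less)
      then show "smooth_fun_on M (W \<inter> D) (C (x div (r * r)) (x mod (r * r)))"
        unfolding C_def D by (intro coef[OF c f]) (auto simp: less_mult_imp_div_less)
    next
      fix p assume p: "p \<in> W \<inter> D"
      then have pV: "p \<in> V" and pU: "p \<in> U" and pW: "p \<in> W" by (auto simp: D)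
      have "t p = (\<Sum>i<n. \<Sum>j<r. \<Sum>k<r. frame_coef es j p (act p (t p) (coord_covec V \<phi> i p) ((es ! k) p)) *\<^sub>R
          pure_tensor (tangent_space M p) (endo_space (fibre E p)) (coord_vec M V \<phi> i p)
            (matrix_unit (\<lambda>j. (es ! j) p) (\<lambda>j. frame_coef es j p) j k))"
        by (rule tensor_expand[OF tangent_dual_basis[OF c pV] frame_dual_basis[OF f pU] t[OF pW]])
      \<comment> \<open>First the pair of \<open>j\<close> and \<open>k\<close> is flattened to
        \<open>l\<close>, then the pair of \<open>i\<close> and \<open>l\<close> to a position in
        the nested list.\<close>
      also have "\<dots> = (\<Sum>i<n. \<Sum>l<r * r. C i l p *\<^sub>R P p i l)"
        unfolding C_def P_def by (intro sum.cong refl sum_div_mod[symmetric])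
      also have "\<dots> = (\<Sum>x<n * (r * r). C (x div (r * r)) (x mod (r * r)) p *\<^sub>R P p (x div (r * r))
          (x mod (r * r)))"
        by (rule sum_div_mod[symmetric])
      also have "\<dots> = (\<Sum>x<length L. C (x div (r * r)) (x mod (r * r)) p *\<^sub>R (L ! x) p)"
        unfolding lL by (intro sum.cong refl) (simp add: Lx)
      finally show "t p = (\<Sum>x<length L. C (x div (r * r)) (x mod (r * r)) p *\<^sub>R (L ! x) p)" .
    qed
  qed
  then show ?thesis using t unfolding smooth_section_on_def
    by (auto simp: tensor_bundle_def tangent_bundle_def endo_bundle_def)
qed

end

section \<open>Loday brackets on the sections of a vector bundle\<close>

locale loday_vb = smooth_vb M E r
  for M :: "'m::{t2_space,second_countable_topology} mfd" and E :: "('m, 'v::real_vector) vbundle" and r +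
  fixes br :: "('m, 'v) bracket"
  assumes loday: "loday_bracket (sections M E) br"
begin

lemma br_left: "Y \<in> Sec \<Longrightarrow> lin_on Sec Sec (\<lambda>X. br X Y)"
  and br_right: "X \<in> Sec \<Longrightarrow> lin_on Sec Sec (br X)"
  using loday by (auto simp: loday_bracket_def bilin_on_def)

lemma br_mem: "X \<in> Sec \<Longrightarrow> Y \<in> Sec \<Longrightarrow> br X Y \<in> Sec"
  using lin_on_mem[OF br_right] .

lemma br_add_left: "X \<in> Sec \<Longrightarrow> X' \<in> Sec \<Longrightarrow> Y \<in> Sec \<Longrightarrow> br (X + X') Y = br X Y + br X' Y"
  using lin_on_add[OF br_left] .

lemma br_add_right: "X \<in> Sec \<Longrightarrow> Y \<in> Sec \<Longrightarrow> Y' \<in> Sec \<Longrightarrow> br X (Y + Y') = br X Y + br X Y'"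
  using lin_on_add[OF br_right] .

lemma br_scaleR_left: "X \<in> Sec \<Longrightarrow> Y \<in> Sec \<Longrightarrow> br (c *\<^sub>R X) Y = c *\<^sub>R br X Y"
  using lin_on_scaleR[OF br_left] .

lemma br_scaleR_right: "X \<in> Sec \<Longrightarrow> Y \<in> Sec \<Longrightarrow> br X (c *\<^sub>R Y) = c *\<^sub>R br X Y"
  using lin_on_scaleR[OF br_right] .

lemma br_jacobi:
  "X \<in> Sec \<Longrightarrow> Y \<in> Sec \<Longrightarrow> Z \<in> Sec \<Longrightarrow> br X (br Y Z) = br (br X Y) Z + br Y (br X Z)"
  using loday unfolding loday_bracket_def by blast

lemma br_rank_zero: "r = 0 \<Longrightarrow> X \<in> Sec \<Longrightarrow> Y \<in> Sec \<Longrightarrow> br X Y = 0"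
  by (rule rank_zero_section[OF _ br_mem])


subsection \<open>From anchors to Loday algebroids\<close>

context
  fixes \<rho> \<alpha>
  assumes anchor: "anchor_conditions M E br \<rho> \<alpha>"
begin

lemma rho_lin: "lin_on (fibre E p) (tangent_space M p) (\<rho> p)"
  and alpha_lin: "lin_on (fibre E p) (TE p) (\<alpha> p)"
  using anchor unfolding anchor_conditions_def vb_morphism_def
  by (simp_all add: tangent_bundle_def tensor_bundle_def endo_bundle_def)

lemma anchor_right:
  assumes "X \<in> Sec" "Y \<in> Sec" "f \<in> \<A>"
  shows "br X (f \<cdot>\<^sub>s Y) = f \<cdot>\<^sub>s br X Y + (\<lambda>p. \<rho> p (X p) f) \<cdot>\<^sub>s Y"
  using anchor assms unfolding anchor_conditions_def by blast

lemma anchor_left: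
  assumes "X \<in> Sec" "Y \<in> Sec" "f \<in> \<A>"
  shows "br (f \<cdot>\<^sub>s X) Y = f \<cdot>\<^sub>s br X Y - (\<lambda>p. \<rho> p (Y p) f) \<cdot>\<^sub>s X +
    (\<lambda>p. act p (\<alpha> p (Y p)) (differential M f p) (X p))"
  using anchor assms unfolding anchor_conditions_def by blast

text \<open>Smoothness is read off from the bracket: multiplication by \<rho>(X)(f) is the
  difference of [X, f Y] and f [X, Y], hence preserves sections.\<close>

lemma rho_smooth:
  assumes "r > 0" "X \<in> Sec" "f \<in> \<A>"
  shows "(\<lambda>p. \<rho> p (X p) f) \<in> \<A>"
proof (rule smooth_multiplier[OF assms(1)])
  fix Y assume Y: "Y \<in> Sec"
  have "(\<lambda>p. \<rho> p (X p) f) \<cdot>\<^sub>s Y = br X (f \<cdot>\<^sub>s Y) - f \<cdot>\<^sub>s br X Y"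
    unfolding anchor_right[OF assms(2) Y assms(3)] by simp
  then show "(\<lambda>p. \<rho> p (X p) f) \<cdot>\<^sub>s Y \<in> Sec"
    using subspace_diff[OF subspace_sections br_mem[OF assms(2) sections_fmult[OF assms(3) Y]]
        sections_fmult[OF assms(3) br_mem[OF assms(2) Y]]] by simp
qed

lemma anchor_imp_bidiff: "bidiff_order_le_1 M E br"
  unfolding bidiff_order_le_1_def
proof (intro ballI allI)
  fix f g i j X Y
  assume f: "f \<in> \<A>" and g: "g \<in> \<A>" and X: "X \<in> Sec" and Y: "Y \<in> Sec"
  \<comment> \<open>After one commutator the bracket itself has cancelled. What remains at
    \<open>p\<close> is linear in each of the values of the two sections there, so any further
    commutator with a function vanishes.\<close>
  have d2: "delta True g br X Y = (\<lambda>p. \<rho> p (X p) g *\<^sub>R Y p)" if "X \<in> Sec" "Y \<in> Sec" for X Y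
    using anchor_right[OF that g] by (simp add: delta_def fmult_def)
  have d1: "delta False g br X Y = (\<lambda>p. act p (\<alpha> p (Y p)) (differential M g p) (X p) - \<rho> p (Y p) g *\<^sub>R X p)"
    if "X \<in> Sec" "Y \<in> Sec" for X Y
    using anchor_left[OF that g] by (simp add: delta_def fmult_def fun_eq_iff)
  note fX = sections_fmult[OF f X] and fY = sections_fmult[OF f Y]
  note Xf = section_in_fibre[OF X] and Yf = section_in_fibre[OF Y]
  have rho: "\<rho> p (c *\<^sub>R x) g = c * \<rho> p x g" if "x \<in> fibre E p" for p c x
    using lin_on_scaleR[OF rho_lin that, of c] by (simp add: scaleR_fun_def)
  have act_x: "act p (\<alpha> p y) (differential M g p) (c *\<^sub>R x) = c *\<^sub>R act p (\<alpha> p y) (differential M g p) x"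
    if "x \<in> fibre E p" "y \<in> fibre E p" for p c x y
    using lin_on_scaleR[OF act_lin_right[OF differential_in_dual_space lin_on_mem[OF alpha_lin that(2)]]
        that(1)] .
  have act_y: "act p (\<alpha> p (c *\<^sub>R y)) (differential M g p) x = c *\<^sub>R act p (\<alpha> p y) (differential M g p) x"
    if "x \<in> fibre E p" "y \<in> fibre E p" for p c x y
    using lin_on_scaleR[OF alpha_lin that(2), of c]
      lin_on_scaleR[OF act_lin_left[OF differential_in_dual_space that(1)] lin_on_mem[OF alpha_lin
          that(2)]] by simp
  show "delta i f (delta j g br) X Y = 0"
  proof (cases j)
    case True
    then show ?thesis
      unfolding delta_def[of i f] using X Y fX fY Xf Yf
      by (cases i) (simp_all add: d2 fun_eq_iff fmult_def rho mult.commute)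
  next
    case False
    then show ?thesis
      unfolding delta_def[of i f] using X Y fX fY Xf Yf
      by (cases i) (simp_all add: d1 fun_eq_iff fmult_def rho act_x act_y scaleR_diff_right mult.commute)
  qed
qed

lemma anchor_imp_derivative_endo:
  assumes X: "X \<in> Sec" shows "derivative_endo M E (br X)"
  unfolding derivative_endo_def
proof (intro conjI ballI)
  fix f assume f: "f \<in> \<A>"
  show "\<exists>g\<in>\<A>. \<forall>Y\<in>Sec. br X (f \<cdot>\<^sub>s Y) - f \<cdot>\<^sub>s br X Y = g \<cdot>\<^sub>s Y"
  proof (cases "r = 0")
    \<comment> \<open>\<open>rho_smooth\<close> requires positive rank. Here all sections are 0, so
      the multiplier 0 serves.\<close>
    case True
    have "br X (f \<cdot>\<^sub>s Y) - f \<cdot>\<^sub>s br X Y = 0 \<cdot>\<^sub>s Y" if "Y \<in> Sec" for Y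
      using br_rank_zero[OF True X] sections_fmult[OF f that] that
          by (simp add: fmult_def zero_fun_def fun_eq_iff)
    then show ?thesis using smooth_funs_zero by blast
  next
    case False
    have "br X (f \<cdot>\<^sub>s Y) - f \<cdot>\<^sub>s br X Y = (\<lambda>p. \<rho> p (X p) f) \<cdot>\<^sub>s Y" if "Y \<in> Sec" for Y
      unfolding anchor_right[OF X that f] by simp
    then show ?thesis using rho_smooth[OF _ X f] False by blast
  qed
qed (rule br_right[OF X])

lemma anchor_imp_loday_algebroid: "loday_algebroid M E br"
  using loday anchor_imp_bidiff anchor_imp_derivative_endo by (simp add: loday_algebroid_def)

lemma rho_at:
  assumes X: "X \<in> Sec" and Y: "Y \<in> Sec" and f: "f \<in> \<A>"
  shows "\<rho> p (X p) f *\<^sub>R Y p = br X (f \<cdot>\<^sub>s Y) p - f p *\<^sub>R br X Y p"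
  unfolding anchor_right[OF assms] by (simp add: fmult_def)

lemma alpha_at:
  assumes X: "X \<in> Sec" and Y: "Y \<in> Sec" and f: "f \<in> \<A>"
  shows "act p (\<alpha> p (Y p)) (differential M f p) (X p) =
    br (f \<cdot>\<^sub>s X) Y p - f p *\<^sub>R br X Y p + \<rho> p (Y p) f *\<^sub>R X p"
  unfolding anchor_left[OF assms] by (simp add: fmult_def)

text \<open>In the Jacobi identity for X, Y and f Z the second-order terms form the Jacobi identity
  for Z times f, and the mixed terms \<rho>(X)(f) [Y, Z] and \<rho>(Y)(f) [X, Z] occur on both
  sides. What is left is a multiple of Z, chosen nonzero at \<open>p\<close>.\<close>

lemma rho_hom:
  assumes X: "X \<in> Sec" and Y: "Y \<in> Sec"
  shows "(\<lambda>p. \<rho> p (br X Y p)) = lie_bracket_vf (\<lambda>p. \<rho> p (X p)) (\<lambda>p. \<rho> p (Y p))"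
proof (intro ext)
  fix p f
  have T: "\<rho> p (Z p) \<in> tangent_space M p" if "Z \<in> Sec" for Z p
    using lin_on_mem[OF rho_lin section_in_fibre[OF that]] .
  show "\<rho> p (br X Y p) f = lie_bracket_vf (\<lambda>p. \<rho> p (X p)) (\<lambda>p. \<rho> p (Y p)) p f"
  proof (cases "f \<in> \<A>")
    case False
    \<comment> \<open>For a function that is not smooth, both inner derivatives are the zero
      function, which every tangent vector kills; both sides are then 0.\<close>
    then have "\<rho> q (Z q) f = 0" if "Z \<in> Sec" for Z q using tangent_outside[OF T[OF that]] by blast
    then show ?thesis using tangent_zero[OF T[OF X]] tangent_zero[OF T[OF Y]] X Y br_mem[OF X Y]
      by (simp add: lie_bracket_vf_def zero_fun_def)
  next
    case f: True
    show ?thesis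
    proof (cases "r = 0")
      case True
      then have "X = 0" "Y = 0" "br X Y = 0" using rank_zero_section[OF True] X Y br_mem[OF X Y] by auto
      then show ?thesis using lin_on_zero[OF rho_lin subspace_fibre] by (simp add: lie_bracket_vf_def)
    next
      case False
      then have r: "r > 0" by simp
      define a where "a = (\<lambda>q. \<rho> q (Y q) f)"
      define b where "b = (\<lambda>q. \<rho> q (X q) f)"
      \<comment> \<open>\<open>a\<close> and \<open>b\<close> are differentiated once more and
        multiply sections inside brackets, so they must be smooth functions.\<close>
      have a: "a \<in> \<A>" and b: "b \<in> \<A>"
        unfolding a_def b_def using rho_smooth[OF r _ f] X Y by auto
      obtain Z where Z: "Z \<in> Sec" "Z p \<noteq> 0" using nonvanishing_section[OF r] .
      have YZ: "br Y (f \<cdot>\<^sub>s Z) = f \<cdot>\<^sub>s br Y Z + a \<cdot>\<^sub>s Z" using anchor_right[OF Y Z(1) f] by (simp add: a_def)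
      have XZ: "br X (f \<cdot>\<^sub>s Z) = f \<cdot>\<^sub>s br X Z + b \<cdot>\<^sub>s Z" using anchor_right[OF X Z(1) f] by (simp add: b_def)
      note mem = br_mem[OF X Z(1)] br_mem[OF Y Z(1)] br_mem[OF X Y]
      have 1: "br X (br Y (f \<cdot>\<^sub>s Z)) p = f p *\<^sub>R br X (br Y Z) p + b p *\<^sub>R br Y Z p + a p *\<^sub>R br X Z p +
          \<rho> p (X p) a *\<^sub>R Z p"
        unfolding YZ br_add_right[OF X sections_fmult[OF f mem(2)] sections_fmult[OF a Z(1)]]
          anchor_right[OF X mem(2) f] anchor_right[OF X Z(1) a] by (simp add: fmult_def b_def)
      have 2: "br Y (br X (f \<cdot>\<^sub>s Z)) p = f p *\<^sub>R br Y (br X Z) p + a p *\<^sub>R br X Z p + b p *\<^sub>R br Y Z p +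
          \<rho> p (Y p) b *\<^sub>R Z p"
        unfolding XZ br_add_right[OF Y sections_fmult[OF f mem(1)] sections_fmult[OF b Z(1)]]
          anchor_right[OF Y mem(1) f] anchor_right[OF Y Z(1) b] by (simp add: fmult_def a_def)
      have 3: "br (br X Y) (f \<cdot>\<^sub>s Z) p = f p *\<^sub>R br (br X Y) Z p + \<rho> p (br X Y p) f *\<^sub>R Z p"
        unfolding anchor_right[OF mem(3) Z(1) f] by (simp add: fmult_def)
      have J: "br X (br Y Z) p = br (br X Y) Z p + br Y (br X Z) p"
        using br_jacobi[OF X Y Z(1)] by simp
      have "br X (br Y (f \<cdot>\<^sub>s Z)) p = br (br X Y) (f \<cdot>\<^sub>s Z) p + br Y (br X (f \<cdot>\<^sub>s Z)) p"
        using br_jacobi[OF X Y sections_fmult[OF f Z(1)]] by simp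
      then have "\<rho> p (X p) a *\<^sub>R Z p = \<rho> p (br X Y p) f *\<^sub>R Z p + \<rho> p (Y p) b *\<^sub>R Z p"
        unfolding 1 2 3 J by (simp add: scaleR_add_right)
      then have "\<rho> p (X p) a = \<rho> p (br X Y p) f + \<rho> p (Y p) b"
        using Z(2) by (simp flip: scaleR_add_left)
      then show ?thesis by (simp add: lie_bracket_vf_def a_def b_def)
    qed
  qed
qed

end

text \<open>A section nonzero at \<open>p\<close> recovers \<rho>(x)(f) from the bracket. Once
  \<rho> is known, the left Leibniz rule gives the action of \<alpha>(x) on all differentials and
  section values, which determines the tensor.\<close>

lemma anchors_unique:
  assumes A: "anchor_conditions M E br \<rho> \<alpha>" and A': "anchor_conditions M E br \<rho>' \<alpha>'"
    and x: "x \<in> fibre E p"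
  shows "\<rho> p x = \<rho>' p x" "\<alpha> p x = \<alpha>' p x"
proof -
  note T = lin_on_mem[OF rho_lin[OF A] x] and T' = lin_on_mem[OF rho_lin[OF A'] x]
  note TE = lin_on_mem[OF alpha_lin[OF A] x] and TE' = lin_on_mem[OF alpha_lin[OF A'] x]
  obtain X where X: "X \<in> Sec" "X p = x" using section_through[OF x] .
  have rho: "\<rho> p x = \<rho>' p x"
  proof (cases "r = 0")
    \<comment> \<open>No nonzero section exists here, but the fibre is trivial and linear maps agree
      at 0.\<close>
    case True
    then have "x = 0" using rank_zero_fibre x by blast
    then show ?thesis
      using lin_on_zero[OF rho_lin[OF A] subspace_fibre] lin_on_zero[OF rho_lin[OF A'] subspace_fibre] by simp
  next
    case False
    show ?thesis
    proof
      fix f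
      obtain Y where Y: "Y \<in> Sec" "Y p \<noteq> 0" using nonvanishing_section False by blast
      show "\<rho> p x f = \<rho>' p x f"
      proof (cases "f \<in> \<A>")
        case True
        have "\<rho> p x f *\<^sub>R Y p = \<rho>' p x f *\<^sub>R Y p"
          using rho_at[OF A X(1) Y(1) True, of p] rho_at[OF A' X(1) Y(1) True, of p] X(2) by simp
        then show ?thesis using Y(2) by simp
      next
        case False
        then show ?thesis using tangent_outside[OF T] tangent_outside[OF T'] by simp
      qed
    qed
  qed
  then show "\<rho> p x = \<rho>' p x" .
  show "\<alpha> p x = \<alpha>' p x"
  proof (rule TE_eqI[OF TE TE'])
    show "act p (\<alpha> p x) (differential M f p) (Z p) = act p (\<alpha>' p x) (differential M f p) (Z p)"
      if "f \<in> \<A>" "Z \<in> Sec" for f Z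
      using alpha_at[OF A that(2) X(1) that(1), of p] alpha_at[OF A' that(2) X(1) that(1), of p] X(2)
          rho by simp
  qed
qed

end


subsection \<open>From Loday algebroids to anchors\<close>

lemma fmult_plus_fun: "(f + g) \<cdot>\<^sub>s X = f \<cdot>\<^sub>s X + g \<cdot>\<^sub>s X"
  by (simp add: fmult_def fun_eq_iff scaleR_add_left)

lemma fmult_scaleR_fun: "(c *\<^sub>R f) \<cdot>\<^sub>s X = c *\<^sub>R (f \<cdot>\<^sub>s X)"
  by (simp add: fmult_def fun_eq_iff scaleR_fun_def)

lemma fmult_times_fun: "(f * g) \<cdot>\<^sub>s X = f \<cdot>\<^sub>s (g \<cdot>\<^sub>s X)"
  by (simp add: fmult_def fun_eq_iff)

lemma fmult_plus_section: "f \<cdot>\<^sub>s (X + Y) = f \<cdot>\<^sub>s X + f \<cdot>\<^sub>s Y"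
  by (simp add: fmult_def fun_eq_iff scaleR_add_right)

locale loday_algebroid_vb = loday_vb M E r br
  for M :: "'m::{t2_space,second_countable_topology} mfd" and E :: "('m, 'v::real_vector) vbundle" and r
    and br :: "('m, 'v) bracket" +
  assumes bidiff: "bidiff_order_le_1 M E br"
    and endo: "\<And>X. X \<in> sections M E \<Longrightarrow> derivative_endo M E (br X)"
    and rank_pos: "r > 0"
begin

text \<open>Positive rank makes the multiplier \<open>hat X f\<close> unique; in rank zero any function would do.\<close>

definition hat :: "('m \<Rightarrow> 'v) \<Rightarrow> ('m \<Rightarrow> real) \<Rightarrow> 'm \<Rightarrow> real"
  where "hat X f = (SOME g. g \<in> \<A> \<and> (\<forall>Y\<in>Sec. br X (f \<cdot>\<^sub>s Y) - f \<cdot>\<^sub>s br X Y = g \<cdot>\<^sub>s Y))"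

lemma hat_props:
  assumes "X \<in> Sec" "f \<in> \<A>"
  shows hat_smooth: "hat X f \<in> \<A>"
    and hat_eq: "Y \<in> Sec \<Longrightarrow> br X (f \<cdot>\<^sub>s Y) - f \<cdot>\<^sub>s br X Y = hat X f \<cdot>\<^sub>s Y"
proof -
  have "\<exists>g. g \<in> \<A> \<and> (\<forall>Y\<in>Sec. br X (f \<cdot>\<^sub>s Y) - f \<cdot>\<^sub>s br X Y = g \<cdot>\<^sub>s Y)"
    using endo[OF assms(1)] assms(2) unfolding derivative_endo_def by blast
  from someI_ex[OF this] show "hat X f \<in> \<A>"
    "Y \<in> Sec \<Longrightarrow> br X (f \<cdot>\<^sub>s Y) - f \<cdot>\<^sub>s br X Y = hat X f \<cdot>\<^sub>s Y" unfolding hat_def by blast+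
qed

lemma hat_at:
  assumes "X \<in> Sec" "f \<in> \<A>" "Y \<in> Sec"
  shows "br X (f \<cdot>\<^sub>s Y) p = f p *\<^sub>R br X Y p + hat X f p *\<^sub>R Y p"
  using fun_cong[OF hat_eq[OF assms], of p] by (simp add: fmult_def diff_eq_eq add.commute)

lemma br_fmult_right:
  assumes "X \<in> Sec" "f \<in> \<A>" "Y \<in> Sec"
  shows "br X (f \<cdot>\<^sub>s Y) = f \<cdot>\<^sub>s br X Y + hat X f \<cdot>\<^sub>s Y"
  using hat_at[OF assms] by (simp add: fun_eq_iff fmult_def)

text \<open>The multiplier is unique in positive rank, so each algebraic law for \<open>hat\<close>
  is proved by showing that the proposed expression is a multiplier too.\<close>

lemma hat_eqI:
  assumes "X \<in> Sec" "f \<in> \<A>"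
    and "\<And>Y p. Y \<in> Sec \<Longrightarrow> br X (f \<cdot>\<^sub>s Y) p = f p *\<^sub>R br X Y p + g p *\<^sub>R Y p"
  shows "hat X f = g"
proof (rule multiplier_unique[OF rank_pos])
  show "hat X f \<cdot>\<^sub>s Y = g \<cdot>\<^sub>s Y" if "Y \<in> Sec" for Y
    using hat_at[OF assms(1,2) that] assms(3)[OF that] by (simp add: fun_eq_iff fmult_def)
qed

lemma hat_add_section:
  assumes X: "X \<in> Sec" and X': "X' \<in> Sec" and f: "f \<in> \<A>"
  shows "hat (X + X') f = hat X f + hat X' f"
proof (rule hat_eqI[OF sections_add[OF X X'] f])
  show "br (X + X') (f \<cdot>\<^sub>s Y) p = f p *\<^sub>R br (X + X') Y p + (hat X f + hat X' f) p *\<^sub>R Y p" if Y: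
      "Y \<in> Sec" for Y p
    using hat_at[OF X f Y, of p] hat_at[OF X' f Y, of p]
    unfolding br_add_left[OF X X' Y] br_add_left[OF X X' sections_fmult[OF f Y]]
    by (simp add: algebra_simps)
qed

lemma delta_delta:
  assumes "f \<in> \<A>" "g \<in> \<A>" "X \<in> Sec" "Y \<in> Sec"
  shows "delta i f (delta j g br) X Y = 0"
  using bidiff assms unfolding bidiff_order_le_1_def by blast

text \<open>After \<delta>_2(f) the bracket is multiplication by \<open>hat X f\<close>; that
  \<delta>_1(h) annihilates it is exactly linearity over functions in X.\<close>

lemma hat_fmult_section:
  assumes X: "X \<in> Sec" and h: "h \<in> \<A>" and f: "f \<in> \<A>"
  shows "hat (h \<cdot>\<^sub>s X) f = h \<cdot>\<^sub>s hat X f"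
proof (rule hat_eqI[OF sections_fmult[OF h X] f])
  fix Y p assume Y: "Y \<in> Sec"
  have "delta False h (delta True f br) X Y p = 0"
    using delta_delta[OF h f X Y] by simp
  then show "br (h \<cdot>\<^sub>s X) (f \<cdot>\<^sub>s Y) p = f p *\<^sub>R br (h \<cdot>\<^sub>s X) Y p + (h \<cdot>\<^sub>s hat X f) p *\<^sub>R Y p"
    using hat_at[OF X f Y, of p] by (simp add: delta_def fmult_def algebra_simps)
qed

lemma hat_cong:
  assumes "X \<in> Sec" "X' \<in> Sec" "f \<in> \<A>" "X p = X' p"
  shows "hat X f p = hat X' f p"
  using tensorial[of "\<lambda>X. hat X f", OF hat_add_section[OF _ _ assms(3)] hat_fmult_section[OF _ _
      assms(3)] assms(1,2,4)] .

lemma hat_add_fun: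
  assumes X: "X \<in> Sec" and f: "f \<in> \<A>" and g: "g \<in> \<A>"
  shows "hat X (f + g) = hat X f + hat X g"
proof (rule hat_eqI[OF X smooth_funs_add[OF f g]])
  show "br X ((f + g) \<cdot>\<^sub>s Y) p = (f + g) p *\<^sub>R br X Y p + (hat X f + hat X g) p *\<^sub>R Y p" if Y: "Y \<in> Sec" for Y p
    using hat_at[OF X f Y, of p] hat_at[OF X g Y, of p]
    unfolding fmult_plus_fun br_add_right[OF X sections_fmult[OF f Y] sections_fmult[OF g Y]]
    by (simp add: algebra_simps)
qed

lemma hat_scaleR_fun:
  assumes X: "X \<in> Sec" and f: "f \<in> \<A>"
  shows "hat X (c *\<^sub>R f) = c *\<^sub>R hat X f"
proof (rule hat_eqI[OF X smooth_funs_scaleR[OF f]])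
  show "br X ((c *\<^sub>R f) \<cdot>\<^sub>s Y) p = (c *\<^sub>R f) p *\<^sub>R br X Y p + (c *\<^sub>R hat X f) p *\<^sub>R Y p" if Y: "Y \<in> Sec" for Y p
    using hat_at[OF X f Y, of p]
    unfolding fmult_scaleR_fun br_scaleR_right[OF X sections_fmult[OF f Y]]
    by (simp add: algebra_simps scaleR_fun_def)
qed

text \<open>Apply the Leibniz rule to f (g Y), first for \<open>f\<close> and then for
  \<open>g\<close>.\<close>

lemma hat_mult_fun:
  assumes X: "X \<in> Sec" and f: "f \<in> \<A>" and g: "g \<in> \<A>"
  shows "hat X (f * g) = f * hat X g + g * hat X f"
proof (rule hat_eqI[OF X smooth_funs_mult[OF f g]])
  show "br X ((f * g) \<cdot>\<^sub>s Y) p = (f * g) p *\<^sub>R br X Y p + (f * hat X g + g * hat X f) p *\<^sub>R Y p" if Y: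
      "Y \<in> Sec" for Y p
    using hat_at[OF X g Y, of p] hat_at[OF X f sections_fmult[OF g Y], of p]
    unfolding fmult_times_fun
    by (simp add: algebra_simps fmult_def)
qed

text \<open>Some section through \<open>x\<close> is used, and \<open>hat_cong\<close> makes the
  choice immaterial. The value 0 off the smooth functions is what \<open>dual_space\<close>
  prescribes.\<close>

definition rho :: "'m \<Rightarrow> 'v \<Rightarrow> 'm tvec"
  where "rho p x f = (if f \<in> \<A> then hat (SOME X. X \<in> Sec \<and> X p = x) f p else 0)"

lemma rho_eq:
  assumes X: "X \<in> Sec" and f: "f \<in> \<A>"
  shows "rho p (X p) f = hat X f p"
proof -
  have "\<exists>Y. Y \<in> Sec \<and> Y p = X p" using X by blast
  from someI_ex[OF this] show ?thesis unfolding rho_def using hat_cong[OF _ X f] f by simp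
qed

lemma rho_tangent:
  assumes X: "X \<in> Sec" shows "rho p (X p) \<in> tangent_space M p"
  unfolding tangent_space_def dual_space_def lin_on_def
  by (auto simp: rho_eq[OF X] smooth_funs_add smooth_funs_scaleR smooth_funs_mult hat_add_fun[OF X]
      hat_scaleR_fun[OF X] hat_mult_fun[OF X] scaleR_fun_def[of _ "hat X _"]) (simp add: rho_def)

lemma rho_linear: "lin_on (fibre E p) (tangent_space M p) (rho p)"
  unfolding lin_on_def
proof (intro conjI ballI allI)
  fix x assume x: "x \<in> fibre E p"
  obtain X where X: "X \<in> Sec" "X p = x" using section_through[OF x] .
  show "rho p x \<in> tangent_space M p" using rho_tangent[OF X(1), of p] X(2) by simp
  show "rho p (c *\<^sub>R x) = c *\<^sub>R rho p x" for c
  proof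
    fix f
    have e: "(\<lambda>_. c) \<cdot>\<^sub>s X = c *\<^sub>R X" by (simp add: fmult_def scaleR_fun_def)
    show "rho p (c *\<^sub>R x) f = (c *\<^sub>R rho p x) f"
    proof (cases "f \<in> \<A>")
      case True
      then show ?thesis
        using rho_eq[OF sections_scaleR[OF X(1), of c] True, of p] rho_eq[OF X(1) True, of p] X(2)
          hat_fmult_section[OF X(1) smooth_funs_const[of c] True]
        unfolding e by (simp add: scaleR_fun_def fmult_def)
    qed (simp add: rho_def scaleR_fun_def)
  qed
  fix y assume y: "y \<in> fibre E p"
  obtain Y where Y: "Y \<in> Sec" "Y p = y" using section_through[OF y] .
  show "rho p (x + y) = rho p x + rho p y"
  proof
    fix f
    show "rho p (x + y) f = (rho p x + rho p y) f"
    proof (cases "f \<in> \<A>")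
      case True
      then show ?thesis
        using rho_eq[OF sections_add[OF X(1) Y(1)] True, of p] rho_eq[OF X(1) True, of p]
          rho_eq[OF Y(1) True, of p] X(2) Y(2) hat_add_section[OF X(1) Y(1) True] by simp
    qed (simp add: rho_def)
  qed
qed

text \<open>A frame section agrees near each point with a global section X, and there its image
  evaluated on \<open>f\<close> is \<open>hat X f\<close>, a smooth function.\<close>

lemma rho_morphism: "vb_morphism M E (tangent_bundle M) rho"
  unfolding vb_morphism_def
proof (intro conjI allI)
  show "lin_on (fibre E p) (fibre (tangent_bundle M) p) (rho p)" for p
    using rho_linear by (simp add: tangent_bundle_def)
  have "smooth_section_on M (tangent_bundle M) U (\<lambda>p. rho p (e p))"
    if fr: "(U, es) \<in> frames E" and e: "e \<in> set es" for U es e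
  proof (rule smooth_vector_fieldI[OF frame_open[OF fr]])
    note es = frame_smooth[OF fr e]
    show "rho q (e q) \<in> tangent_space M q" if "q \<in> U" for q
      using es that lin_on_mem[OF rho_linear] by (simp add: smooth_section_on_def)
    fix f assume f: "f \<in> \<A>"
    show "smooth_fun_on M U (\<lambda>q. rho q (e q) f)"
    proof (rule smooth_fun_on_local[OF frame_open[OF fr]])
      fix p assume "p \<in> U"
      then obtain X W' where X: "X \<in> Sec" "open W'" "p \<in> W'" "W' \<subseteq> U" "\<And>q. q \<in> W' \<Longrightarrow> X q = e q"
        using local_section_extension[OF frame_open[OF fr] _ es] by blast
      have "smooth_fun_on M W' (\<lambda>q. rho q (e q) f)"
      proof (rule smooth_fun_on_cong[OF X(2) _ smooth_funs_onD[OF hat_smooth[OF X(1) f]]])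
        show "hat X f q = rho q (e q) f" if "q \<in> W'" for q
          using rho_eq[OF X(1) f, of q] X(5)[OF that] by simp
      qed
      then show "\<exists>W'. open W' \<and> p \<in> W' \<and> smooth_fun_on M W' (\<lambda>q. rho q (e q) f)"
        using X by blast
    qed
  qed
  then show "\<forall>(U, es)\<in>frames E. \<forall>e\<in>set es. smooth_section_on M (tangent_bundle M) U (\<lambda>p. rho p (e p))"
    by blast
qed


text \<open>The left Leibniz rule solved for the term with \<alpha>. The added \<open>hat\<close>
  term is itself bilinear over functions and a derivation in \<open>f\<close>, so these properties
  pass from the commutator to the sum.\<close>

definition symbol :: "('m \<Rightarrow> real) \<Rightarrow> ('m \<Rightarrow> 'v) \<Rightarrow> ('m \<Rightarrow> 'v) \<Rightarrow> 'm \<Rightarrow> 'v"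
  where "symbol f X Y = br (f \<cdot>\<^sub>s X) Y - f \<cdot>\<^sub>s br X Y + hat Y f \<cdot>\<^sub>s X"

lemma symbol_mem:
  assumes f: "f \<in> \<A>" and X: "X \<in> Sec" and Y: "Y \<in> Sec"
  shows "symbol f X Y \<in> Sec"
  unfolding symbol_def
  by (intro sections_add subspace_diff[OF subspace_sections] br_mem sections_fmult hat_smooth assms)

lemma symbol_add_1:
  assumes f: "f \<in> \<A>" and X: "X \<in> Sec" and X': "X' \<in> Sec" and Y: "Y \<in> Sec"
  shows "symbol f (X + X') Y = symbol f X Y + symbol f X' Y"
  unfolding symbol_def fmult_plus_section br_add_left[OF X X' Y]
    br_add_left[OF sections_fmult[OF f X] sections_fmult[OF f X'] Y]
  by (simp add: fmult_plus_section)

lemma symbol_add_2: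
  assumes f: "f \<in> \<A>" and X: "X \<in> Sec" and Y: "Y \<in> Sec" and Y': "Y' \<in> Sec"
  shows "symbol f X (Y + Y') = symbol f X Y + symbol f X Y'"
  unfolding symbol_def br_add_right[OF X Y Y'] br_add_right[OF sections_fmult[OF f X] Y Y']
    hat_add_section[OF Y Y' f]
  by (simp add: fmult_plus_section fmult_plus_fun)

text \<open>The order condition with both commutators in the first slot gives this for the bracket
  part; the \<open>hat\<close> term is visibly linear in X.\<close>

lemma symbol_fmult_1:
  assumes f: "f \<in> \<A>" and h: "h \<in> \<A>" and X: "X \<in> Sec" and Y: "Y \<in> Sec"
  shows "symbol f (h \<cdot>\<^sub>s X) Y = h \<cdot>\<^sub>s symbol f X Y"
proof
  fix p
  have "delta False h (delta False f br) X Y p = 0" using delta_delta[OF h f X Y] by simp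
  then show "symbol f (h \<cdot>\<^sub>s X) Y p = (h \<cdot>\<^sub>s symbol f X Y) p"
    by (simp add: symbol_def delta_def fmult_def algebra_simps)
qed

text \<open>The order condition with one commutator in each slot handles the bracket part, and
  \<open>hat_fmult_section\<close> the \<open>hat\<close> term.\<close>

lemma symbol_fmult_2:
  assumes f: "f \<in> \<A>" and h: "h \<in> \<A>" and X: "X \<in> Sec" and Y: "Y \<in> Sec"
  shows "symbol f X (h \<cdot>\<^sub>s Y) = h \<cdot>\<^sub>s symbol f X Y"
proof
  fix p
  have "delta True h (delta False f br) X Y p = 0" using delta_delta[OF h f X Y] by simp
  then show "symbol f X (h \<cdot>\<^sub>s Y) p = (h \<cdot>\<^sub>s symbol f X Y) p"
    unfolding symbol_def hat_fmult_section[OF Y h f]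
    by (simp add: delta_def fmult_def algebra_simps)
qed

lemma symbol_cong:
  assumes f: "f \<in> \<A>" and X: "X \<in> Sec" "X' \<in> Sec" and Y: "Y \<in> Sec" "Y' \<in> Sec"
    and "X p = X' p" "Y p = Y' p"
  shows "symbol f X Y p = symbol f X' Y' p"
proof -
  have "symbol f X Y p = symbol f X' Y p"
    by (rule tensorial[of "\<lambda>X. symbol f X Y"])
       (use assms in \<open>auto intro: symbol_add_1 symbol_fmult_1\<close>)
  also have "\<dots> = symbol f X' Y' p"
    by (rule tensorial[of "\<lambda>Y. symbol f X' Y"])
       (use assms in \<open>auto intro: symbol_add_2 symbol_fmult_2\<close>)
  finally show ?thesis .
qed

lemma symbol_scaleR_1:
  assumes "f \<in> \<A>" "X \<in> Sec" "Y \<in> Sec" shows "symbol f (c *\<^sub>R X) Y = c *\<^sub>R symbol f X Y"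
  using symbol_fmult_1[OF assms(1) smooth_funs_const[of c] assms(2,3)] by (simp add: fmult_def scaleR_fun_def)

lemma symbol_scaleR_2:
  assumes "f \<in> \<A>" "X \<in> Sec" "Y \<in> Sec" shows "symbol f X (c *\<^sub>R Y) = c *\<^sub>R symbol f X Y"
  using symbol_fmult_2[OF assms(1) smooth_funs_const[of c] assms(2,3)] by (simp add: fmult_def scaleR_fun_def)

lemma symbol_add_fun:
  assumes f: "f \<in> \<A>" and g: "g \<in> \<A>" and X: "X \<in> Sec" and Y: "Y \<in> Sec"
  shows "symbol (f + g) X Y = symbol f X Y + symbol g X Y"
  unfolding symbol_def fmult_plus_fun hat_add_fun[OF Y f g]
    br_add_left[OF sections_fmult[OF f X] sections_fmult[OF g X] Y] by (simp add: fmult_plus_fun)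

lemma symbol_scaleR_fun:
  assumes f: "f \<in> \<A>" and X: "X \<in> Sec" and Y: "Y \<in> Sec"
  shows "symbol (c *\<^sub>R f) X Y = c *\<^sub>R symbol f X Y"
  unfolding symbol_def fmult_scaleR_fun hat_scaleR_fun[OF Y f]
    br_scaleR_left[OF sections_fmult[OF f X] Y]
        by (simp add: fmult_scaleR_fun scaleR_add_right scaleR_diff_right)

text \<open>Read (f g) X as f (g X): the symbol of \<open>f\<close> at g X appears, and linearity in
  the first section argument pulls \<open>g\<close> out.\<close>

lemma symbol_mult_fun:
  assumes f: "f \<in> \<A>" and g: "g \<in> \<A>" and X: "X \<in> Sec" and Y: "Y \<in> Sec"
  shows "symbol (f * g) X Y p = f p *\<^sub>R symbol g X Y p + g p *\<^sub>R symbol f X Y p"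
proof -
  have "symbol f (g \<cdot>\<^sub>s X) Y p = g p *\<^sub>R symbol f X Y p"
    using symbol_fmult_1[OF f g X Y] by (simp add: fmult_def)
  then show ?thesis
    unfolding symbol_def fmult_times_fun hat_mult_fun[OF Y f g]
    by (simp add: fmult_def algebra_simps)
qed

text \<open>The symbol is a derivation in \<open>f\<close> with values in the fibre. Each of its
  frame coefficients is a real-valued derivation, to which the expansion of tangent vectors
  applies.\<close>

lemma symbol_tangent:
  assumes fr: "(U, es) \<in> frames E" "p \<in> U" and j: "j < r" and X: "X \<in> Sec" and Y: "Y \<in> Sec"
  shows "(\<lambda>f. if f \<in> \<A> then frame_coef es j p (symbol f X Y p) else 0) \<in> tangent_space M p"
  unfolding tangent_space_def dual_space_def lin_on_def
  using frame_coef_add[OF fr j] frame_coef_scaleR[OF fr j] section_in_fibre[OF symbol_mem[OF _ X Y]]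
    subspace_mul[OF subspace_fibre]
  by (auto simp: smooth_funs_add smooth_funs_scaleR smooth_funs_mult symbol_add_fun[OF _ _ X Y]
      symbol_scaleR_fun[OF _ X Y] symbol_mult_fun[OF _ _ X Y] scaleR_fun_def[of _ "symbol _ _ _"])

lemma symbol_expand:
  assumes c: "(V, \<phi>) \<in> charts M" and W: "open W" "p \<in> W" "W \<subseteq> V"
    and \<zeta>: "\<And>i. i < n \<Longrightarrow> \<zeta> i \<in> \<A>" "\<And>i q. i < n \<Longrightarrow> q \<in> W \<Longrightarrow> \<zeta> i q = \<phi> q i"
    and f: "f \<in> \<A>" and X: "X \<in> Sec" and Y: "Y \<in> Sec"
  shows "symbol f X Y p = (\<Sum>i<n. coord_vec M V \<phi> i p f *\<^sub>R symbol (\<zeta> i) X Y p)"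
proof -
  obtain U es where fr: "(U, es) \<in> frames E" "p \<in> U" by (rule frame_exists)
  note mem = section_in_fibre[OF symbol_mem[OF _ X Y]]
  note ex = dual_basis_expand[OF frame_dual_basis[OF fr] mem]
  have co: "frame_coef es j p (symbol f X Y p) =
      (\<Sum>i<n. frame_coef es j p (symbol (\<zeta> i) X Y p) * coord_vec M V \<phi> i p f)" if j: "j < r" for j
    using tangent_expansion_fun[OF c W \<zeta> symbol_tangent[OF fr j X Y] f] f \<zeta>(1) by simp
  have "symbol f X Y p = (\<Sum>j<r. frame_coef es j p (symbol f X Y p) *\<^sub>R (es ! j) p)" using ex[OF f] by simp
  also have "\<dots> = (\<Sum>j<r. \<Sum>i<n. coord_vec M V \<phi> i p f *\<^sub>R frame_coef es j p (symbol (\<zeta> i) X Y p) *\<^sub>R (es ! j) p)"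
    by (intro sum.cong) (auto simp: co scaleR_sum_left mult.commute)
  also have "\<dots> = (\<Sum>i<n. coord_vec M V \<phi> i p f *\<^sub>R
      (\<Sum>j<r. frame_coef es j p (symbol (\<zeta> i) X Y p) *\<^sub>R (es ! j) p))"
    by (subst sum.swap) (simp add: scaleR_sum_right)
  also have "\<dots> = (\<Sum>i<n. coord_vec M V \<phi> i p f *\<^sub>R symbol (\<zeta> i) X Y p)"
    using ex[OF \<zeta>(1)] by (intro sum.cong) auto
  finally show ?thesis .
qed

text \<open>At \<open>p\<close> the symbol depends on \<open>f\<close> only through its coordinate
  derivatives and on X only through its value, so it is the action of a tensor on df and
  X(p).\<close>

lemma alpha_exists:
  assumes Y: "Y \<in> Sec"
  shows "\<exists>t. t \<in> TE p \<and> (\<forall>f\<in>\<A>. \<forall>X\<in>Sec. act p t (differential M f p) (X p) = symbol f X Y p)"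
proof -
  obtain U es where fr: "(U, es) \<in> frames E" "p \<in> U" by (rule frame_exists)
  obtain V \<phi> where c: "(V, \<phi>) \<in> charts M" "p \<in> V" by (rule chart_exists)
  obtain \<zeta> W where \<zeta>: "\<And>i. i < n \<Longrightarrow> \<zeta> i \<in> \<A>" "open W" "p \<in> W" "W \<subseteq> V"
    "\<And>i q. i < n \<Longrightarrow> q \<in> W \<Longrightarrow> \<zeta> i q = \<phi> q i"
    using global_coordinates[OF c] by blast
  obtain e where e: "\<And>k. k < r \<Longrightarrow> e k \<in> Sec" "\<And>k. k < r \<Longrightarrow> e k p = (es ! k) p"
  proof -
    obtain e W' where "\<And>j. j < r \<Longrightarrow> e j \<in> Sec" "p \<in> W'" "\<And>j q. j < r \<Longrightarrow> q \<in> W' \<Longrightarrow> e j q = (es ! j) q"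
      using global_frame[OF fr] by metis
    then show ?thesis using that[of e] by blast
  qed
  note S = tangent_dual_basis[OF c] and F = frame_dual_basis[OF fr]
  \<comment> \<open>By \<open>tensor_expand\<close> this is the only possible choice: the tensor has
    to send d\<zeta>_i and e_k to the symbol of \<zeta>_i on e_k.\<close>
  define C where "C i j k = frame_coef es j p (symbol (\<zeta> i) (e k) Y p)" for i j k
  define t where "t = (\<Sum>i<n. \<Sum>j<r. \<Sum>k<r. C i j k *\<^sub>R pure_tensor (tangent_space M p) (endo_space (fibre E p))
    (coord_vec M V \<phi> i p) (matrix_unit (\<lambda>j. (es ! j) p) (\<lambda>j. frame_coef es j p) j k))"
  have "act p t (differential M f p) (X p) = symbol f X Y p" if f: "f \<in> \<A>" and X: "X \<in> Sec" for f X
  proof -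
    have lin: "lin_on Sec UNIV (\<lambda>X. symbol (\<zeta> i) X Y p)" if "i < n" for i
      unfolding lin_on_def
      by (auto simp: symbol_add_1[OF \<zeta>(1)[OF that] _ _ Y] symbol_scaleR_1[OF \<zeta>(1)[OF that] _ Y]
          scaleR_fun_def[of _ "symbol _ _ _"])
    \<comment> \<open>The coefficients are frozen at \<open>p\<close>, so \<open>Z\<close> is a real
      linear combination of global sections. It may replace X since the symbol at \<open>p\<close>
      sees only X(p), and then linearity over the reals expands it.\<close>
    define Z where "Z = (\<Sum>k<r. frame_coef es k p (X p) *\<^sub>R e k)"
    have Z: "Z \<in> Sec" unfolding Z_def using e(1)
        by (intro subspace_sum[OF subspace_sections] sections_scaleR) auto
    have Zp: "Z p = X p"
      using dual_basis_expand[OF F section_in_fibre[OF X]] e(2)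
          by (simp add: Z_def sum_fun_apply scaleR_fun_def)
    have X\<zeta>: "symbol (\<zeta> i) X Y p = (\<Sum>k<r. frame_coef es k p (X p) *\<^sub>R symbol (\<zeta> i) (e k) Y p)" if "i < n" for i
    proof -
      have "symbol (\<zeta> i) X Y p = symbol (\<zeta> i) Z Y p"
        using Zp by (intro symbol_cong[OF \<zeta>(1)[OF that] X Z Y Y]) auto
      also have "\<dots> = (\<Sum>k<r. frame_coef es k p (X p) *\<^sub>R symbol (\<zeta> i) (e k) Y p)"
        unfolding Z_def using e(1) by (intro lin_on_sum[OF lin[OF that] subspace_sections]) auto
      finally show ?thesis .
    qed
    have "act p t (differential M f p) (X p) =
        (\<Sum>i<n. \<Sum>k<r. (differential M f p (coord_vec M V \<phi> i p) * frame_coef es k p (X p)) *\<^sub>R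
          (\<Sum>j<r. C i j k *\<^sub>R (es ! j) p))"
      by (rule tensor_action_sum(2)[OF S F differential_in_dual_space section_in_fibre[OF X] t_def])
    also have "\<dots> = (\<Sum>i<n. \<Sum>k<r. (coord_vec M V \<phi> i p f * frame_coef es k p (X p)) *\<^sub>R symbol (\<zeta> i) (e k) Y p)"
    proof (intro sum.cong refl)
      fix i k assume "i \<in> {..<n}" "k \<in> {..<r}"
      then have "symbol (\<zeta> i) (e k) Y \<in> Sec" using \<zeta>(1) e(1) Y by (intro symbol_mem) auto
      then have "(\<Sum>j<r. C i j k *\<^sub>R (es ! j) p) = symbol (\<zeta> i) (e k) Y p"
        unfolding C_def by (rule dual_basis_expand[OF F section_in_fibre])
      moreover have "coord_vec M V \<phi> i p \<in> tangent_space M p"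
        using coord_vec_in_tangent_space[OF c] \<open>i \<in> _\<close> by simp
      ultimately show "(differential M f p (coord_vec M V \<phi> i p) * frame_coef es k p (X p)) *\<^sub>R
          (\<Sum>j<r. C i j k *\<^sub>R (es ! j) p) =
          (coord_vec M V \<phi> i p f * frame_coef es k p (X p)) *\<^sub>R symbol (\<zeta> i) (e k) Y p"
        by (simp add: differential_def)
    qed
    also have "\<dots> = (\<Sum>i<n. coord_vec M V \<phi> i p f *\<^sub>R symbol (\<zeta> i) X Y p)"
      by (intro sum.cong refl) (simp add: X\<zeta> scaleR_sum_right)
    also have "\<dots> = symbol f X Y p"
      by (rule symbol_expand[OF c(1) \<zeta>(2-4) \<zeta>(1,5) f X Y, symmetric])
    finally show ?thesis .
  qed
  moreover have "t \<in> TE p"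
    by (rule tensor_action_sum(1)[OF S F differential_in_dual_space section_in_fibre[OF Y] t_def])
  ultimately show ?thesis by blast
qed

text \<open>The tensor is required to fit every section through \<open>y\<close> at once. This can
  be met because the symbol at \<open>p\<close> depends only on Y(p), and \<open>TE_eqI\<close>
  leaves at most one such tensor when \<open>y\<close> lies in the fibre.\<close>

definition alpha :: "'m \<Rightarrow> 'v \<Rightarrow> ('m tvec \<Rightarrow> ('v \<Rightarrow> 'v) \<Rightarrow> real) \<Rightarrow> real"
  where "alpha p y = (SOME t. t \<in> TE p \<and> (\<forall>Y\<in>Sec. Y p = y \<longrightarrow>
    (\<forall>f\<in>\<A>. \<forall>X\<in>Sec. act p t (differential M f p) (X p) = symbol f X Y p)))"

lemma alpha_props:
  assumes Y: "Y \<in> Sec"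
  shows alpha_mem: "alpha p (Y p) \<in> TE p"
    and alpha_act: "f \<in> \<A> \<Longrightarrow> X \<in> Sec \<Longrightarrow>
      act p (alpha p (Y p)) (differential M f p) (X p) = symbol f X Y p"
proof -
  obtain t where t: "t \<in> TE p" "\<forall>f\<in>\<A>. \<forall>X\<in>Sec. act p t (differential M f p) (X p) = symbol f X Y p"
    using alpha_exists[OF Y] by blast
  have "act p t (differential M f p) (X p) = symbol f X Y' p"
    if "Y' \<in> Sec" "Y' p = Y p" "f \<in> \<A>" "X \<in> Sec" for Y' f X
    using t(2) that symbol_cong[OF that(3,4,4) Y that(1), of p] by simp
  then have "\<exists>t. t \<in> TE p \<and> (\<forall>Y'\<in>Sec. Y' p = Y p \<longrightarrow>
      (\<forall>f\<in>\<A>. \<forall>X\<in>Sec. act p t (differential M f p) (X p) = symbol f X Y' p))"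
    using t(1) by blast
  from someI_ex[OF this, folded alpha_def] Y show "alpha p (Y p) \<in> TE p"
    "f \<in> \<A> \<Longrightarrow> X \<in> Sec \<Longrightarrow> act p (alpha p (Y p)) (differential M f p) (X p) = symbol f X Y p"
    by blast+
qed

text \<open>Values of \<open>alpha\<close> come from unrelated choices, so the equations are checked
  with \<open>TE_eqI\<close>: both sides act alike because the symbol is linear in its last
  argument.\<close>

lemma alpha_linear: "lin_on (fibre E p) (TE p) (alpha p)"
  unfolding lin_on_def
proof (intro conjI ballI allI)
  note sub = subspace_tensor_space[of "tangent_space M p" "endo_space (fibre E p)"]
  fix y assume y: "y \<in> fibre E p"
  obtain Y where Y: "Y \<in> Sec" "Y p = y" using section_through[OF y] .
  have ym: "alpha p y \<in> TE p" using alpha_mem[OF Y(1), of p] Y(2) by simp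
  then show "alpha p y \<in> TE p" .
  have ya: "act p (alpha p y) (differential M f p) (X p) = symbol f X Y p" if "f \<in> \<A>" "X \<in> Sec" for f X
    using alpha_act[OF Y(1) that, of p] Y(2) by simp
  show "alpha p (c *\<^sub>R y) = c *\<^sub>R alpha p y" for c
  proof (rule TE_eqI)
    have cy: "(c *\<^sub>R Y) p = c *\<^sub>R y" using Y(2) by (simp add: scaleR_fun_def)
    show "alpha p (c *\<^sub>R y) \<in> TE p" using alpha_mem[OF sections_scaleR[OF Y(1), of c], of p] unfolding cy .
    show "c *\<^sub>R alpha p y \<in> TE p" using subspace_mul[OF sub ym] .
    fix f X assume f: "f \<in> \<A>" and X: "X \<in> Sec"
    have "act p (alpha p (c *\<^sub>R y)) (differential M f p) (X p) = symbol f X (c *\<^sub>R Y) p"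
      using alpha_act[OF sections_scaleR[OF Y(1), of c] f X, of p] unfolding cy .
    also have "\<dots> = c *\<^sub>R symbol f X Y p" using symbol_scaleR_2[OF f X Y(1)] by (simp add: scaleR_fun_def)
    also have "\<dots> = act p (c *\<^sub>R alpha p y) (differential M f p) (X p)"
      using lin_on_scaleR[OF act_lin_left[OF differential_in_dual_space section_in_fibre[OF X]] ym, of
          c] ya[OF f X] by simp
    finally show "act p (alpha p (c *\<^sub>R y)) (differential M f p) (X p) =
        act p (c *\<^sub>R alpha p y) (differential M f p) (X p)" .
  qed
  fix z assume z: "z \<in> fibre E p"
  obtain Z where Z: "Z \<in> Sec" "Z p = z" using section_through[OF z] .
  have zm: "alpha p z \<in> TE p" using alpha_mem[OF Z(1), of p] Z(2) by simp
  have za: "act p (alpha p z) (differential M f p) (X p) = symbol f X Z p" if "f \<in> \<A>" "X \<in> Sec" for f X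
    using alpha_act[OF Z(1) that, of p] Z(2) by simp
  show "alpha p (y + z) = alpha p y + alpha p z"
  proof (rule TE_eqI)
    have yz: "(Y + Z) p = y + z" using Y(2) Z(2) by simp
    show "alpha p (y + z) \<in> TE p" using alpha_mem[OF sections_add[OF Y(1) Z(1)], of p] unfolding yz .
    show "alpha p y + alpha p z \<in> TE p" using subspace_add[OF sub ym zm] .
    fix f X assume f: "f \<in> \<A>" and X: "X \<in> Sec"
    have "act p (alpha p (y + z)) (differential M f p) (X p) = symbol f X (Y + Z) p"
      using alpha_act[OF sections_add[OF Y(1) Z(1)] f X, of p] unfolding yz .
    also have "\<dots> = symbol f X Y p + symbol f X Z p" using symbol_add_2[OF f X Y(1) Z(1)] by simp
    also have "\<dots> = act p (alpha p y + alpha p z) (differential M f p) (X p)"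
      using lin_on_add[OF act_lin_left[OF differential_in_dual_space section_in_fibre[OF X]] ym zm]
          ya[OF f X] za[OF f X] by simp
    finally show "act p (alpha p (y + z)) (differential M f p) (X p) =
        act p (alpha p y + alpha p z) (differential M f p) (X p)" .
  qed
qed

text \<open>Near each point of a frame domain the frame section can be replaced by a global section
  X, and the tested coefficients become those of \<open>symbol f Z X\<close>, a smooth
  section.\<close>

lemma alpha_morphism: "vb_morphism M E (tensor_bundle (tangent_bundle M) (endo_bundle E)) alpha"
  unfolding vb_morphism_def
proof (intro conjI allI)
  show "lin_on (fibre E p) (fibre (tensor_bundle (tangent_bundle M) (endo_bundle E)) p) (alpha p)" for p
    using alpha_linear by (simp add: tensor_bundle_def tangent_bundle_def endo_bundle_def)
  have "smooth_section_on M (tensor_bundle (tangent_bundle M) (endo_bundle E)) U (\<lambda>p. alpha p (e p))"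
    if fr: "(U, es) \<in> frames E" and e: "e \<in> set es" for U es e
  proof (rule smooth_tensor_sectionI[OF frame_open[OF fr]])
    note es = frame_smooth[OF fr e]
    show "alpha q (e q) \<in> TE q" if "q \<in> U" for q
      using es that lin_on_mem[OF alpha_linear] by (simp add: smooth_section_on_def)
    fix f Z U' es' j
    assume f: "f \<in> \<A>" and Z: "Z \<in> Sec" and fr': "(U', es') \<in> frames E" and j: "j < r"
    show "smooth_fun_on M (U \<inter> U') (\<lambda>q. frame_coef es' j q (act q (alpha q (e q)) (differential M f q) (Z q)))"
      (is "smooth_fun_on M _ ?g")
    proof (rule smooth_fun_on_local[OF open_Int[OF frame_open[OF fr] frame_open[OF fr']]])
      fix p assume p: "p \<in> U \<inter> U'"
      then obtain X W' where X: "X \<in> Sec" "open W'" "p \<in> W'" "W' \<subseteq> U" "\<And>q. q \<in> W' \<Longrightarrow> X q = e q"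
        using local_section_extension[OF frame_open[OF fr] _ es] by blast
      have o: "open (W' \<inter> U')" using X(2) frame_open[OF fr'] by blast
      have "smooth_fun_on M (W' \<inter> U') (\<lambda>q. frame_coef es' j q (symbol f Z X q))"
        by (rule smooth_fun_on_subset[OF _ section_coef_smooth[OF symbol_mem[OF f Z X(1)] fr' j]]) blast
      then have "smooth_fun_on M (W' \<inter> U') ?g"
      proof (rule smooth_fun_on_cong[OF o, rotated])
        show "frame_coef es' j q (symbol f Z X q) = ?g q" if "q \<in> W' \<inter> U'" for q
          using alpha_act[OF X(1) f Z, of q] X(5)[of q] that by simp
      qed
      then show "\<exists>W'. open W' \<and> p \<in> W' \<and> smooth_fun_on M W' ?g"
        using o p X(3) by (intro exI[of _ "W' \<inter> U'"]) auto
    qed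
  qed
  then show "\<forall>(U, es)\<in>frames E. \<forall>e\<in>set es.
      smooth_section_on M (tensor_bundle (tangent_bundle M) (endo_bundle E)) U (\<lambda>p. alpha p (e p))"
    by blast
qed

lemma anchor_conditions_rho_alpha: "anchor_conditions M E br rho alpha"
  unfolding anchor_conditions_def
proof (intro conjI ballI rho_morphism alpha_morphism)
  fix X Y f assume X: "X \<in> Sec" and Y: "Y \<in> Sec" and f: "f \<in> \<A>"
  show "br X (f \<cdot>\<^sub>s Y) = f \<cdot>\<^sub>s br X Y + (\<lambda>p. rho p (X p) f) \<cdot>\<^sub>s Y"
    unfolding br_fmult_right[OF X f Y] rho_eq[OF X f] by simp
  show "br (f \<cdot>\<^sub>s X) Y = f \<cdot>\<^sub>s br X Y - (\<lambda>p. rho p (Y p) f) \<cdot>\<^sub>s X +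
      (\<lambda>p. act p (alpha p (Y p)) (differential M f p) (X p))"
    unfolding alpha_act[OF Y f X] rho_eq[OF Y f] symbol_def by (simp add: fun_eq_iff)
qed

end

text \<open>Frames are empty lists and all sections vanish, so smoothness of the images of frame
  sections is vacuous and both Leibniz rules read 0 = 0.\<close>

lemma (in loday_vb) rank_zero_anchor_conditions:
  assumes r: "r = 0" shows "anchor_conditions M E br (\<lambda>p x. 0) (\<lambda>p x. 0)"
  unfolding anchor_conditions_def vb_morphism_def
proof (intro conjI ballI allI)
  have nil: "es = []" if "(U, es) \<in> frames E" for U es using frame_length[OF that] r by simp
  show "lin_on (fibre E p) (fibre (tangent_bundle M) p) (\<lambda>x. 0)" for p
    using subspace_0[OF subspace_tangent_space] by (simp add: lin_on_def tangent_bundle_def)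
  show "lin_on (fibre E p) (fibre (tensor_bundle (tangent_bundle M) (endo_bundle E)) p) (\<lambda>x. 0)" for p
    by (simp add: lin_on_def tensor_bundle_def subspace_0[OF subspace_tensor_space])
  show "case u of (U, es) \<Rightarrow> \<forall>e\<in>set es. smooth_section_on M (tangent_bundle M) U (\<lambda>p. 0)"
    if "u \<in> frames E" for u using that nil by fastforce
  show "case u of (U, es) \<Rightarrow> \<forall>e\<in>set es.
      smooth_section_on M (tensor_bundle (tangent_bundle M) (endo_bundle E)) U (\<lambda>p. 0)"
    if "u \<in> frames E" for u using that nil by fastforce
  fix X Y f assume X: "X \<in> Sec" and Y: "Y \<in> Sec" and f: "f \<in> \<A>"
  note z = br_rank_zero[OF r] rank_zero_section[OF r] sections_fmult[OF f]
  have "act p 0 (differential M f p) (X p) = 0" for p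
    using lin_on_zero[OF act_lin_left[OF differential_in_dual_space section_in_fibre[OF X]]
        subspace_tensor_space] .
  then show "br (f \<cdot>\<^sub>s X) Y = f \<cdot>\<^sub>s br X Y - (\<lambda>p. 0 f) \<cdot>\<^sub>s X + (\<lambda>p. act p 0 (differential M f p) (X p))"
    using z(1)[OF z(3)[OF X] Y] z(1)[OF X Y] by (simp add: fmult_def fun_eq_iff)
  show "br X (f \<cdot>\<^sub>s Y) = f \<cdot>\<^sub>s br X Y + (\<lambda>p. 0 f) \<cdot>\<^sub>s Y"
    using z(1)[OF X z(3)[OF Y]] z(1)[OF X Y] by (simp add: fmult_def fun_eq_iff)
qed

theorem theorem4p8:
  fixes M :: "'m::{t2_space,second_countable_topology} mfd"
    and E :: "('m, 'v::real_vector) vbundle"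
    and r :: nat
    and br :: "('m, 'v) bracket"
  assumes "smooth_manifold M"
    and "smooth_vector_bundle M r E"
    and "loday_bracket (sections M E) br"
  shows "(loday_algebroid M E br \<longleftrightarrow> (\<exists>\<rho> \<alpha>. anchor_conditions M E br \<rho> \<alpha>)) \<and>
    (\<forall>\<rho> \<alpha> \<rho>' \<alpha>'. anchor_conditions M E br \<rho> \<alpha> \<and> anchor_conditions M E br \<rho>' \<alpha>' \<longrightarrow>
      (\<forall>p. \<forall>x\<in>fibre E p. \<rho> p x = \<rho>' p x \<and> \<alpha> p x = \<alpha>' p x)) \<and>
    (\<forall>\<rho> \<alpha>. anchor_conditions M E br \<rho> \<alpha> \<longrightarrow>
      (\<forall>X\<in>sections M E. \<forall>Y\<in>sections M E.
        (\<lambda>p. \<rho> p (br X Y p)) = lie_bracket_vf (\<lambda>p. \<rho> p (X p)) (\<lambda>p. \<rho> p (Y p))))"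
proof -
  interpret loday_vb M E r br by unfold_locales (fact assms)+
  have "\<exists>\<rho> \<alpha>. anchor_conditions M E br \<rho> \<alpha>" if L: "loday_algebroid M E br"
  proof (cases "r = 0")
    case True
    then show ?thesis using rank_zero_anchor_conditions by blast
  next
    case False
    interpret loday_algebroid_vb M E r br
      using L False by unfold_locales (auto simp: loday_algebroid_def)
    show ?thesis using anchor_conditions_rho_alpha by blast
  qed
  moreover have "loday_algebroid M E br" if "anchor_conditions M E br \<rho> \<alpha>" for \<rho> \<alpha>
    by (rule anchor_imp_loday_algebroid[OF that])
  moreover have "\<rho> p x = \<rho>' p x \<and> \<alpha> p x = \<alpha>' p x"
    if "anchor_conditions M E br \<rho> \<alpha>" "anchor_conditions M E br \<rho>' \<alpha>'" "x \<in> fibre E p" for \<rho> \<alpha> \<rho>' \<alpha>' p x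
    using anchors_unique[OF that] by blast
  moreover have "(\<lambda>p. \<rho> p (br X Y p)) = lie_bracket_vf (\<lambda>p. \<rho> p (X p)) (\<lambda>p. \<rho> p (Y p))"
    if "anchor_conditions M E br \<rho> \<alpha>" "X \<in> sections M E" "Y \<in> sections M E" for \<rho> \<alpha> X Y
    by (rule rho_hom[OF that])
  ultimately show ?thesis by blast
qed

end
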